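(* Let $\mathcal{H}$ be a separable, infinite dimensional, complex Hilbert space, let $\mathscr{U}$ be a free ultrafilter on $\mathbb{N}$, and let $T_{1},T_{2}\in\mathcal{B}(\mathcal{H})$. Then $T_{1}$ and $T_{2}$ are approximately unitarily equivalent if and only if the ultrapowers $T_{1}^{\mathscr{U}}$ and $T_{2}^{\mathscr{U}}$ are unitarily equivalent.
   Context: Let $\mathcal{H}^{\mathscr{U}}=\ell_\infty(\mathcal{H})/\{(x_n)_{n\ge1}\in\ell_\infty(\mathcal{H}):\lim_{n,\mathscr{U}}\|x_n\|=0\}$, with the image of $(x_n)$ denoted $(x_n)_{\mathscr{U}}$; it is a Hilbert space with inner product $\langle (x_n)_{\mathscr{U}},(y_n)_{\mathscr{U}}\rangle=\lim_{n,\mathscr{U}}\langle x_n,y_n\rangle$. For $T\in\mathcal{B}(\mathcal{H})$, the ultrapower $T^{\mathscr{U}}\in\mathcal{B}(\mathcal{H}^{\mathscr{U}})$ is $(x_n)_{\mathscr{U}}\mapsto(Tx_n)_{\mathscr{U}}$. Operators $T_1,T_2\in\mathcal{B}(\mathcal{H})$ are approximately unitarily equivalent if there are unitaries $W_n$ on $\mathcal{H}$ with $T_2-W_nT_1W_n^{*}$ compact for all $n$ and $\|T_2-W_nT_1W_n^{*}\|\to0$. *)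

theory Defs
  imports "HOL-Analysis.Analysis"
begin

class chilbert = banach +
  fixes scaleC :: "complex \<Rightarrow> 'a \<Rightarrow> 'a"
    and cinner :: "'a \<Rightarrow> 'a \<Rightarrow> complex"
  assumes scaleC_add_right: "scaleC a (x + y) = scaleC a x + scaleC a y"
    and scaleC_add_left: "scaleC (a + b) x = scaleC a x + scaleC b x"
    and scaleC_scaleC: "scaleC a (scaleC b x) = scaleC (a * b) x"
    and scaleC_one: "scaleC 1 x = x"
    and scaleR_scaleC: "scaleR r x = scaleC (complex_of_real r) x"
    and cinner_commute: "cinner x y = cnj (cinner y x)"
    and cinner_add_left: "cinner (x + y) z = cinner x z + cinner y z"
    and cinner_scaleC_left: "cinner (scaleC a x) y = a * cinner x y"
    and cinner_self_norm: "cinner x x = complex_of_real ((norm x)^2)"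

definition cspan :: "'a::chilbert set \<Rightarrow> 'a set" where
  "cspan S = {y. \<exists>F c. finite F \<and> F \<subseteq> S \<and> y = (\<Sum>x\<in>F. scaleC (c x) x)}"

definition bounded_clinear :: "('a::chilbert \<Rightarrow> 'a) \<Rightarrow> bool" where
  "bounded_clinear T \<longleftrightarrow>
     (\<forall>x y. T (x + y) = T x + T y) \<and> (\<forall>a x. T (scaleC a x) = scaleC a (T x)) \<and>
     (\<exists>K. \<forall>x. norm (T x) \<le> norm x * K)"

definition is_cadjoint :: "('a::chilbert \<Rightarrow> 'a) \<Rightarrow> ('a \<Rightarrow> 'a) \<Rightarrow> bool" where
  "is_cadjoint V W \<longleftrightarrow> (\<forall>x y. cinner (V x) y = cinner x (W y))"

definition cadjoint :: "('a::chilbert \<Rightarrow> 'a) \<Rightarrow> ('a \<Rightarrow> 'a)" where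
  "cadjoint W = (THE V. is_cadjoint V W)"

definition unitary_op :: "('a::chilbert \<Rightarrow> 'a) \<Rightarrow> bool" where
  "unitary_op W \<longleftrightarrow> bounded_clinear W \<and>
     (\<exists>V. is_cadjoint V W \<and> V \<circ> W = id \<and> W \<circ> V = id)"

definition compact_op :: "('a::chilbert \<Rightarrow> 'a) \<Rightarrow> bool" where
  "compact_op T \<longleftrightarrow> compact (closure (T ` cball 0 1))"

definition approx_unitarily_equivalent :: "('a::chilbert \<Rightarrow> 'a) \<Rightarrow> ('a \<Rightarrow> 'a) \<Rightarrow> bool" where
  "approx_unitarily_equivalent T1 T2 \<longleftrightarrow>
     (\<exists>W :: nat \<Rightarrow> 'a \<Rightarrow> 'a.
        (\<forall>n. unitary_op (W n) \<and> compact_op (\<lambda>x. T2 x - W n (T1 (cadjoint (W n) x)))) \<and>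
        (\<lambda>n. onorm (\<lambda>x. T2 x - W n (T1 (cadjoint (W n) x)))) \<longlonglongrightarrow> 0)"

definition free_ultrafilter :: "nat filter \<Rightarrow> bool" where
  "free_ultrafilter U \<longleftrightarrow> U \<noteq> bot \<and>
     (\<forall>P. eventually P U \<or> eventually (\<lambda>n. \<not> P n) U) \<and>
     (\<forall>m. eventually (\<lambda>n. n \<noteq> m) U)"

text \<open>Elements of the ultrapower are represented by bounded sequences,
two sequences representing the same element iff their difference is U-null.\<close>

definition bseq :: "(nat \<Rightarrow> 'a::chilbert) \<Rightarrow> bool" where
  "bseq X \<longleftrightarrow> bounded (range X)"

definition unull :: "nat filter \<Rightarrow> (nat \<Rightarrow> 'a::chilbert) \<Rightarrow> bool" where
  "unull U X \<longleftrightarrow> ((\<lambda>n. norm (X n)) \<longlongrightarrow> 0) U"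

definition ulim :: "nat filter \<Rightarrow> (nat \<Rightarrow> 'b::t2_space) \<Rightarrow> 'b" where
  "ulim U f = Lim U f"

definition uop :: "('a::chilbert \<Rightarrow> 'a) \<Rightarrow> (nat \<Rightarrow> 'a) \<Rightarrow> (nat \<Rightarrow> 'a)" where
  "uop T X = (\<lambda>n. T (X n))"

text \<open>A map on representatives that induces a bounded linear operator on the ultrapower.\<close>
definition ultra_bounded_clinear ::
  "nat filter \<Rightarrow> ((nat \<Rightarrow> 'a::chilbert) \<Rightarrow> (nat \<Rightarrow> 'a)) \<Rightarrow> bool" where
  "ultra_bounded_clinear U F \<longleftrightarrow>
     (\<forall>X. bseq X \<longrightarrow> bseq (F X)) \<and>
     (\<forall>X Y. bseq X \<and> bseq Y \<and> unull U (\<lambda>n. X n - Y n) \<longrightarrow> unull U (\<lambda>n. F X n - F Y n)) \<and>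
     (\<forall>X Y. bseq X \<and> bseq Y \<longrightarrow> unull U (\<lambda>n. F (\<lambda>k. X k + Y k) n - F X n - F Y n)) \<and>
     (\<forall>a X. bseq X \<longrightarrow> unull U (\<lambda>n. F (\<lambda>k. scaleC a (X k)) n - scaleC a (F X n))) \<and>
     (\<exists>K. \<forall>X. bseq X \<longrightarrow> ulim U (\<lambda>n. norm (F X n)) \<le> K * ulim U (\<lambda>n. norm (X n)))"

text \<open>T1^U and T2^U are unitarily equivalent: there is a unitary W on the
ultrapower (represented by F, with adjoint represented by G) such that
T2^U = W T1^U W^*.\<close>
definition ultra_unitarily_equivalent ::
  "nat filter \<Rightarrow> ('a::chilbert \<Rightarrow> 'a) \<Rightarrow> ('a \<Rightarrow> 'a) \<Rightarrow> bool" where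
  "ultra_unitarily_equivalent U T1 T2 \<longleftrightarrow>
     (\<exists>F G. ultra_bounded_clinear U F \<and> ultra_bounded_clinear U G \<and>
        (\<forall>X Y. bseq X \<and> bseq Y \<longrightarrow>
            ulim U (\<lambda>n. cinner (G X n) (Y n)) = ulim U (\<lambda>n. cinner (X n) (F Y n))) \<and>
        (\<forall>X. bseq X \<longrightarrow> unull U (\<lambda>n. G (F X) n - X n)) \<and>
        (\<forall>X. bseq X \<longrightarrow> unull U (\<lambda>n. F (G X) n - X n)) \<and>
        (\<forall>X. bseq X \<longrightarrow> unull U (\<lambda>n. uop T2 X n - F (uop T1 (G X)) n)))"

end

(*
Let W be a unitary on the ultrapower with T2^U = W T1^U W*. Inside the ultrapower, the closed span K
of H and W* H is separable and reduces T1^U to an operator R. With respect to H and to W* H the operator R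
splits as T1 + S1 and as T2 + S2, where S1 and S2 live on weakly null sequences for T1 and T2.
By the absorption argument of Voiculescu's theorem T1 + S1 is approximately equivalent to T1,
and T2 + S2 to T2, modulo small compact operators; hence so are T1 and T2.

Absorption needs no general theory: on a sequence closed under R and R*, Gram-Schmidt makes S1
block tridiagonal, so functions of the block number that vary slowly almost commute with S1.
The ultrapower is never formed as a space. K is realised inside H by the limits of Gram-Schmidt
coefficients, and operators on it are obtained as weak limits along U.
*)
theory Submission
  imports Defs
begin

section \<open>Hilbert space basics and adjoints\<close>

text \<open>The obstacle is that a unitary on the ultrapower need not come from a sequence of
  unitaries on H, so nothing can be read off coordinatewise; only its effect on separable pieces is
  accessible. Spanning both H and W* H makes one operator R visible from both sides. Absorption
  rests on infinite repetition. Infinitely many copies of S are almost intertwined with T by an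
  isometry V, and they absorb one more S by a shift of the copies. The adjoints have to be almost
  intertwined as well, since the shift acts on H through both V and its adjoint. The copies exist
  because vectors of the ultrapower orthogonal to the constants are weakly null, hence can be moved
  off any finite set. A logarithm in the partition of unity lets its n-th function live on about 2^n
  blocks, up to a constant factor, so that its variation is of order 2^-n and the errors are
  summable. The number 3 counts the cases in an enumeration of generators closed under R and its
  adjoint. The converse is direct: the approximating unitaries, applied coordinatewise, form a
  unitary on the ultrapower.\<close>

lemma cinner_add_right: "cinner x (y + z) = cinner x y + cinner x (z::'a::chilbert)"
  by (metis cinner_add_left cinner_commute complex_cnj_add)

lemma cinner_scaleC_right: "cinner x (scaleC a y) = cnj a * cinner x (y::'a::chilbert)"
  by (metis cinner_commute cinner_scaleC_left complex_cnj_mult)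

lemma cinner_scaleR_left: "cinner (r *\<^sub>R x) y = of_real r * cinner x (y::'a::chilbert)"
  by (simp add: scaleR_scaleC cinner_scaleC_left)

lemma cinner_scaleR_right: "cinner x (r *\<^sub>R y) = of_real r * cinner x (y::'a::chilbert)"
  by (simp add: scaleR_scaleC cinner_scaleC_right)

lemma cinner_minus_left: "cinner (- x) y = - cinner x (y::'a::chilbert)"
  using cinner_scaleR_left[of "-1" x y] by simp

lemma cinner_minus_right: "cinner x (- y) = - cinner x (y::'a::chilbert)"
  using cinner_scaleR_right[of x "-1" y] by simp

lemma cinner_diff_left: "cinner (x - y) z = cinner x z - cinner y (z::'a::chilbert)"
  by (metis add_uminus_conv_diff cinner_add_left cinner_minus_left)

lemma cinner_diff_right: "cinner x (y - z) = cinner x y - cinner x (z::'a::chilbert)"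
  by (metis add_uminus_conv_diff cinner_add_right cinner_minus_right)

lemma cinner_zero_left [simp]: "cinner 0 (y::'a::chilbert) = 0"
  using cinner_scaleR_left[of 0 0 y] by simp

lemma cinner_zero_right [simp]: "cinner (y::'a::chilbert) 0 = 0"
  using cinner_scaleR_right[of y 0 0] by simp

lemma cinner_sum_left: "cinner (\<Sum>i\<in>A. f i) (y::'a::chilbert) = (\<Sum>i\<in>A. cinner (f i) y)"
  by (induction A rule: infinite_finite_induct) (auto simp: cinner_add_left)

lemma cinner_sum_right: "cinner (y::'a::chilbert) (\<Sum>i\<in>A. f i) = (\<Sum>i\<in>A. cinner y (f i))"
  by (induction A rule: infinite_finite_induct) (auto simp: cinner_add_right)

lemmas cinner_simps = cinner_add_left cinner_add_right cinner_diff_left cinner_diff_right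
  cinner_scaleC_left cinner_scaleC_right cinner_scaleR_left cinner_scaleR_right
  cinner_minus_left cinner_minus_right cinner_sum_left cinner_sum_right

lemma cinner_eq_zero_iff [simp]: "cinner x x = 0 \<longleftrightarrow> x = (0::'a::chilbert)"
  by (simp add: cinner_self_norm)

lemma Re_cinner_self: "Re (cinner x x) = (norm (x::'a::chilbert))\<^sup>2"
  by (simp add: cinner_self_norm)

lemma cinner_eqI: "(\<And>z. cinner x z = cinner y z) \<Longrightarrow> x = (y::'a::chilbert)"
  by (metis cinner_diff_left cinner_eq_zero_iff eq_iff_diff_eq_0)

lemma scaleC_zero_left [simp]: "scaleC 0 (x::'a::chilbert) = 0"
  by (rule cinner_eqI) (simp add: cinner_simps)

lemma scaleC_zero_right [simp]: "scaleC a (0::'a::chilbert) = 0"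
  by (rule cinner_eqI) (simp add: cinner_simps)

lemma scaleC_minus_one: "scaleC (-1) (x::'a::chilbert) = - x"
  by (rule cinner_eqI) (simp add: cinner_simps)

lemma norm_scaleC [simp]: "norm (scaleC a (x::'a::chilbert)) = cmod a * norm x"
proof -
  have "complex_of_real ((norm (scaleC a x))\<^sup>2) = (a * cnj a) * cinner x x"
    by (simp only: cinner_self_norm[symmetric] cinner_scaleC_left cinner_scaleC_right mult_ac)
  also have "\<dots> = complex_of_real ((cmod a * norm x)\<^sup>2)"
    by (simp only: cinner_self_norm complex_norm_square[symmetric] of_real_mult[symmetric] of_real_power[symmetric] power_mult_distrib)
  finally have "(norm (scaleC a x))\<^sup>2 = (cmod a * norm x)\<^sup>2" using of_real_eq_iff by blast
  then show ?thesis by (simp add: power2_eq_iff_nonneg)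
qed

lemma norm_add_sq: "(norm (x + y))\<^sup>2 = (norm x)\<^sup>2 + (norm y)\<^sup>2 + 2 * Re (cinner x (y::'a::chilbert))"
proof -
  have "Re (cinner y x) = Re (cinner x y)" by (subst cinner_commute) simp
  then show ?thesis by (simp add: Re_cinner_self[symmetric] cinner_simps)
qed

lemma norm_diff_sq: "(norm (x - y))\<^sup>2 = (norm x)\<^sup>2 + (norm y)\<^sup>2 - 2 * Re (cinner x (y::'a::chilbert))"
  using norm_add_sq[of x "- y"] by (simp add: cinner_simps)

lemma cauchy_schwarz: "cmod (cinner x y) \<le> norm x * norm (y::'a::chilbert)"
proof (cases "y = 0")
  case False
  define a where "a = cinner x y / cinner y y"
  have yy: "cinner y y = of_real ((norm y)\<^sup>2)" by (rule cinner_self_norm)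
  have yn: "norm y \<noteq> 0" using False by simp
  have "0 \<le> (norm (x - scaleC a y))\<^sup>2" by simp
  also have "\<dots> = (norm x)\<^sup>2 + (cmod a * norm y)\<^sup>2 - 2 * Re (cnj a * cinner x y)"
    by (simp add: norm_diff_sq cinner_simps)
  also have "cnj a * cinner x y = of_real ((cmod (cinner x y))\<^sup>2 / (norm y)\<^sup>2)"
    unfolding a_def yy using complex_norm_square[of "cinner x y"] by (simp add: mult.commute)
  also have "cmod a * norm y = cmod (cinner x y) / norm y"
    unfolding a_def yy using yn by (simp add: norm_divide power2_eq_square norm_mult)
  finally have "(cmod (cinner x y))\<^sup>2 / (norm y)\<^sup>2 \<le> (norm x)\<^sup>2"
    by (simp add: power_divide)
  then have "(cmod (cinner x y))\<^sup>2 \<le> (norm x * norm y)\<^sup>2"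
    using yn by (simp add: divide_simps power_mult_distrib)
  then show ?thesis by (rule power2_le_imp_le) simp
qed simp

lemma bounded_bilinear_cinner: "bounded_bilinear (cinner :: 'a::chilbert \<Rightarrow> _)"
  by standard (auto simp: cinner_simps scaleR_conv_of_real intro!: exI[of _ 1] cauchy_schwarz)

lemmas tendsto_cinner = bounded_bilinear.tendsto[OF bounded_bilinear_cinner]

lemma norm_eqI_cinner: "cinner x x = cinner y (y::'a::chilbert) \<Longrightarrow> norm x = norm y"
  by (simp add: cinner_self_norm flip: of_real_power)

lemma norm_leI_cinner:
  assumes "\<And>y. cmod (cinner x y) \<le> c * norm (y::'a::chilbert)" "0 \<le> c" shows "norm x \<le> c"
proof -
  have "norm x * norm x \<le> c * norm x"
    using assms(1)[of x] by (simp add: cinner_self_norm power2_eq_square norm_mult)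
  then show ?thesis using assms(2) by (cases "x = 0") auto
qed

section \<open>Bounded complex-linear operators\<close>

lemma bounded_clinearI:
  assumes "\<And>x y. T (x + y) = T x + T y" "\<And>a x. T (scaleC a x) = scaleC a (T x)"
    "\<And>x. norm (T x) \<le> K * norm x"
  shows "bounded_clinear T"
  unfolding bounded_clinear_def using assms by (metis mult.commute)

lemma bcl_add: "bounded_clinear T \<Longrightarrow> T (x + y) = T x + T y"
  by (simp add: bounded_clinear_def)

lemma bcl_scaleC: "bounded_clinear T \<Longrightarrow> T (scaleC a x) = scaleC a (T x)"
  by (simp add: bounded_clinear_def)

lemma bcl_bound:
  assumes "bounded_clinear T" obtains K where "K > 0" "\<And>x. norm (T x) \<le> K * norm x"
proof -
  from assms obtain K where K: "\<And>x. norm (T x) \<le> norm x * K" by (auto simp: bounded_clinear_def)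
  have "norm (T x) \<le> (\<bar>K\<bar> + 1) * norm x" for x
  proof -
    have "norm x * K \<le> norm x * (\<bar>K\<bar> + 1)" by (intro mult_left_mono) auto
    then show ?thesis using K[of x] by (simp add: mult.commute)
  qed
  then show ?thesis by (intro that[of "\<bar>K\<bar> + 1"]) auto
qed

lemma bcl_bounded_linear: "bounded_clinear T \<Longrightarrow> bounded_linear T"
  unfolding bounded_clinear_def by (metis bounded_linear_intro scaleR_scaleC)

lemmas bcl_zero = linear_0[OF bounded_linear.linear[OF bcl_bounded_linear]]
lemmas bcl_diff = linear_diff[OF bounded_linear.linear[OF bcl_bounded_linear]]
lemmas bcl_minus = linear_neg[OF bounded_linear.linear[OF bcl_bounded_linear]]
lemmas bcl_sum = linear_sum[OF bounded_linear.linear[OF bcl_bounded_linear]]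
lemmas bcl_tendsto = bounded_linear.tendsto[OF bcl_bounded_linear]
lemmas bcl_simps = bcl_add bcl_scaleC bcl_zero bcl_diff bcl_minus bcl_sum

lemma bcl_id: "bounded_clinear (\<lambda>x. x)"
  by (rule bounded_clinearI[where K=1]) auto

lemma bcl_0: "bounded_clinear (\<lambda>x. 0)"
  by (rule bounded_clinearI[where K=1]) auto

lemma bcl_compose:
  assumes A: "bounded_clinear A" and B: "bounded_clinear B" shows "bounded_clinear (\<lambda>x. A (B x))"
proof -
  obtain K where K: "K > 0" "\<And>x. norm (A x) \<le> K * norm x" by (rule bcl_bound[OF A]) blast
  obtain L where L: "L > 0" "\<And>x. norm (B x) \<le> L * norm x" by (rule bcl_bound[OF B]) blast
  have "norm (A (B x)) \<le> (K * L) * norm x" for x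
    using K(2)[of "B x"] mult_left_mono[OF L(2)[of x] less_imp_le[OF K(1)]] by simp
  then show ?thesis by (intro bounded_clinearI) (auto simp: bcl_simps[OF A] bcl_simps[OF B])
qed

lemma scaleC_diff_right: "scaleC a (x - y) = scaleC a x - scaleC a (y::'a::chilbert)"
  by (rule cinner_eqI) (simp add: cinner_simps algebra_simps)

lemma scaleC_minus_right: "scaleC a (- x) = - scaleC a (x::'a::chilbert)"
  by (rule cinner_eqI) (simp add: cinner_simps algebra_simps)

lemma scaleC_sum_right: "scaleC a (\<Sum>i\<in>A. f i) = (\<Sum>i\<in>A. scaleC a (f i :: 'a::chilbert))"
  by (rule cinner_eqI) (simp add: cinner_simps sum_distrib_left)

lemma bcl_plus:
  assumes A: "bounded_clinear A" and B: "bounded_clinear B" shows "bounded_clinear (\<lambda>x. A x + B x)"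
proof -
  obtain K where K: "K > 0" "\<And>x. norm (A x) \<le> K * norm x" by (rule bcl_bound[OF A]) blast
  obtain L where L: "L > 0" "\<And>x. norm (B x) \<le> L * norm x" by (rule bcl_bound[OF B]) blast
  have "norm (A x + B x) \<le> (K + L) * norm x" for x
    using K(2)[of x] L(2)[of x] norm_triangle_ineq[of "A x" "B x"] by (simp add: algebra_simps)
  then show ?thesis
    by (intro bounded_clinearI) (auto simp: bcl_simps[OF A] bcl_simps[OF B] scaleC_add_right)
qed

lemma bcl_uminus:
  assumes A: "bounded_clinear A" shows "bounded_clinear (\<lambda>x. - A x)"
proof -
  obtain K where K: "K > 0" "\<And>x. norm (A x) \<le> K * norm x" by (rule bcl_bound[OF A]) blast
  then show ?thesis
    by (intro bounded_clinearI[where K=K]) (auto simp: bcl_simps[OF A] scaleC_minus_right)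
qed

lemma bcl_minus_fun:
  assumes A: "bounded_clinear A" and B: "bounded_clinear B" shows "bounded_clinear (\<lambda>x. A x - B x)"
  using bcl_plus[OF A bcl_uminus[OF B]] by simp

lemma bcl_sum_fun:
  assumes "\<And>i. i \<in> I \<Longrightarrow> bounded_clinear (A i)" shows "bounded_clinear (\<lambda>x. \<Sum>i\<in>I. A i x)"
  using assms by (induction I rule: infinite_finite_induct) (auto intro: bcl_0 bcl_plus)

lemma bcl_rank_one: "bounded_clinear (\<lambda>x. scaleC (cinner x a) b)"
proof (rule bounded_clinearI)
  show "norm (scaleC (cinner x a) b) \<le> (norm a * norm b) * norm x" for x
    using mult_right_mono[OF cauchy_schwarz[of x a] norm_ge_zero[of b]] by (simp add: mult_ac)
qed (auto simp: cinner_simps scaleC_add_left scaleC_scaleC)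

text \<open>The representing vector minimises \<open>\<parallel>x\<parallel>\<^sup>2 - 2 Re (f x)\<close>: by the parallelogram law
  minimising sequences are Cauchy.\<close>

lemma riesz_representation:
  fixes f :: "'a::chilbert \<Rightarrow> complex"
  assumes add: "\<And>x y. f (x + y) = f x + f y" and scale: "\<And>a x. f (scaleC a x) = a * f x"
    and bd: "\<And>x. cmod (f x) \<le> K * norm x"
  obtains z where "\<And>x. f x = cinner x z"
proof -
  have fR: "f (r *\<^sub>R x) = of_real r * f x" for r x by (simp add: scaleR_scaleC scale)
  define q where "q x = (norm x)\<^sup>2 - 2 * Re (f x)" for x
  have qb: "q x \<ge> - K\<^sup>2" for x
  proof -
    have "Re (f x) \<le> K * norm x" using bd[of x] complex_Re_le_cmod[of "f x"] by linarith
    moreover have "0 \<le> (norm x - K)\<^sup>2" by simp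
    ultimately show ?thesis unfolding q_def by (simp add: power2_diff algebra_simps)
  qed
  then have bdd: "bdd_below (range q)" by (auto simp: bdd_below_def)
  define m where "m = Inf (range q)"
  have mle: "m \<le> q x" for x unfolding m_def by (rule cInf_lower[OF _ bdd]) auto
  have "\<exists>x. q x < m + 1 / real (Suc n)" for n
    using cInf_lessD[of "range q" "m + 1 / real (Suc n)"] by (auto simp: m_def)
  then obtain X where X: "\<And>n. q (X n) < m + 1 / real (Suc n)" by metis
  have para: "(norm (x - y))\<^sup>2 \<le> 2 * (q x - m) + 2 * (q y - m)" for x y
  proof -
    have "q ((1/2) *\<^sub>R (x + y)) = (1/4) * (norm (x + y))\<^sup>2 - Re (f x) - Re (f y)"
      unfolding q_def fR add norm_scaleR power_mult_distrib by (simp add: power2_eq_square field_simps)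
    then have "4 * q ((1/2) *\<^sub>R (x + y)) = (norm (x + y))\<^sup>2 - 4 * Re (f x) - 4 * Re (f y)" by simp
    moreover have "(norm (x + y))\<^sup>2 + (norm (x - y))\<^sup>2 = 2 * (norm x)\<^sup>2 + 2 * (norm y)\<^sup>2"
      by (simp add: norm_add_sq norm_diff_sq)
    ultimately have "(norm (x - y))\<^sup>2 = 2 * q x + 2 * q y - 4 * q ((1/2) *\<^sub>R (x + y))"
      by (simp add: q_def)
    then show ?thesis using mle[of "(1/2) *\<^sub>R (x + y)"] by simp
  qed
  have "Cauchy X"
  proof (rule metric_CauchyI)
    fix e :: real assume e: "0 < e"
    obtain N where N: "4 / e\<^sup>2 < real N" using reals_Archimedean2 by blast
    have "dist (X i) (X j) < e" if "N \<le> i" "N \<le> j" for i j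
    proof -
      have e2: "1 / real (Suc k) < e\<^sup>2 / 4" if "N \<le> k" for k
      proof -
        have "4 / e\<^sup>2 < real (Suc k)" using N that by linarith
        then show ?thesis using e by (simp add: field_simps)
      qed
      have "(norm (X i - X j))\<^sup>2 < e\<^sup>2"
      proof -
        have "q (X i) - m < e\<^sup>2 / 4" "q (X j) - m < e\<^sup>2 / 4"
          using less_trans[OF X add_strict_left_mono[OF e2[OF that(1)]]]
            less_trans[OF X add_strict_left_mono[OF e2[OF that(2)]]] by argo+
        then show ?thesis using para[of "X i" "X j"] by argo
      qed
      then show ?thesis using e by (simp add: dist_norm power2_less_imp_less)
    qed
    then show "\<exists>M. \<forall>m\<ge>M. \<forall>n\<ge>M. dist (X m) (X n) < e" by blast
  qed
  then obtain z where z: "X \<longlonglongrightarrow> z" using convergent_eq_Cauchy by blast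
  have fcont: "(\<lambda>n. f (X n)) \<longlonglongrightarrow> f z"
  proof -
    have "bounded_linear f"
      by (rule bounded_linear_intro[where K=K]) (auto simp: add fR scaleR_conv_of_real bd mult.commute)
    then show ?thesis using z by (rule bounded_linear.tendsto)
  qed
  have "(\<lambda>n. q (X n)) \<longlonglongrightarrow> q z" unfolding q_def by (intro tendsto_intros z fcont)
  moreover have "(\<lambda>n. m + 1 / real (Suc n)) \<longlonglongrightarrow> m + 0"
    by (intro tendsto_intros LIMSEQ_Suc[OF lim_const_over_n])
  ultimately have qz: "q z \<le> m"
    using LIMSEQ_le[of "\<lambda>n. q (X n)" "q z" "\<lambda>n. m + 1 / real (Suc n)" m] X less_imp_le by auto
  have re: "Re (f h) = Re (cinner h z)" for h
  proof -
    define s where "s = Re (cinner h z) - Re (f h)"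
    \<comment> \<open>A minimiser cannot be improved in the direction \<open>h\<close>, so the
      linear coefficient of this quadratic in \<open>t\<close> has to vanish.\<close>
    have ge: "0 \<le> t\<^sup>2 * (norm h)\<^sup>2 + 2 * t * s" for t
    proof -
      have "Re (cinner z h) = Re (cinner h z)" by (subst cinner_commute) simp
      then have "q (z + t *\<^sub>R h) = q z + t\<^sup>2 * (norm h)\<^sup>2 + 2 * t * s"
        by (simp add: q_def norm_add_sq s_def add fR cinner_simps power_mult_distrib algebra_simps)
      then show ?thesis using mle[of "z + t *\<^sub>R h"] qz by simp
    qed
    have "s = 0"
    proof (rule ccontr)
      assume s: "s \<noteq> 0"
      \<comment> \<open>\<open>- s / N\<close> is close to the minimising \<open>t\<close>; the
        summand 1 keeps \<open>N\<close> positive when \<open>h = 0\<close>.\<close>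
      define N where "N = (norm h)\<^sup>2 + 1"
      have N: "N > 0" unfolding N_def by (simp add: add_nonneg_pos)
      have "0 \<le> (- s / N)\<^sup>2 * (norm h)\<^sup>2 + 2 * (- s / N) * s" by (rule ge)
      also have "\<dots> \<le> (- s / N)\<^sup>2 * N + 2 * (- s / N) * s"
        by (intro add_right_mono mult_left_mono) (auto simp: N_def)
      also have "\<dots> = - (s\<^sup>2 / N)" using N by (simp add: field_simps power2_eq_square)
      finally have "s\<^sup>2 / N \<le> 0" by simp
      moreover have "0 < s\<^sup>2 / N" using s N by (intro divide_pos_pos) auto
      ultimately show False by linarith
    qed
    then show ?thesis by (simp add: s_def)
  qed
  have "f x = cinner x z" for x
  proof (rule complex_eqI)
    show "Re (f x) = Re (cinner x z)" by (rule re)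
    have "Re (f (scaleC \<i> x)) = Re (cinner (scaleC \<i> x) z)" by (rule re)
    then show "Im (f x) = Im (cinner x z)" by (simp add: scale cinner_simps)
  qed
  then show ?thesis by (rule that)
qed

text \<open>Makes the \<open>THE\<close> in \<open>cadjoint\<close> meaningful: Riesz gives
  existence, nondegeneracy of the inner product gives uniqueness.\<close>

lemma is_cadjoint_cadjoint:
  assumes T: "bounded_clinear T" shows "is_cadjoint (cadjoint T) T"
proof -
  obtain K where K: "K > 0" "\<And>x. norm (T x) \<le> K * norm x" by (rule bcl_bound[OF T]) blast
  have "\<exists>z. \<forall>x. cinner (T x) y = cinner x z" for y
  proof (rule riesz_representation[of "\<lambda>x. cinner (T x) y" "K * norm y"])
    fix x
    show "cmod (cinner (T x) y) \<le> K * norm y * norm x"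
      using cauchy_schwarz[of "T x" y] mult_right_mono[OF K(2)[of x] norm_ge_zero[of y]]
      by (simp add: mult_ac)
  qed (auto simp: bcl_simps[OF T] cinner_simps)
  then obtain V where V: "\<And>x y. cinner (T x) y = cinner x (V y)" by metis
  have "is_cadjoint V T" unfolding is_cadjoint_def using V by (metis cinner_commute)
  moreover have "V' = V" if "is_cadjoint V' T" for V'
  proof
    fix x show "V' x = V x"
      by (rule cinner_eqI) (metis \<open>is_cadjoint V T\<close> is_cadjoint_def that)
  qed
  ultimately show ?thesis unfolding cadjoint_def by (rule theI)
qed

lemma cadjoint_left: "bounded_clinear T \<Longrightarrow> cinner (cadjoint T x) y = cinner x (T y)"
  using is_cadjoint_cadjoint by (auto simp: is_cadjoint_def)

lemma cadjoint_right: "bounded_clinear T \<Longrightarrow> cinner x (cadjoint T y) = cinner (T x) y"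
  by (metis cadjoint_left cinner_commute)

lemma cadjoint_eqI:
  assumes "bounded_clinear T" "\<And>x y. cinner (V x) y = cinner x (T y)" shows "cadjoint T = V"
  by (rule ext, rule cinner_eqI) (simp add: cadjoint_left[OF assms(1)] assms(2))

lemma adjoint_norm_bound:
  assumes "\<And>x y. cinner (V x) y = cinner x (T y)" "\<And>x. norm (T x) \<le> K * norm x" "0 \<le> K"
  shows "norm (V (x::'a::chilbert)) \<le> K * norm x"
proof (rule norm_leI_cinner)
  fix y
  show "cmod (cinner (V x) y) \<le> K * norm x * norm y"
    using cauchy_schwarz[of x "T y"] mult_left_mono[OF assms(2)[of y] norm_ge_zero[of x]]
    by (simp add: assms(1) mult_ac)
qed (use assms in simp)

lemma cadjoint_norm_bound:
  assumes "bounded_clinear T" "\<And>x. norm (T x) \<le> K * norm x" "0 \<le> K"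
  shows "norm (cadjoint T x) \<le> K * norm x"
  using adjoint_norm_bound[OF cadjoint_left[OF assms(1)] assms(2,3)] .

lemma bcl_cadjoint:
  assumes T: "bounded_clinear T" shows "bounded_clinear (cadjoint T)"
proof -
  obtain K where K: "K > 0" "\<And>x. norm (T x) \<le> K * norm x" by (rule bcl_bound[OF T]) blast
  show ?thesis
  proof (rule bounded_clinearI)
    show "norm (cadjoint T x) \<le> K * norm x" for x
      using cadjoint_norm_bound[OF T K(2)] K(1) by simp
  qed (rule cinner_eqI, simp add: cadjoint_left[OF T] cinner_simps)+
qed

lemma cadjoint_cadjoint: "bounded_clinear T \<Longrightarrow> cadjoint (cadjoint T) = T"
  by (rule cadjoint_eqI) (auto simp: bcl_cadjoint cadjoint_right)

section \<open>Orthonormal families and ultrafilter limits\<close>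

lemma norm_sum_sq:
  fixes f :: "'i \<Rightarrow> 'a::chilbert"
  assumes "finite A" "\<And>i j. i \<in> A \<Longrightarrow> j \<in> A \<Longrightarrow> i \<noteq> j \<Longrightarrow> cinner (f i) (f j) = 0"
  shows "(norm (\<Sum>i\<in>A. f i))\<^sup>2 = (\<Sum>i\<in>A. (norm (f i))\<^sup>2)"
  using assms
proof (induction A rule: finite_induct)
  case (insert a A)
  have "cinner (f a) (\<Sum>i\<in>A. f i) = 0"
    unfolding cinner_sum_right by (rule sum.neutral) (use insert in auto)
  then show ?case using insert by (simp add: norm_add_sq)
qed simp

text \<open>Zero members are allowed, so that Gram-Schmidt need not discard dependent vectors.\<close>

definition ortho_family :: "('i \<Rightarrow> 'a::chilbert) \<Rightarrow> bool" where
  "ortho_family u \<longleftrightarrow> (\<forall>i j. i \<noteq> j \<longrightarrow> cinner (u i) (u j) = 0) \<and> (\<forall>i. norm (u i) = 0 \<or> norm (u i) = 1)"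

lemma ortho_familyD: "ortho_family u \<Longrightarrow> i \<noteq> j \<Longrightarrow> cinner (u i) (u j) = 0"
  by (auto simp: ortho_family_def)

lemma ortho_family_cases:
  assumes "ortho_family u" obtains "u i = 0" | "u i \<noteq> 0" "norm (u i) = 1" "cinner (u i) (u i) = 1"
  using assms by (auto simp: ortho_family_def cinner_self_norm) fastforce

lemma ortho_family_norm: "ortho_family u \<Longrightarrow> norm (u i) \<le> 1"
  by (metis ortho_family_def le_numeral_extra(4) zero_less_one_class.zero_le_one)

text \<open>The extra factor is 1 for unit members and 0 for zero members, and in the second case
  both sides vanish. This stands in for normalisation wherever zero members may occur.\<close>

lemma ortho_family_coeff:
  assumes "ortho_family u" shows "cinner x (u j) * cinner (u j) (u j) = cinner x (u j)"
  by (rule ortho_family_cases[OF assms, of j]) auto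

lemma ortho_family_self:
  assumes "ortho_family u" shows "scaleC (cinner (u j) (u j)) (u j) = u j"
  by (rule ortho_family_cases[OF assms, of j]) (auto simp: scaleC_one)

lemma ortho_family_sum_inner:
  assumes u: "ortho_family u" and A: "finite A"
  shows "cinner (\<Sum>j\<in>A. scaleC (c j) (u j)) (u i) = (if i \<in> A then c i * cinner (u i) (u i) else 0)"
proof -
  have "cinner (\<Sum>j\<in>A. scaleC (c j) (u j)) (u i)
      = (\<Sum>j\<in>A. if j = i then c i * cinner (u i) (u i) else 0)"
    unfolding cinner_simps by (rule sum.cong) (use ortho_familyD[OF u] in auto)
  then show ?thesis using A by (simp add: sum.delta)
qed

lemma ortho_family_sum_coeff:
  assumes u: "ortho_family u" and A: "finite A" and i: "i \<in> A"
  shows "cinner (\<Sum>j\<in>A. scaleC (cinner x (u j)) (u j)) (u i) = cinner x (u i)"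
  using ortho_family_sum_inner[OF u A, of "\<lambda>j. cinner x (u j)" i] i
  by (simp add: ortho_family_coeff[OF u])

lemma ortho_family_sum_norm:
  assumes u: "ortho_family u" and A: "finite A"
  shows "(norm (\<Sum>j\<in>A. scaleC (c j) (u j)))\<^sup>2 = (\<Sum>j\<in>A. (cmod (c j) * norm (u j))\<^sup>2)"
  by (subst norm_sum_sq) (auto simp: A cinner_simps ortho_familyD[OF u])

text \<open>With \<open>t\<close> the sum in question, \<open>cinner x t\<close> is the square of
  \<open>norm t\<close>, so Cauchy-Schwarz yields the first bound and squaring it the
  second.\<close>

lemma bessel:
  assumes u: "ortho_family u" and A: "finite A"
  shows "norm (\<Sum>j\<in>A. scaleC (cinner x (u j)) (u j)) \<le> norm x"
    and "(\<Sum>j\<in>A. (cmod (cinner x (u j)))\<^sup>2) \<le> (norm x)\<^sup>2"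
proof -
  define t where "t = (\<Sum>j\<in>A. scaleC (cinner x (u j)) (u j))"
  have nt: "(norm t)\<^sup>2 = (\<Sum>j\<in>A. (cmod (cinner x (u j)))\<^sup>2)"
    unfolding t_def ortho_family_sum_norm[OF u A]
  proof (rule sum.cong)
    fix j show "(cmod (cinner x (u j)) * norm (u j))\<^sup>2 = (cmod (cinner x (u j)))\<^sup>2"
      by (rule ortho_family_cases[OF u, of j]) auto
  qed simp
  have "cinner x t = of_real ((norm t)\<^sup>2)"
    unfolding nt unfolding t_def cinner_simps
    by (simp add: complex_norm_square mult.commute del: of_real_power)
  then have "(norm t)\<^sup>2 \<le> norm x * norm t"
    using cauchy_schwarz[of x t] by (simp add: norm_power)
  then show *: "norm t \<le> norm x"
    by (cases "t = 0") (auto simp: power2_eq_square)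
  show "(\<Sum>j\<in>A. (cmod (cinner x (u j)))\<^sup>2) \<le> (norm x)\<^sup>2"
    unfolding nt[symmetric] using * by (rule power_mono) simp
qed

lemma ortho_family_transfer_bound:
  assumes a: "ortho_family a" and b: "ortho_family b" and A: "finite A"
  shows "norm (\<Sum>j\<in>A. scaleC (cinner x (a j)) (b j)) \<le> norm x"
proof -
  have "(norm (\<Sum>j\<in>A. scaleC (cinner x (a j)) (b j)))\<^sup>2 \<le> (\<Sum>j\<in>A. (cmod (cinner x (a j)))\<^sup>2)"
    unfolding ortho_family_sum_norm[OF b A]
  proof (intro sum_mono power_mono)
    fix j show "cmod (cinner x (a j)) * norm (b j) \<le> cmod (cinner x (a j))"
      using ortho_family_norm[OF b, of j] mult_left_mono[of "norm (b j)" 1 "cmod (cinner x (a j))"] by simp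
  qed simp
  also have "\<dots> \<le> (norm x)\<^sup>2" by (rule bessel[OF a A])
  finally show ?thesis by (rule power2_le_imp_le) simp
qed

text \<open>Since \<open>1 / 0 = 0\<close>, a vector depending on its predecessors yields the member
  0 instead of being skipped. Indices are thereby kept, and \<open>gs x i\<close> depends only on
  the vectors up to \<open>x i\<close>.\<close>

function gs :: "(nat \<Rightarrow> 'a::chilbert) \<Rightarrow> nat \<Rightarrow> 'a" where
  "gs x i = (1 / norm (x i - (\<Sum>j<i. scaleC (cinner (x i) (gs x j)) (gs x j)))) *\<^sub>R
     (x i - (\<Sum>j<i. scaleC (cinner (x i) (gs x j)) (gs x j)))"
  by pat_completeness auto
termination by (relation "Wellfounded.measure snd") auto

declare gs.simps [simp del]

definition gs_residual :: "(nat \<Rightarrow> 'a::chilbert) \<Rightarrow> nat \<Rightarrow> 'a" where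
  "gs_residual x i = x i - (\<Sum>j<i. scaleC (cinner (x i) (gs x j)) (gs x j))"

lemma gs_eq: "gs x i = (1 / norm (gs_residual x i)) *\<^sub>R gs_residual x i"
  unfolding gs_residual_def by (rule gs.simps)

lemma gs_residual_eq: "gs_residual x i = norm (gs_residual x i) *\<^sub>R gs x i"
  by (cases "gs_residual x i = 0") (simp_all add: gs_eq)

lemma norm_gs: "norm (gs x i) = 0 \<or> norm (gs x i) = 1"
  by (simp add: gs_eq)

lemma gs_coeff: "cinner y (gs x j) * cinner (gs x j) (gs x j) = cinner y (gs x j)"
  using norm_gs[of x j] by (auto simp: cinner_self_norm)

lemma gs_orth: "j < i \<Longrightarrow> cinner (gs x i) (gs x j) = 0"
proof (induction i arbitrary: j rule: less_induct)
  case (less i)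
  have "(\<Sum>l<i. cinner (x i) (gs x l) * cinner (gs x l) (gs x j))
      = (\<Sum>l<i. if l = j then cinner (x i) (gs x j) else 0)"
  proof (rule sum.cong)
    fix l assume l: "l \<in> {..<i}"
    show "cinner (x i) (gs x l) * cinner (gs x l) (gs x j) = (if l = j then cinner (x i) (gs x j) else 0)"
    proof (cases l j rule: linorder_cases)
      case less
      have "cinner (gs x j) (gs x l) = 0" using less.IH[OF less.prems less] .
      then have "cinner (gs x l) (gs x j) = 0" by (subst cinner_commute) simp
      then show ?thesis using less by simp
    next
      case greater
      then show ?thesis using less.IH[of l j] l by simp
    qed (simp add: gs_coeff)
  qed simp
  also have "\<dots> = cinner (x i) (gs x j)" using less.prems by (simp add: sum.delta)
  finally have "cinner (gs_residual x i) (gs x j) = 0"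
    unfolding gs_residual_def by (simp add: cinner_simps)
  then show ?case by (subst gs_eq) (simp add: cinner_simps)
qed

lemma ortho_family_gs: "ortho_family (gs x)"
  unfolding ortho_family_def
proof (intro conjI allI impI)
  fix i j :: nat assume "i \<noteq> j"
  then show "cinner (gs x i) (gs x j) = 0"
    by (metis gs_orth cinner_commute complex_cnj_zero nat_neq_iff)
qed (rule norm_gs)

lemma gs_expand: "x i = (\<Sum>j<Suc i. scaleC (cinner (x i) (gs x j)) (gs x j))"
proof -
  have 1: "x i = (\<Sum>j<i. scaleC (cinner (x i) (gs x j)) (gs x j)) + norm (gs_residual x i) *\<^sub>R gs x i"
    using gs_residual_eq[of x i] by (simp add: gs_residual_def)
  have "cinner (x i) (gs x i) = norm (gs_residual x i) * cinner (gs x i) (gs x i)"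
    by (subst 1) (simp only: cinner_add_left cinner_scaleR_left
        ortho_family_sum_inner[OF ortho_family_gs finite_lessThan] lessThan_iff less_irrefl if_False add_0_left)
  then have "scaleC (cinner (x i) (gs x i)) (gs x i) = norm (gs_residual x i) *\<^sub>R gs x i"
    by (simp add: scaleC_scaleC[symmetric] ortho_family_self[OF ortho_family_gs] scaleR_scaleC)
  then show ?thesis using 1 by simp
qed

lemma gs_inner_greater: "i < j \<Longrightarrow> cinner (x i) (gs x j) = 0"
  by (subst gs_expand) (simp add: ortho_family_sum_inner[OF ortho_family_gs] del: sum.lessThan_Suc)

text \<open>The expansion \<open>gs_expand\<close> gives one direction, induction along the
  residuals the other. Orthogonality takes the place of equality of spans, so that no subspaces have
  to be formed.\<close>

lemma gs_perp_iff: "(\<forall>j<n. cinner z (gs x j) = 0) \<longleftrightarrow> (\<forall>j<n. cinner z (x j) = 0)"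
proof safe
  fix j assume *: "\<forall>j<n. cinner z (gs x j) = 0" and j: "j < n"
  show "cinner z (x j) = 0"
    by (subst gs_expand, subst cinner_sum_right, rule sum.neutral) (use * j in \<open>auto simp: cinner_simps\<close>)
next
  fix j assume *: "\<forall>j<n. cinner z (x j) = 0"
  show "j < n \<Longrightarrow> cinner z (gs x j) = 0"
  proof (induction j rule: less_induct)
    case (less j)
    have "(\<Sum>l<j. cinner z (scaleC (cinner (x j) (gs x l)) (gs x l))) = 0"
      by (rule sum.neutral) (use less in \<open>auto simp: cinner_simps\<close>)
    then have "cinner z (gs_residual x j) = 0"
      unfolding gs_residual_def using * less.prems by (simp add: cinner_diff_right cinner_sum_right)
    then show ?case by (subst gs_eq) (simp add: cinner_simps)
  qed
qed

text \<open>For the difference \<open>D\<close> every value \<open>cadjoint D z\<close> is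
  orthogonal to all \<open>u j\<close>, hence killed by \<open>D\<close>; so \<open>D\<close>
  composed with its adjoint is 0, and therefore \<open>D\<close> is 0. This replaces arguments by
  density of a span and by orthogonal decomposition.\<close>

lemma eq_on_basis:
  assumes A: "bounded_clinear A" and B: "bounded_clinear B"
    and u: "\<And>j. A (u j) = B (u j)"
    and perp: "\<And>x. (\<And>j. cinner x (u j) = 0) \<Longrightarrow> A x = B x"
  shows "A x = B x"
proof -
  define D where "D x = A x - B x" for x
  have D: "bounded_clinear D" unfolding D_def by (rule bcl_minus_fun[OF A B])
  have "cadjoint D z = 0" for z
  proof -
    have "cinner (cadjoint D z) (u j) = 0" for j
      by (simp add: cadjoint_left[OF D] D_def u)
    then have "D (cadjoint D z) = 0" unfolding D_def using perp by simp
    then have "cinner (cadjoint D z) (cadjoint D z) = 0"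
      by (simp add: cadjoint_left[OF D])
    then show ?thesis by simp
  qed
  then have "D x = 0" by (intro cinner_eqI) (metis D cadjoint_right cinner_zero_left cinner_zero_right)
  then show ?thesis by (simp add: D_def)
qed

text \<open>Gram-Schmidt is continuous at families that are orthonormal in the limit; the members with
  limit \<open>0\<close> have to vanish identically because normalisation is discontinuous at \<open>0\<close>.\<close>

lemma gs_close:
  fixes X :: "nat \<Rightarrow> nat \<Rightarrow> 'a::chilbert" and U :: "nat filter"
  assumes off: "\<And>i j. i \<noteq> j \<Longrightarrow> ((\<lambda>n. cinner (X i n) (X j n)) \<longlongrightarrow> 0) U"
    and diag: "\<And>i. (\<forall>n. X i n = 0) \<or> ((\<lambda>n. norm (X i n)) \<longlongrightarrow> 1) U"
  shows "((\<lambda>n. gs (\<lambda>j. X j n) i - X i n) \<longlongrightarrow> 0) U"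
proof (induction i rule: less_induct)
  case (less i)
  define w where "w j n = gs (\<lambda>j. X j n) j" for j n
  define p where "p n = gs_residual (\<lambda>j. X j n) i" for n
  have w: "w i n = (1 / norm (p n)) *\<^sub>R p n" for n unfolding w_def p_def by (rule gs_eq)
  have bd: "\<exists>K. eventually (\<lambda>n. norm (X i n) \<le> K) U"
  proof (cases "\<forall>n. X i n = 0")
    case False
    then have "((\<lambda>n. norm (X i n)) \<longlongrightarrow> 1) U" using diag by blast
    then have "eventually (\<lambda>n. norm (X i n) < 2) U" by (rule order_tendstoD) simp
    then show ?thesis by (auto intro!: exI[of _ 2] elim: eventually_mono)
  qed (auto intro!: exI[of _ 0])
  then obtain K where K: "eventually (\<lambda>n. norm (X i n) \<le> K) U" by blast
  have "((\<lambda>n. \<Sum>j<i. scaleC (cinner (X i n) (w j n)) (w j n)) \<longlongrightarrow> (\<Sum>j<i. 0)) U"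
  proof (rule tendsto_sum)
    fix j assume j: "j \<in> {..<i}"
    have d: "((\<lambda>n. w j n - X j n) \<longlongrightarrow> 0) U" using less j unfolding w_def by simp
    have "((\<lambda>n. cinner (X i n) (w j n - X j n)) \<longlongrightarrow> 0) U"
    proof (rule tendsto_0_le)
      show "((\<lambda>n. w j n - X j n) \<longlongrightarrow> 0) U" by (rule d)
      show "eventually (\<lambda>n. norm (cinner (X i n) (w j n - X j n)) \<le> norm (w j n - X j n) * K) U"
        using K
      proof eventually_elim
        case (elim n)
        then show ?case
          using cauchy_schwarz[of "X i n" "w j n - X j n"] mult_right_mono[OF elim norm_ge_zero[of "w j n - X j n"]]
          by (simp add: mult.commute)
      qed
    qed
    moreover have "((\<lambda>n. cinner (X i n) (X j n)) \<longlongrightarrow> 0) U" using off j by auto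
    ultimately have "((\<lambda>n. cinner (X i n) (w j n - X j n) + cinner (X i n) (X j n)) \<longlongrightarrow> 0 + 0) U"
      by (rule tendsto_add)
    then have l: "((\<lambda>n. cinner (X i n) (w j n)) \<longlongrightarrow> 0) U" by (simp add: cinner_simps)
    show "((\<lambda>n. scaleC (cinner (X i n) (w j n)) (w j n)) \<longlongrightarrow> 0) U"
    proof (rule tendsto_0_le[OF l, where K=1], rule always_eventually, rule allI)
      fix n
      have "norm (w j n) \<le> 1" unfolding w_def by (rule ortho_family_norm[OF ortho_family_gs])
      then show "norm (scaleC (cinner (X i n) (w j n)) (w j n)) \<le> norm (cinner (X i n) (w j n)) * 1"
        using mult_left_mono[of "norm (w j n)" 1 "cmod (cinner (X i n) (w j n))"] by simp
    qed
  qed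
  then have "((\<lambda>n. - (\<Sum>j<i. scaleC (cinner (X i n) (w j n)) (w j n))) \<longlongrightarrow> - 0) U"
    by (intro tendsto_minus) simp
  then have pX: "((\<lambda>n. p n - X i n) \<longlongrightarrow> 0) U"
    unfolding p_def gs_residual_def w_def by simp
  have wX: "((\<lambda>n. w i n - X i n) \<longlongrightarrow> 0) U"
  proof (cases "\<forall>n. X i n = 0")
    case True
    then have "w i n = 0" for n unfolding w p_def gs_residual_def by simp
    then show ?thesis using True by simp
  next
    case False
    then have nX: "((\<lambda>n. norm (X i n)) \<longlongrightarrow> 1) U" using diag by blast
    have "((\<lambda>n. norm (p n) - norm (X i n)) \<longlongrightarrow> 0) U"
      by (rule tendsto_0_le[OF pX, where K=1]) (auto intro!: always_eventually norm_triangle_ineq3)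
    from tendsto_add[OF this nX] have "((\<lambda>n. norm (p n)) \<longlongrightarrow> 1) U" by simp
    then have np: "((\<lambda>n. norm (p n) - 1) \<longlongrightarrow> 0) U" by (simp add: LIM_zero_iff)
    have "((\<lambda>n. w i n - p n) \<longlongrightarrow> 0) U"
    proof (rule tendsto_0_le[OF np, where K=1], rule always_eventually, rule allI)
      fix n
      show "norm (w i n - p n) \<le> norm (norm (p n) - 1) * 1"
      proof (cases "p n = 0")
        case False
        have "w i n - p n = (1 / norm (p n) - 1) *\<^sub>R p n" unfolding w by (simp add: scaleR_diff_left)
        then have "norm (w i n - p n) = \<bar>(1 / norm (p n) - 1) * norm (p n)\<bar>" by (simp add: abs_mult)
        also have "(1 / norm (p n) - 1) * norm (p n) = 1 - norm (p n)" using False by (simp add: field_simps)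
        finally show ?thesis by simp
      qed (simp add: w)
    qed
    from tendsto_add[OF this pX] show ?thesis by simp
  qed
  show ?case using wX by (simp only: w_def)
qed

section \<open>Limits along a free ultrafilter\<close>

lemma free_ultrafilter_le_sequentially:
  assumes "free_ultrafilter U" shows "U \<le> sequentially"
  unfolding le_sequentially
proof
  fix N :: nat
  have "eventually (\<lambda>n. \<forall>m\<in>{..<N}. n \<noteq> m) U"
    using assms by (subst eventually_ball_finite_distrib) (auto simp: free_ultrafilter_def)
  then show "eventually (\<lambda>n. N \<le> n) U" by (rule eventually_mono) (metis lessThan_iff not_le)
qed

text \<open>Compactness of a closed disc gives a cluster point along \<open>U\<close>, and the
  ultrafilter property turns a cluster point into a limit.\<close>

lemma ultrafilter_limit:
  fixes f :: "nat \<Rightarrow> complex"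
  assumes U: "free_ultrafilter U" and bd: "\<And>n. cmod (f n) \<le> K"
  obtains l where "(f \<longlongrightarrow> l) U"
proof -
  have "filtermap f U \<noteq> bot" using U by (simp add: filtermap_bot_iff free_ultrafilter_def)
  moreover have "eventually (\<lambda>x. x \<in> cball 0 K) (filtermap f U)"
    using bd by (simp add: eventually_filtermap)
  ultimately obtain l where l: "inf (nhds l) (filtermap f U) \<noteq> bot"
    using compact_cball[of 0 K] unfolding compact_filter by blast
  have "(f \<longlongrightarrow> l) U"
  proof (rule topological_tendstoI, rule ccontr)
    fix S assume S: "open S" "l \<in> S" and n: "\<not> eventually (\<lambda>n. f n \<in> S) U"
    have "eventually (\<lambda>n. f n \<notin> S) U" using U n by (auto simp: free_ultrafilter_def)
    then have "eventually (\<lambda>x. x \<notin> S) (filtermap f U)" by (simp add: eventually_filtermap)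
    moreover have "eventually (\<lambda>x. x \<in> S) (nhds l)" using S by (rule eventually_nhds_in_open)
    ultimately have "eventually (\<lambda>x. False) (inf (nhds l) (filtermap f U))"
      unfolding eventually_inf by (intro exI conjI) auto
    with l show False by (simp add: trivial_limit_def)
  qed
  then show ?thesis by (rule that)
qed

text \<open>The sesquilinear forms converge along \<open>U\<close> because they are bounded, and
  Riesz turns the limit form into an operator. The maps \<open>theta\<close>, the lifts
  \<open>J\<close>, the operator \<open>R\<close> and the ampliations all arise this way.\<close>

lemma weak_ultralimit:
  fixes A :: "nat \<Rightarrow> 'a::chilbert \<Rightarrow> 'a"
  assumes U: "free_ultrafilter U" and A: "\<And>n. bounded_clinear (A n)"
    and bd: "\<And>n x. norm (A n x) \<le> K * norm x"
  obtains B where "bounded_clinear B" "\<And>x. norm (B x) \<le> K * norm x"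
    "\<And>x y. ((\<lambda>n. cinner (A n x) y) \<longlongrightarrow> cinner (B x) y) U"
proof -
  have nb: "U \<noteq> bot" using U by (simp add: free_ultrafilter_def)
  have cb: "cmod (cinner (A n x) y) \<le> K * norm x * norm y" for n x y
    using cauchy_schwarz[of "A n x" y] mult_right_mono[OF bd[of n x] norm_ge_zero[of y]] by linarith
  have "\<exists>l. ((\<lambda>n. cinner (A n x) y) \<longlongrightarrow> l) U" for x y
    by (rule ultrafilter_limit[OF U, of "\<lambda>n. cinner (A n x) y" "K * norm x * norm y"]) (use cb in auto)
  then obtain L where L: "\<And>x y. ((\<lambda>n. cinner (A n x) y) \<longlongrightarrow> L x y) U" by metis
  note uniq = tendsto_unique[OF nb L]
  have Lb: "cmod (L x y) \<le> K * norm x * norm y" for x y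
    by (rule tendsto_upperbound[OF tendsto_norm[OF L] always_eventually nb]) (use cb in auto)
  have Lr: "L x (y + z) = L x y + L x z" "L x (scaleC a y) = cnj a * L x y" for x y z a
    by (rule uniq, simp add: cinner_simps, intro tendsto_intros L)+
  have Ll: "L (x + y) z = L x z + L y z" "L (scaleC a x) z = a * L x z" for x y z a
    by (rule uniq, simp add: bcl_simps[OF A] cinner_simps, intro tendsto_intros L)+
  \<comment> \<open>\<open>cinner\<close> is conjugate linear in its second argument, so it is the
    conjugate of the form that is a linear functional of \<open>y\<close>.\<close>
  have "\<exists>z. \<forall>y. cnj (L x y) = cinner y z" for x
  proof (rule riesz_representation[of "\<lambda>y. cnj (L x y)" "K * norm x"])
    show "cmod (cnj (L x y)) \<le> K * norm x * norm y" for y using Lb by simp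
  qed (auto simp: Lr)
  then obtain B where "\<And>x y. cnj (L x y) = cinner y (B x)" by metis
  then have B: "L x y = cinner (B x) y" for x y by (metis cinner_commute complex_cnj_cnj)
  have K0: "norm (B x) \<le> K * norm x" for x
  proof -
    have "0 \<le> K * norm x" using bd[of 0 x] norm_ge_zero order_trans by blast
    then show ?thesis by (intro norm_leI_cinner) (use Lb in \<open>auto simp: B\<close>)
  qed
  show ?thesis
  proof (rule that)
    show "bounded_clinear B"
      by (rule bounded_clinearI[OF _ _ K0]; rule cinner_eqI; simp add: B[symmetric] Ll cinner_simps)
  qed (use K0 L B in auto)
qed

text \<open>The partial isometry taking \<open>a j\<close> to \<open>b j\<close>. The partial sums converge strongly, but their weak
  limit along \<open>U\<close> suffices and needs no convergence proof.\<close>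

definition theta :: "nat filter \<Rightarrow> (nat \<Rightarrow> 'a::chilbert) \<Rightarrow> (nat \<Rightarrow> 'a) \<Rightarrow> 'a \<Rightarrow> 'a" where
  "theta U a b = (SOME B. bounded_clinear B \<and> (\<forall>x. norm (B x) \<le> norm x) \<and>
     (\<forall>x y. ((\<lambda>N. cinner (\<Sum>j<N. scaleC (cinner x (a j)) (b j)) y) \<longlongrightarrow> cinner (B x) y) U))"

context
  fixes U :: "nat filter" and a b :: "nat \<Rightarrow> 'a::chilbert"
  assumes U: "free_ultrafilter U" and a: "ortho_family a" and b: "ortho_family b"
begin

lemma theta_spec:
  shows bcl_theta: "bounded_clinear (theta U a b)"
    and theta_le: "norm (theta U a b x) \<le> norm x"
    and theta_lim: "((\<lambda>N. cinner (\<Sum>j<N. scaleC (cinner x (a j)) (b j)) y) \<longlongrightarrow> cinner (theta U a b x) y) U"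
proof -
  have "\<exists>B. bounded_clinear B \<and> (\<forall>x. norm (B x) \<le> norm x) \<and>
     (\<forall>x y. ((\<lambda>N. cinner (\<Sum>j<N. scaleC (cinner x (a j)) (b j)) y) \<longlongrightarrow> cinner (B x) y) U)"
  proof (rule weak_ultralimit[OF U, where K=1 and A="\<lambda>N x. \<Sum>j<N. scaleC (cinner x (a j)) (b j)"])
    show "norm (\<Sum>j<N. scaleC (cinner x (a j)) (b j)) \<le> 1 * norm x" for N x
      using ortho_family_transfer_bound[OF a b, of "{..<N}"] by simp
  qed (auto intro: bcl_sum_fun bcl_rank_one)
  then have *: "bounded_clinear (theta U a b) \<and> (\<forall>x. norm (theta U a b x) \<le> norm x) \<and>
     (\<forall>x y. ((\<lambda>N. cinner (\<Sum>j<N. scaleC (cinner x (a j)) (b j)) y) \<longlongrightarrow> cinner (theta U a b x) y) U)"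
    unfolding theta_def by (rule someI_ex)
  show "bounded_clinear (theta U a b)" "norm (theta U a b x) \<le> norm x"
    "((\<lambda>N. cinner (\<Sum>j<N. scaleC (cinner x (a j)) (b j)) y) \<longlongrightarrow> cinner (theta U a b x) y) U"
    using * by auto
qed

text \<open>The free ultrafilter refines \<open>sequentially\<close>, so a pairing that is
  eventually constant determines the limit.\<close>

lemma theta_eqI:
  assumes "\<And>y. eventually (\<lambda>N. cinner (\<Sum>j<N. scaleC (cinner x (a j)) (b j)) y = cinner z y) sequentially"
  shows "theta U a b x = z"
proof (rule cinner_eqI)
  fix y
  have nb: "U \<noteq> bot" using U by (simp add: free_ultrafilter_def)
  have "((\<lambda>N. cinner (\<Sum>j<N. scaleC (cinner x (a j)) (b j)) y) \<longlongrightarrow> cinner z y) sequentially"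
    using assms by (rule tendsto_eventually)
  then have "((\<lambda>N. cinner (\<Sum>j<N. scaleC (cinner x (a j)) (b j)) y) \<longlongrightarrow> cinner z y) U"
    using free_ultrafilter_le_sequentially[OF U] by (rule tendsto_mono[rotated])
  then show "cinner (theta U a b x) y = cinner z y"
    using tendsto_unique[OF nb theta_lim] by blast
qed

lemma theta_basis_general: "theta U a b (a i) = scaleC (cinner (a i) (a i)) (b i)"
proof (rule theta_eqI)
  fix y
  have "(\<Sum>j<N. scaleC (cinner (a i) (a j)) (b j)) = scaleC (cinner (a i) (a i)) (b i)" if "i < N" for N
  proof -
    have "(\<Sum>j<N. scaleC (cinner (a i) (a j)) (b j))
        = (\<Sum>j<N. if j = i then scaleC (cinner (a i) (a i)) (b i) else 0)"
      by (rule sum.cong) (use ortho_familyD[OF a] in auto)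
    then show ?thesis using that by (simp add: sum.delta)
  qed
  then show "\<forall>\<^sub>F N in sequentially. cinner (\<Sum>j<N. scaleC (cinner (a i) (a j)) (b j)) y
      = cinner (scaleC (cinner (a i) (a i)) (b i)) y"
    by (intro eventually_sequentiallyI[of "Suc i"]) simp
qed

lemma theta_basis: "(a i = 0 \<Longrightarrow> b i = 0) \<Longrightarrow> theta U a b (a i) = b i"
  using theta_basis_general[of i] by (rule_tac ortho_family_cases[OF a, of i]) (auto simp: scaleC_one)

lemma theta_perp: "(\<And>j. cinner x (a j) = 0) \<Longrightarrow> theta U a b x = 0"
  by (rule theta_eqI) (simp add: always_eventually)

end

text \<open>Swapping the two families replaces each partial sum by its adjoint, and adjoints survive
  weak limits.\<close>

lemma theta_adjoint:
  assumes U: "free_ultrafilter U" and a: "ortho_family a" and b: "ortho_family b"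
  shows "cinner (theta U a b x) y = cinner x (theta U b a y)"
proof -
  have nb: "U \<noteq> bot" using U by (simp add: free_ultrafilter_def)
  have "((\<lambda>N. cnj (cinner (\<Sum>j<N. scaleC (cinner y (b j)) (a j)) x)) \<longlongrightarrow> cnj (cinner (theta U b a y) x)) U"
    by (intro tendsto_intros theta_lim[OF U b a])
  moreover have "cnj (cinner (\<Sum>j<N. scaleC (cinner y (b j)) (a j)) x)
      = cinner (\<Sum>j<N. scaleC (cinner x (a j)) (b j)) y" for N
    unfolding cinner_simps cnj_sum complex_cnj_mult
    by (rule sum.cong) (simp_all add: cinner_commute[symmetric] mult.commute)
  ultimately have "((\<lambda>N. cinner (\<Sum>j<N. scaleC (cinner x (a j)) (b j)) y) \<longlongrightarrow> cinner x (theta U b a y)) U"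
    by (simp add: cinner_commute[symmetric])
  then show ?thesis using tendsto_unique[OF nb theta_lim[OF U a b]] by blast
qed

text \<open>\<open>x - y\<close> is itself orthogonal to every \<open>u j\<close>, so the second
  hypothesis can be tested on it.\<close>

lemma eq_vec_on_basis:
  assumes "\<And>j. cinner x (u j) = cinner y (u j)"
    and "\<And>z. (\<And>j. cinner z (u j) = 0) \<Longrightarrow> cinner x z = cinner y z"
  shows "x = (y::'a::chilbert)"
proof -
  have "cinner x (x - y) = cinner y (x - y)"
    by (rule assms(2)) (simp add: cinner_simps assms(1))
  then have "cinner (x - y) (x - y) = 0" by (simp only: cinner_diff_left[of x y] diff_self)
  then show ?thesis by simp
qed

lemma theta_proj_idem:
  assumes U: "free_ultrafilter U" and u: "ortho_family u"
  shows "theta U u u (theta U u u x) = theta U u u x"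
  by (rule eq_on_basis[OF bcl_compose, OF bcl_theta bcl_theta bcl_theta, OF U u u U u u U u u, where u=u])
    (auto simp: theta_basis[OF U u u] theta_perp[OF U u u] bcl_zero[OF bcl_theta[OF U u u]])

lemma exists_perp_unit:
  fixes F :: "'a::chilbert set"
  assumes inf: "\<forall>S :: 'a set. finite S \<longrightarrow> cspan S \<noteq> UNIV" and F: "finite F"
  shows "\<exists>e. norm e = 1 \<and> (\<forall>x\<in>F. cinner e x = 0)"
proof -
  obtain x :: "nat \<Rightarrow> 'a" and r where x: "F = x ` {i. i < r}"
    using finite_imp_nat_seg_image_inj_on[OF F] by blast
  define u where "u = gs x"
  have u: "ortho_family u" unfolding u_def by (rule ortho_family_gs)
  obtain y where y: "y \<notin> cspan (u ` {..<r})" using inf by blast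
  define t where "t = (\<Sum>j<r. scaleC (cinner y (u j)) (u j))"
  have "t \<in> cspan (u ` {..<r})"
  proof -
    \<comment> \<open>\<open>cspan\<close> sums over sets of vectors, not over indexed families.
      Only zero members can coincide, so removing them makes \<open>u\<close> injective.\<close>
    define A where "A = {j\<in>{..<r}. u j \<noteq> 0}"
    have inj: "inj_on u A"
    proof (rule inj_onI, rule ccontr)
      fix i j assume *: "i \<in> A" "j \<in> A" "u i = u j" "i \<noteq> j"
      then have "cinner (u i) (u i) = 0" using ortho_familyD[OF u, of i j] by simp
      then show False using * by (simp add: A_def)
    qed
    have "t = (\<Sum>j\<in>A. scaleC (cinner y (u j)) (u j))"
      unfolding t_def A_def by (rule sum.mono_neutral_right) auto
    also have "\<dots> = (\<Sum>e\<in>u ` A. scaleC (cinner y e) e)"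
      by (simp add: sum.reindex[OF inj])
    finally show ?thesis unfolding cspan_def
      by (intro CollectI exI[of _ "u ` A"] exI[of _ "\<lambda>e. cinner y e"]) (auto simp: A_def)
  qed
  then have ne: "y - t \<noteq> 0" using y by auto
  have "cinner (y - t) (u j) = 0" if "j < r" for j
    unfolding cinner_diff_left t_def using ortho_family_sum_coeff[OF u, of "{..<r}" j y] that by simp
  then have "\<forall>j<r. cinner (y - t) (x j) = 0"
    using gs_perp_iff[of r "y - t" x] unfolding u_def by blast
  then have "norm ((1 / norm (y - t)) *\<^sub>R (y - t)) = 1 \<and> (\<forall>z\<in>F. cinner ((1 / norm (y - t)) *\<^sub>R (y - t)) z = 0)"
    using ne x by (auto simp: cinner_simps)
  then show ?thesis by blast
qed

text \<open>This is where infinite dimension enters. The sequence provides coordinates for realising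
  \<open>K\<close> inside H and, indexed by pairs, room for infinitely many copies.\<close>

lemma exists_orthonormal_sequence:
  assumes inf: "\<forall>S :: 'a::chilbert set. finite S \<longrightarrow> cspan S \<noteq> UNIV"
  obtains b :: "nat \<Rightarrow> 'a::chilbert" where "ortho_family b" "\<And>i. norm (b i) = 1"
proof -
  have "\<exists>b :: nat \<Rightarrow> 'a. \<forall>n. norm (b n) = 1 \<and> (\<forall>x\<in>b ` {..<n}. cinner (b n) x = 0)"
  proof (rule dependent_wellorder_choice)
    fix r :: 'a and f g :: "nat \<Rightarrow> 'a" and n :: nat
    assume "\<And>y. y < n \<Longrightarrow> f y = g y"
    then have "f ` {..<n} = g ` {..<n}" by (intro image_cong) auto
    then show "(norm r = 1 \<and> (\<forall>x\<in>f ` {..<n}. cinner r x = 0)) = (norm r = 1 \<and> (\<forall>x\<in>g ` {..<n}. cinner r x = 0))"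
      by simp
  next
    fix n and f :: "nat \<Rightarrow> 'a"
    show "\<exists>r. norm r = 1 \<and> (\<forall>x\<in>f ` {..<n}. cinner r x = 0)"
      by (rule exists_perp_unit[OF inf]) simp
  qed
  then obtain b :: "nat \<Rightarrow> 'a" where b: "\<And>n. norm (b n) = 1" "\<And>n m. m < n \<Longrightarrow> cinner (b n) (b m) = 0"
    by blast
  have "cinner (b i) (b j) = 0" if "i \<noteq> j" for i j
    using b(2) that by (metis cinner_commute complex_cnj_zero nat_neq_iff)
  then have "ortho_family b" using b(1) unfolding ortho_family_def by blast
  then show ?thesis using b(1) by (rule that)
qed

text \<open>Each \<open>X i n\<close> expands in the Gram-Schmidt family of its own coordinate
  \<open>n\<close> with \<open>Suc i\<close> coefficients. The limits of these coefficients are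
  transplanted to the fixed family \<open>b\<close>; as the sums stay finite, inner products pass to
  the limit.\<close>

lemma gram_realization:
  fixes X :: "nat \<Rightarrow> nat \<Rightarrow> 'a::chilbert" and b :: "nat \<Rightarrow> 'a"
  assumes U: "free_ultrafilter U" and b: "ortho_family b" "\<And>i. norm (b i) = 1"
    and bd: "\<And>i n. norm (X i n) \<le> K i"
  obtains v :: "nat \<Rightarrow> 'a" where
    "\<And>i j. ((\<lambda>n. cinner (X i n) (X j n)) \<longlongrightarrow> cinner (v i) (v j)) U"
proof -
  have nb: "U \<noteq> bot" using U by (simp add: free_ultrafilter_def)
  define c where "c i j n = cinner (X i n) (gs (\<lambda>k. X k n) j)" for i j n
  have "cmod (c i j n) \<le> K i" for i j n
  proof -
    have "norm (gs (\<lambda>k. X k n) j) \<le> 1" by (rule ortho_family_norm[OF ortho_family_gs])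
    then have "norm (X i n) * norm (gs (\<lambda>k. X k n) j) \<le> norm (X i n)"
      using mult_left_mono[of _ 1 "norm (X i n)"] by simp
    then show ?thesis unfolding c_def
      using cauchy_schwarz[of "X i n" "gs (\<lambda>k. X k n) j"] bd[of i n] by linarith
  qed
  then have "\<exists>l. (c i j \<longlongrightarrow> l) U" for i j
    by (rule_tac ultrafilter_limit[OF U, of "c i j" "K i"]) auto
  then obtain l where l: "\<And>i j. (c i j \<longlongrightarrow> l i j) U" by metis
  define v where "v i = (\<Sum>j<Suc i. scaleC (l i j) (b j))" for i
  have bb: "cinner (b j) (b j) = 1" for j by (simp add: cinner_self_norm b(2))
  \<comment> \<open>Triangularity survives the limit. It makes
    \<open>cinner (v k) (b j) = l k j\<close> true also for \<open>j > k\<close>, so that sums of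
    different lengths can be compared.\<close>
  have l0: "l i j = 0" if "i < j" for i j
  proof -
    have "c i j n = 0" for n unfolding c_def by (rule gs_inner_greater[OF that])
    then have "c i j = (\<lambda>n. 0)" by auto
    then have "(c i j \<longlongrightarrow> 0) U" by simp
    then show ?thesis using tendsto_unique[OF nb l] by blast
  qed
  have vb: "cinner (v k) (b j) = l k j" for k j
    unfolding v_def ortho_family_sum_inner[OF b(1) finite_lessThan] bb using l0[of k j] by simp
  show ?thesis
  proof (rule that)
    fix i k
    have "cinner (v i) (v k) = (\<Sum>j<Suc i. l i j * cnj (l k j))"
    proof -
      have "cinner (b j) (v k) = cnj (l k j)" for j by (subst cinner_commute) (simp add: vb)
      then show ?thesis unfolding v_def[of i] cinner_sum_left cinner_scaleC_left by simp
    qed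
    moreover have "cinner (X i n) (X k n) = (\<Sum>j<Suc i. c i j n * cnj (c k j n))" for n
    proof -
      have "cinner (gs (\<lambda>k. X k n) j) (X k n) = cnj (c k j n)" for j
        unfolding c_def by (rule cinner_commute)
      then show ?thesis
        using arg_cong[OF gs_expand[of "\<lambda>k. X k n" i], of "\<lambda>z. cinner z (X k n)"]
        by (simp only: cinner_sum_left cinner_scaleC_left c_def)
    qed
    ultimately show "((\<lambda>n. cinner (X i n) (X k n)) \<longlongrightarrow> cinner (v i) (v k)) U"
      by (simp only:) (intro tendsto_intros l)
  qed
qed

text \<open>A relation rather than a map: if the \<open>v i\<close> are dependent, one vector has
  several formal combinations and hence several sequences. By \<open>lin_rel_gram\<close> these
  differ only by null sequences.\<close>

inductive lin_rel :: "(nat \<Rightarrow> 'a::chilbert) \<Rightarrow> (nat \<Rightarrow> nat \<Rightarrow> 'a) \<Rightarrow> 'a \<Rightarrow> (nat \<Rightarrow> 'a) \<Rightarrow> bool"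
  for v X where
  base: "lin_rel v X (v i) (X i)"
| add: "lin_rel v X x Y \<Longrightarrow> lin_rel v X x' Y' \<Longrightarrow> lin_rel v X (x + x') (\<lambda>n. Y n + Y' n)"
| scale: "lin_rel v X x Y \<Longrightarrow> lin_rel v X (scaleC a x) (\<lambda>n. scaleC a (Y n))"

lemma lin_rel_zero: "lin_rel v X 0 (\<lambda>n. 0)"
  using lin_rel.scale[OF lin_rel.base, of v X 0 0] by simp

lemma lin_rel_diff:
  assumes "lin_rel v X x Y" "lin_rel v X x' Y'"
  shows "lin_rel v X (x - x') (\<lambda>n. Y n - Y' n)"
  using lin_rel.add[OF assms(1) lin_rel.scale[OF assms(2), of "-1"]] by (simp add: scaleC_minus_one)

lemma lin_rel_sum:
  assumes "finite A" "\<And>j. j \<in> A \<Longrightarrow> lin_rel v X (f j) (Y j)"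
  shows "lin_rel v X (\<Sum>j\<in>A. f j) (\<lambda>n. \<Sum>j\<in>A. Y j n)"
  using assms
proof (induction A rule: finite_induct)
  case (insert a A)
  have "lin_rel v X (f a) (Y a)" "lin_rel v X (\<Sum>j\<in>A. f j) (\<lambda>n. \<Sum>j\<in>A. Y j n)"
    using insert by auto
  from lin_rel.add[OF this] show ?case using insert by simp
qed (simp add: lin_rel_zero)

text \<open>Sesquilinearity carries the convergence from the generators to all combinations, by
  induction on both arguments. With the vector 0 on both sides it shows that a lift of 0 is
  null.\<close>

lemma lin_rel_gram:
  assumes G: "\<And>i j. ((\<lambda>n. cinner (X i n) (X j n)) \<longlongrightarrow> cinner (v i) (v j)) U"
    and 1: "lin_rel v X x Y" and 2: "lin_rel v X x' Y'"
  shows "((\<lambda>n. cinner (Y n) (Y' n)) \<longlongrightarrow> cinner x x') U"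
  using 1
proof induction
  case (base i)
  show ?case using 2
  proof induction
    case (base j) then show ?case by (rule G)
  next
    case (add x Y x' Y')
    show ?case unfolding cinner_add_right by (intro tendsto_add add.IH)
  next
    case (scale x Y a)
    show ?case unfolding cinner_scaleC_right by (intro tendsto_mult tendsto_const scale.IH)
  qed
next
  case (add x Y x' Y')
  show ?case unfolding cinner_add_left by (intro tendsto_add add.IH)
next
  case (scale x Y a)
  show ?case unfolding cinner_scaleC_left by (intro tendsto_mult tendsto_const scale.IH)
qed

lemma gs_eq_zero: "x i = 0 \<Longrightarrow> gs x i = 0"
  by (subst gs_eq) (simp add: gs_residual_def)

text \<open>The Gram-Schmidt family of \<open>v\<close> lifts to sequences \<open>z i\<close> that
  are orthonormal only in the limit. A second orthonormalisation in each coordinate gives exact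
  families \<open>w n\<close>, so that every \<open>\<Phi> n\<close> is a genuine contraction and
  not merely one along \<open>U\<close>.\<close>

lemma lift_to_ultrapower:
  fixes v :: "nat \<Rightarrow> 'a::chilbert"
  assumes U: "free_ultrafilter U"
    and G: "\<And>i j. ((\<lambda>n. cinner (X i n) (X j n)) \<longlongrightarrow> cinner (v i) (v j)) U"
  obtains \<Phi> :: "nat \<Rightarrow> 'a \<Rightarrow> 'a" where
    "\<And>n. bounded_clinear (\<Phi> n)" "\<And>n x. norm (\<Phi> n x) \<le> norm x"
    "\<And>i. ((\<lambda>n. \<Phi> n (v i) - X i n) \<longlongrightarrow> 0) U"
    "\<And>x y. ((\<lambda>n. cinner (\<Phi> n x) (\<Phi> n y)) \<longlongrightarrow> cinner (theta U (gs v) (gs v) x) y) U"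
proof -
  have nb: "U \<noteq> bot" using U by (simp add: free_ultrafilter_def)
  define u where "u = gs v"
  have u: "ortho_family u" unfolding u_def by (rule ortho_family_gs)
  have "\<exists>z. lin_rel v X (u i) z" for i
  proof (induction i rule: less_induct)
    case (less i)
    then obtain z where z: "\<And>j. j < i \<Longrightarrow> lin_rel v X (u j) (z j)" by metis
    have "lin_rel v X (gs_residual v i)
        (\<lambda>n. X i n - (\<Sum>j<i. scaleC (cinner (v i) (gs v j)) (z j n)))"
      unfolding gs_residual_def
      by (intro lin_rel_diff lin_rel.base lin_rel_sum lin_rel.scale) (use z u_def in auto)
    from lin_rel.scale[OF this] show ?case
      unfolding u_def gs_eq[of v i] scaleR_scaleC by blast
  qed
  \<comment> \<open>A lift of a zero member could be null without being zero. The exact zero is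
    chosen, as \<open>gs_close\<close> and \<open>theta_basis\<close> require.\<close>
  then have "\<exists>z. lin_rel v X (u i) z \<and> (u i = 0 \<longrightarrow> z = (\<lambda>n. 0))" for i
    by (metis lin_rel_zero)
  then obtain z where z: "\<And>i. lin_rel v X (u i) (z i)" "\<And>i. u i = 0 \<Longrightarrow> z i = (\<lambda>n. 0)" by metis
  note zG = lin_rel_gram[OF G]
  define w where "w n = gs (\<lambda>j. z j n)" for n
  have w: "ortho_family (w n)" for n unfolding w_def by (rule ortho_family_gs)
  have wz: "((\<lambda>n. w n i - z i n) \<longlongrightarrow> 0) U" for i
    unfolding w_def
  proof (rule gs_close)
    fix i j :: nat assume "i \<noteq> j"
    then show "((\<lambda>n. cinner (z i n) (z j n)) \<longlongrightarrow> 0) U"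
      using zG[OF z(1)[of i] z(1)[of j]] ortho_familyD[OF u, of i j] by simp
  next
    fix i
    show "(\<forall>n. z i n = 0) \<or> ((\<lambda>n. norm (z i n)) \<longlongrightarrow> 1) U"
    proof (rule ortho_family_cases[OF u, of i])
      assume 1: "cinner (u i) (u i) = 1"
      have "((\<lambda>n. sqrt (Re (cinner (z i n) (z i n)))) \<longlongrightarrow> sqrt (Re 1)) U"
        using zG[OF z(1)[of i] z(1)[of i]] unfolding 1 by (intro tendsto_intros)
      then show ?thesis by (simp add: Re_cinner_self)
    qed (use z(2) in auto)
  qed
  define \<Phi> where "\<Phi> n = theta U u (w n)" for n
  have bcl: "bounded_clinear (\<Phi> n)" for n unfolding \<Phi>_def by (rule bcl_theta[OF U u w])
  have le: "norm (\<Phi> n x) \<le> norm x" for n x unfolding \<Phi>_def by (rule theta_le[OF U u w])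
  have \<Phi>u: "\<Phi> n (u i) = w n i" for n i
    unfolding \<Phi>_def
  proof (rule theta_basis[OF U u w])
    assume "u i = 0" then show "w n i = 0" unfolding w_def by (intro gs_eq_zero) (simp add: z(2))
  qed
  have \<Phi>perp: "\<Phi> n x = 0" if "\<And>j. cinner x (u j) = 0" for n x
    unfolding \<Phi>_def by (rule theta_perp[OF U u w that])
  have \<Phi>v: "((\<lambda>n. \<Phi> n (v i) - X i n) \<longlongrightarrow> 0) U" for i
  proof -
    let ?c = "\<lambda>j. cinner (v i) (u j)"
    \<comment> \<open>The expansion of \<open>v i\<close> gives a second lift of the same vector;
      the difference of both is a lift of 0, hence null.\<close>
    have "lin_rel v X (v i - (\<Sum>j<Suc i. scaleC (?c j) (u j))) (\<lambda>n. X i n - (\<Sum>j<Suc i. scaleC (?c j) (z j n)))"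
      by (intro lin_rel_diff lin_rel.base lin_rel_sum lin_rel.scale z) auto
    moreover have e: "v i = (\<Sum>j<Suc i. scaleC (?c j) (u j))" unfolding u_def by (rule gs_expand)
    ultimately have "lin_rel v X 0 (\<lambda>n. X i n - (\<Sum>j<Suc i. scaleC (?c j) (z j n)))" by simp
    from zG[OF this this] have "((\<lambda>n. sqrt (Re (cinner (X i n - (\<Sum>j<Suc i. scaleC (?c j) (z j n))) (X i n - (\<Sum>j<Suc i. scaleC (?c j) (z j n)))))) \<longlongrightarrow> sqrt (Re (cinner (0::'a) 0))) U"
      by (intro tendsto_intros)
    then have 1: "((\<lambda>n. X i n - (\<Sum>j<Suc i. scaleC (?c j) (z j n))) \<longlongrightarrow> 0) U"
      unfolding Re_cinner_self by (simp add: tendsto_norm_zero_iff del: sum.lessThan_Suc)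
    have "((\<lambda>n. \<Sum>j<Suc i. scaleC (?c j) (w n j - z j n)) \<longlongrightarrow> (\<Sum>j<Suc i. 0)) U"
    proof (rule tendsto_sum)
      fix j
      show "((\<lambda>n. scaleC (?c j) (w n j - z j n)) \<longlongrightarrow> 0) U"
        by (rule tendsto_0_le[OF wz[of j], where K="cmod (?c j)"]) (simp add: mult.commute)
    qed
    from tendsto_diff[OF this 1]
    have "((\<lambda>n. (\<Sum>j<Suc i. scaleC (?c j) (w n j)) - X i n) \<longlongrightarrow> 0) U"
      by (simp add: scaleC_diff_right sum_subtractf algebra_simps del: sum.lessThan_Suc)
    moreover have "\<Phi> n (v i) = (\<Sum>j<Suc i. scaleC (?c j) (w n j))" for n
      by (subst e) (simp only: bcl_sum[OF bcl] bcl_scaleC[OF bcl] \<Phi>u)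
    ultimately show ?thesis by simp
  qed
  have wG: "((\<lambda>n. cinner (w n i) (w n j)) \<longlongrightarrow> cinner (u i) (u j)) U" for i j
  proof (cases "i = j")
    case False
    then show ?thesis using ortho_familyD[OF w] ortho_familyD[OF u] by simp
  next
    case True
    show ?thesis
    proof (rule ortho_family_cases[OF u, of i])
      assume "u i = 0" then have "w n i = 0" for n unfolding w_def by (intro gs_eq_zero) (simp add: z(2))
      then show ?thesis using \<open>u i = 0\<close> by simp
    next
      assume 1: "cinner (u i) (u i) = 1"
      have "((\<lambda>n. sqrt (Re (cinner (z i n) (z i n)))) \<longlongrightarrow> sqrt (Re 1)) U"
        using zG[OF z(1)[of i] z(1)[of i]] unfolding 1 by (intro tendsto_intros)
      then have nz: "((\<lambda>n. norm (z i n)) \<longlongrightarrow> 1) U" by (simp add: Re_cinner_self)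
      have "((\<lambda>n. norm (w n i) - norm (z i n)) \<longlongrightarrow> 0) U"
        by (rule tendsto_0_le[OF wz[of i], where K=1]) (auto intro!: always_eventually norm_triangle_ineq3)
      from tendsto_add[OF this nz] have "((\<lambda>n. norm (w n i)) \<longlongrightarrow> 1) U" by simp
      then have "((\<lambda>n. complex_of_real ((norm (w n i))\<^sup>2)) \<longlongrightarrow> of_real (1\<^sup>2)) U"
        by (intro tendsto_intros)
      then show ?thesis using 1 True by (simp add: cinner_self_norm del: of_real_power)
    qed
  qed
  have "((\<lambda>n. cinner (\<Phi> n x) (\<Phi> n y)) \<longlongrightarrow> cinner (theta U u u x) y) U" for x y
  proof -
    \<comment> \<open>The limit of the forms is an operator, which is then compared with the
      projection on the \<open>u i\<close> and on their complement.\<close>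
    obtain Q where Q: "bounded_clinear Q"
      "\<And>x y. ((\<lambda>n. cinner (cadjoint (\<Phi> n) (\<Phi> n x)) y) \<longlongrightarrow> cinner (Q x) y) U"
    proof (rule weak_ultralimit[OF U, where K=1 and A="\<lambda>n x. cadjoint (\<Phi> n) (\<Phi> n x)"])
      show "norm (cadjoint (\<Phi> n) (\<Phi> n x)) \<le> 1 * norm x" for n x
        using cadjoint_norm_bound[OF bcl, of n 1 "\<Phi> n x"] le[of n] order_trans[OF _ le[of n x]] by simp
    qed (auto intro: bcl_compose bcl_cadjoint bcl)
    have Q2: "((\<lambda>n. cinner (\<Phi> n x) (\<Phi> n y)) \<longlongrightarrow> cinner (Q x) y) U" for x y
      using Q(2)[of x y] by (simp add: cadjoint_left[OF bcl])
    have "Q x = theta U u u x"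
    proof (rule eq_on_basis[OF Q(1) bcl_theta[OF U u u], where u=u])
      fix i
      have "Q (u i) = u i"
      proof (rule eq_vec_on_basis[where u=u])
        fix j
        show "cinner (Q (u i)) (u j) = cinner (u i) (u j)"
          using tendsto_unique[OF nb Q2[of "u i" "u j"]] wG[of i j] by (simp add: \<Phi>u)
      next
        fix y assume y: "\<And>j. cinner y (u j) = 0"
        have "cinner (u i) y = 0" using y[of i] by (metis cinner_commute complex_cnj_zero)
        then show "cinner (Q (u i)) y = cinner (u i) y"
          using tendsto_unique[OF nb Q2[of "u i" y]] by (simp add: \<Phi>perp[OF y])
      qed
      then show "Q (u i) = theta U u u (u i)" by (simp add: theta_basis[OF U u u])
    next
      fix x assume x: "\<And>j. cinner x (u j) = 0"
      have "Q x = 0"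
        by (rule cinner_eqI) (use tendsto_unique[OF nb Q2[of x]] in \<open>simp add: \<Phi>perp[OF x]\<close>)
      then show "Q x = theta U u u x" by (simp add: theta_perp[OF U u u x])
    qed
    then show ?thesis using Q2[of x y] by simp
  qed
  then show ?thesis using that[OF bcl le \<Phi>v] by (simp add: u_def)
qed

section \<open>Small compact operators and slowly varying partitions\<close>

text \<open>The rank one summands stay explicit, so adjoints and composites are computed term by
  term and no dimension of a range is discussed.\<close>

inductive finite_rank :: "('a::chilbert \<Rightarrow> 'a) \<Rightarrow> bool" where
  zero: "finite_rank (\<lambda>x. 0)"
| add: "finite_rank F \<Longrightarrow> finite_rank (\<lambda>x. F x + scaleC (cinner x a) b)"

lemma finite_rank_bcl: "finite_rank F \<Longrightarrow> bounded_clinear F"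
  by (induction rule: finite_rank.induct) (simp_all add: bcl_0 bcl_plus bcl_rank_one)

lemma finite_rank_plus:
  assumes F: "finite_rank F" and G: "finite_rank G" shows "finite_rank (\<lambda>x. F x + G x)"
  using G
proof (induction rule: finite_rank.induct)
  case zero show ?case using F by simp
next
  case (add G a b)
  from finite_rank.add[OF add.IH, of a b] show ?case by (simp add: add.assoc)
qed

lemma finite_rank_left:
  assumes A: "bounded_clinear A" and F: "finite_rank F" shows "finite_rank (\<lambda>x. A (F x))"
  using F
proof (induction rule: finite_rank.induct)
  case zero show ?case by (simp add: bcl_zero[OF A] finite_rank.zero)
next
  case (add F a b)
  from finite_rank.add[OF add.IH, of a "A b"] show ?case by (simp add: bcl_simps[OF A])
qed

lemma finite_rank_right:
  assumes A: "bounded_clinear A" and F: "finite_rank F" shows "finite_rank (\<lambda>x. F (A x))"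
  using F
proof (induction rule: finite_rank.induct)
  case zero show ?case by (rule finite_rank.zero)
next
  case (add F a b)
  from finite_rank.add[OF add.IH, of "cadjoint A a" b] show ?case by (simp add: cadjoint_right[OF A])
qed

lemma finite_rank_uminus:
  assumes "finite_rank F" shows "finite_rank (\<lambda>x. - F x)"
  using finite_rank_left[OF bcl_uminus[OF bcl_id] assms] .

lemma finite_rank_minus: "finite_rank F \<Longrightarrow> finite_rank G \<Longrightarrow> finite_rank (\<lambda>x. F x - G x)"
  using finite_rank_plus[OF _ finite_rank_uminus] by fastforce

lemma finite_rank_sum:
  assumes "finite A" shows "finite_rank (\<lambda>x. \<Sum>p\<in>A. scaleC (cinner x (a p)) (b p))"
  using assms
proof (induction rule: finite_induct)
  case empty show ?case by (simp add: finite_rank.zero)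
next
  case (insert p A)
  from finite_rank.add[OF insert.IH, of "a p" "b p"] show ?case using insert.hyps by (simp add: add.commute)
qed

lemma finite_rank_adjoint:
  "finite_rank F \<Longrightarrow> \<exists>G. finite_rank G \<and> (\<forall>x y. cinner (G x) y = cinner x (F y))"
proof (induction rule: finite_rank.induct)
  case zero show ?case by (intro exI[of _ "\<lambda>x. 0"]) (simp add: finite_rank.zero)
next
  case (add F a b)
  then obtain G where G: "finite_rank G" "\<forall>x y. cinner (G x) y = cinner x (F y)" by blast
  have "cinner (G x + scaleC (cinner x b) a) y = cinner x (F y + scaleC (cinner y a) b)" for x y
    using G(2) by (simp add: cinner_simps cinner_commute[symmetric] mult.commute)
  then show ?case using finite_rank.add[OF G(1), of b a] by blast
qed

lemma bounded_bilinear_scaleC: "bounded_bilinear (scaleC :: complex \<Rightarrow> 'a::chilbert \<Rightarrow> 'a)"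
  by standard (auto simp: scaleC_add_left scaleC_add_right scaleR_scaleC scaleC_scaleC scaleR_conv_of_real mult.commute intro!: exI[of _ 1])

lemma finite_rank_image:
  "finite_rank F \<Longrightarrow> \<exists>K. compact K \<and> F ` cball 0 1 \<subseteq> K"
proof (induction rule: finite_rank.induct)
  case zero show ?case by (intro exI[of _ "{0}"]) auto
next
  case (add F a b)
  then obtain K where K: "compact K" "F ` cball 0 1 \<subseteq> K" by blast
  define C where "C = (\<lambda>z. scaleC z b) ` cball 0 (norm a)"
  have "compact C"
    unfolding C_def
    by (intro compact_continuous_image compact_cball linear_continuous_on
        bounded_bilinear.bounded_linear_left[OF bounded_bilinear_scaleC])
  then have "compact {x + y | x y. x \<in> K \<and> y \<in> C}" by (rule compact_sums[OF K(1)])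
  moreover have "(\<lambda>x. F x + scaleC (cinner x a) b) ` cball 0 1 \<subseteq> {x + y | x y. x \<in> K \<and> y \<in> C}"
  proof (rule image_subsetI)
    fix x :: 'a assume x: "x \<in> cball 0 1"
    have "cmod (cinner x a) \<le> norm a"
      using cauchy_schwarz[of x a] mult_right_mono[of "norm x" 1 "norm a"] x by simp
    then have "scaleC (cinner x a) b \<in> C" unfolding C_def by auto
    moreover have "F x \<in> K" using K(2) x by blast
    ultimately show "F x + scaleC (cinner x a) b \<in> {x + y | x y. x \<in> K \<and> y \<in> C}" by blast
  qed
  ultimately show ?case by blast
qed

text \<open>Compactness is expressed by norm approximation with finite rank operators rather than
  through images of the ball: in this form it passes at once to adjoints and to norm convergent
  series.\<close>

definition small_compact :: "real \<Rightarrow> ('a::chilbert \<Rightarrow> 'a) \<Rightarrow> bool" where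
  "small_compact c B \<longleftrightarrow> 0 \<le> c \<and> bounded_clinear B \<and> (\<forall>x. norm (B x) \<le> c * norm x) \<and>
     (\<forall>d>0. \<exists>F. finite_rank F \<and> (\<forall>x. norm (B x - F x) \<le> d * norm x))"

lemma small_compactD:
  assumes "small_compact c B"
  shows "0 \<le> c" "bounded_clinear B" "norm (B x) \<le> c * norm x"
    "0 < d \<Longrightarrow> \<exists>F. finite_rank F \<and> (\<forall>x. norm (B x - F x) \<le> d * norm x)"
  using assms by (auto simp: small_compact_def)

lemma small_compact_finite_rank:
  assumes "finite_rank F" "\<And>x. norm (F x) \<le> c * norm x" "0 \<le> c" shows "small_compact c F"
  unfolding small_compact_def using assms by (auto simp: finite_rank_bcl intro!: exI[of _ F])

lemma small_compact_left:
  assumes A: "bounded_clinear A" "\<And>x. norm (A x) \<le> norm x" and B: "small_compact c B"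
  shows "small_compact c (\<lambda>x. A (B x))"
  unfolding small_compact_def
proof (intro conjI allI impI)
  show "0 \<le> c" by (rule small_compactD[OF B])
  show "bounded_clinear (\<lambda>x. A (B x))" by (rule bcl_compose[OF A(1) small_compactD(2)[OF B]])
  show "norm (A (B x)) \<le> c * norm x" for x using A(2) small_compactD(3)[OF B] order_trans by blast
  fix d :: real assume "0 < d"
  then obtain F where F: "finite_rank F" "\<And>x. norm (B x - F x) \<le> d * norm x"
    using small_compactD(4)[OF B] by blast
  have "norm (A (B x) - A (F x)) \<le> d * norm x" for x
    unfolding bcl_diff[OF A(1), symmetric] using A(2) F(2) order_trans by blast
  then show "\<exists>F. finite_rank F \<and> (\<forall>x. norm (A (B x) - F x) \<le> d * norm x)"
    using finite_rank_left[OF A(1) F(1)] by (intro exI[of _ "\<lambda>x. A (F x)"]) blast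
qed

lemma small_compact_right:
  assumes A: "bounded_clinear A" "\<And>x. norm (A x) \<le> norm x" and B: "small_compact c B"
  shows "small_compact c (\<lambda>x. B (A x))"
  unfolding small_compact_def
proof (intro conjI allI impI)
  have le: "norm (C (A x)) \<le> d * norm x" if "0 \<le> d" "\<And>x. norm (C x) \<le> d * norm x" for C d x
    using that(2)[of "A x"] mult_left_mono[OF A(2)[of x] that(1)] by linarith
  show c: "0 \<le> c" by (rule small_compactD[OF B])
  show "bounded_clinear (\<lambda>x. B (A x))" by (rule bcl_compose[OF small_compactD(2)[OF B] A(1)])
  show "norm (B (A x)) \<le> c * norm x" for x by (rule le[OF c small_compactD(3)[OF B]])
  fix d :: real assume d: "0 < d"
  then obtain F where F: "finite_rank F" "\<And>x. norm (B x - F x) \<le> d * norm x"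
    using small_compactD(4)[OF B] by blast
  have "norm (B (A x) - F (A x)) \<le> d * norm x" for x
    using le[of d "\<lambda>x. B x - F x"] F(2) d by simp
  then show "\<exists>F. finite_rank F \<and> (\<forall>x. norm (B (A x) - F x) \<le> d * norm x)"
    using finite_rank_right[OF A(1) F(1)] by (intro exI[of _ "\<lambda>x. F (A x)"]) blast
qed

lemma small_compact_plus:
  assumes A: "small_compact a A" and B: "small_compact b B"
  shows "small_compact (a + b) (\<lambda>x. A x + B x)"
  unfolding small_compact_def
proof (intro conjI allI impI)
  show "0 \<le> a + b" using small_compactD(1)[OF A] small_compactD(1)[OF B] by simp
  show "bounded_clinear (\<lambda>x. A x + B x)" by (rule bcl_plus[OF small_compactD(2)[OF A] small_compactD(2)[OF B]])
  show "norm (A x + B x) \<le> (a + b) * norm x" for x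
    using norm_triangle_mono[OF small_compactD(3)[OF A, of x] small_compactD(3)[OF B, of x]] by (simp add: algebra_simps)
  fix d :: real assume "0 < d"
  then have d: "0 < d / 2" by simp
  obtain F where F: "finite_rank F" "\<And>x. norm (A x - F x) \<le> d / 2 * norm x"
    using small_compactD(4)[OF A d] by blast
  obtain G where G: "finite_rank G" "\<And>x. norm (B x - G x) \<le> d / 2 * norm x"
    using small_compactD(4)[OF B d] by blast
  have "norm (A x + B x - (F x + G x)) \<le> d * norm x" for x
    using norm_triangle_mono[OF F(2)[of x] G(2)[of x]] by (simp add: algebra_simps)
  then show "\<exists>F. finite_rank F \<and> (\<forall>x. norm (A x + B x - F x) \<le> d * norm x)"
    using finite_rank_plus[OF F(1) G(1)] by (intro exI[of _ "\<lambda>x. F x + G x"]) blast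
qed

lemma small_compact_uminus: "small_compact c B \<Longrightarrow> small_compact c (\<lambda>x. - B x)"
  using small_compact_left[OF bcl_uminus[OF bcl_id], of c B] by simp

lemma small_compact_minus:
  assumes "small_compact a A" "small_compact b B" shows "small_compact (a + b) (\<lambda>x. A x - B x)"
  using small_compact_plus[OF assms(1) small_compact_uminus[OF assms(2)]] by simp

lemma small_compact_cadjoint:
  assumes B: "small_compact c B" shows "small_compact c (cadjoint B)"
  unfolding small_compact_def
proof (intro conjI allI impI)
  note Bb = small_compactD(2)[OF B]
  show c: "0 \<le> c" by (rule small_compactD[OF B])
  show "bounded_clinear (cadjoint B)" by (rule bcl_cadjoint[OF Bb])
  show "norm (cadjoint B x) \<le> c * norm x" for x
    by (rule cadjoint_norm_bound[OF Bb small_compactD(3)[OF B] c])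
  fix d :: real assume d: "0 < d"
  then obtain F where F: "finite_rank F" "\<And>x. norm (B x - F x) \<le> d * norm x"
    using small_compactD(4)[OF B] by blast
  obtain G where G: "finite_rank G" "\<forall>x y. cinner (G x) y = cinner x (F y)"
    using finite_rank_adjoint[OF F(1)] by blast
  have "norm (cadjoint B x - G x) \<le> d * norm x" for x
    by (rule adjoint_norm_bound[where V="\<lambda>x. cadjoint B x - G x" and T="\<lambda>x. B x - F x"])
      (use F(2) d G(2) in \<open>auto simp: cinner_simps cadjoint_left[OF Bb]\<close>)
  then show "\<exists>F. finite_rank F \<and> (\<forall>x. norm (cadjoint B x - F x) \<le> d * norm x)"
    using G(1) by blast
qed

lemma small_compact_sum:
  assumes "finite I" "\<And>i. i \<in> I \<Longrightarrow> small_compact (c i) (B i)"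
  shows "small_compact (\<Sum>i\<in>I. c i) (\<lambda>x. \<Sum>i\<in>I. B i x)"
  using assms
proof (induction I rule: finite_induct)
  case empty show ?case by (simp add: small_compact_finite_rank finite_rank.zero)
next
  case (insert i I)
  have "small_compact (c i) (B i)" "small_compact (\<Sum>i\<in>I. c i) (\<lambda>x. \<Sum>i\<in>I. B i x)" using insert by auto
  from small_compact_plus[OF this] show ?case using insert.hyps by simp
qed

text \<open>Finite rank approximation of a partial sum costs \<open>d / 2\<close>, and the tail of
  the summable bounds costs the other half.\<close>

lemma small_compact_suminf:
  fixes B :: "nat \<Rightarrow> 'a::chilbert \<Rightarrow> 'a"
  assumes B: "\<And>n. small_compact (c n) (B n)" and c: "summable c"
  shows "small_compact (suminf c) (\<lambda>x. \<Sum>n. B n x)" and "summable (\<lambda>n. B n x)"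
proof -
  have c0: "0 \<le> c n" for n by (rule small_compactD[OF B])
  have cs: "summable (\<lambda>n. c n * norm x)" for x :: 'a using c by (rule summable_mult2)
  have ns: "summable (\<lambda>n. norm (B n x))" for x
    by (rule summable_comparison_test'[OF cs[of x], of 0]) (simp add: small_compactD(3)[OF B])
  show sB: "summable (\<lambda>n. B n x)" for x by (rule summable_norm_cancel[OF ns])
  have tail: "norm (\<Sum>n. B (n + N) x) \<le> (\<Sum>n. c (n + N)) * norm x" for N x
  proof -
    have "norm (\<Sum>n. B (n + N) x) \<le> (\<Sum>n. norm (B (n + N) x))"
      using ns summable_iff_shift[of "\<lambda>n. norm (B n x)" N] by (intro summable_norm) blast
    also have "\<dots> \<le> (\<Sum>n. c (n + N) * norm x)"
      using ns summable_iff_shift[of "\<lambda>n. norm (B n x)" N] cs summable_iff_shift[of "\<lambda>n. c n * norm x" N]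
      by (intro suminf_le small_compactD(3)[OF B]) blast+
    also have "\<dots> = (\<Sum>n. c (n + N)) * norm x"
      using c summable_iff_shift[of c N] by (intro suminf_mult2[symmetric]) blast
    finally show ?thesis .
  qed
  have split: "(\<Sum>n. B n x) = (\<Sum>n. B (n + N) x) + (\<Sum>n<N. B n x)" for N x
    by (rule suminf_split_initial_segment[OF sB])
  show "small_compact (suminf c) (\<lambda>x. \<Sum>n. B n x)"
    unfolding small_compact_def
  proof (intro conjI allI impI)
    show "0 \<le> suminf c" by (rule suminf_nonneg[OF c c0])
    show b: "norm (\<Sum>n. B n x) \<le> suminf c * norm x" for x using tail[of 0 x] by simp
    note Bb = small_compactD(2)[OF B]
    show "bounded_clinear (\<lambda>x. \<Sum>n. B n x)"
    proof (rule bounded_clinearI[OF _ _ b])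
      show "(\<Sum>n. B n (x + y)) = (\<Sum>n. B n x) + (\<Sum>n. B n y)" for x y
        by (simp add: bcl_add[OF Bb] suminf_add[OF sB sB])
      show "(\<Sum>n. B n (scaleC a x)) = scaleC a (\<Sum>n. B n x)" for a x
        using bounded_linear.suminf[OF bounded_bilinear.bounded_linear_right[OF bounded_bilinear_scaleC] sB, of a x]
        by (simp add: bcl_scaleC[OF Bb])
    qed
    fix d :: real assume d: "0 < d"
    obtain N where N: "(\<Sum>n. c (n + N)) < d / 2"
      using suminf_exist_split2[OF c] order_tendstoD(2)[of "\<lambda>N. \<Sum>n. c (n + N)" 0 sequentially "d / 2"] d
      by (auto simp: eventually_sequentially)
    have "small_compact (\<Sum>n<N. c n) (\<lambda>x. \<Sum>n<N. B n x)" by (rule small_compact_sum[OF _ B]) simp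
    from small_compactD(4)[OF this, of "d / 2"] d
    obtain F where F: "finite_rank F" "\<And>x. norm ((\<Sum>n<N. B n x) - F x) \<le> d / 2 * norm x" by auto
    have "norm ((\<Sum>n. B n x) - F x) \<le> d * norm x" for x
    proof -
      have "(\<Sum>n. c (n + N)) * norm x \<le> d / 2 * norm x" using N by (intro mult_right_mono) auto
      then have t: "norm (\<Sum>n. B (n + N) x) \<le> d / 2 * norm x" using tail[of N x] by linarith
      have "norm ((\<Sum>n. B (n + N) x) + ((\<Sum>n<N. B n x) - F x)) \<le> d / 2 * norm x + d / 2 * norm x"
        by (rule norm_triangle_mono[OF t F(2)])
      then show ?thesis unfolding split[of x N] by (simp add: algebra_simps)
    qed
    then show "\<exists>F. finite_rank F \<and> (\<forall>x. norm ((\<Sum>n. B n x) - F x) \<le> d * norm x)" using F(1) by blast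
  qed
qed

lemma small_compact_imp_compact_op:
  assumes B: "small_compact c (B :: 'a::chilbert \<Rightarrow> 'a)" shows "compact_op B"
  unfolding compact_op_def compact_eq_totally_bounded
proof (intro conjI allI impI)
  show "complete (closure (B ` cball 0 1))" by (simp add: complete_eq_closed)
  fix e :: real assume e: "0 < e"
  then obtain F where F: "finite_rank F" "\<And>x. norm (B x - F x) \<le> e / 4 * norm x"
    using small_compactD(4)[OF B, of "e / 4"] by auto
  obtain K where K: "compact K" "F ` cball 0 1 \<subseteq> K" using finite_rank_image[OF F(1)] by blast
  obtain k where k: "finite k" "K \<subseteq> (\<Union>x\<in>k. ball x (e / 4))"
    using K(1) e unfolding compact_eq_totally_bounded by (metis divide_pos_pos zero_less_numeral)
  \<comment> \<open>Closed balls of an intermediate radius: their finite union is closed, so it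
    still contains the closure of the image.\<close>
  have "B ` cball 0 1 \<subseteq> (\<Union>x\<in>k. cball x (e / 2))"
  proof (rule image_subsetI)
    fix x :: 'a assume x: "x \<in> cball 0 1"
    then obtain y where y: "y \<in> k" "dist y (F x) < e / 4" using K(2) k(2) by fastforce
    have "norm (B x - F x) \<le> e / 4"
    proof -
      have "e / 4 * norm x \<le> e / 4 * 1" using x e by (intro mult_left_mono) auto
      then show ?thesis using F(2)[of x] by linarith
    qed
    then have "dist y (B x) \<le> e / 2"
      using dist_triangle[of y "B x" "F x"] y(2) by (simp add: dist_norm norm_minus_commute)
    then show "B x \<in> (\<Union>x\<in>k. cball x (e / 2))" using y(1) by auto
  qed
  moreover have "closed (\<Union>x\<in>k. cball x (e / 2))" using k(1) by (intro closed_UN) auto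
  ultimately have "closure (B ` cball 0 1) \<subseteq> (\<Union>x\<in>k. cball x (e / 2))" by (rule closure_minimal)
  also have "\<dots> \<subseteq> (\<Union>x\<in>k. ball x e)" using e by (intro UN_mono) (auto simp: subset_eq)
  finally show "\<exists>k. finite k \<and> closure (B ` cball 0 1) \<subseteq> (\<Union>x\<in>k. ball x e)" using k(1) by blast
qed

text \<open>In block form the commutator has the entries of \<open>S\<close> multiplied by
  \<open>g k - g l\<close>. The diagonal cancels, and the band hypothesis leaves only neighbouring
  blocks, where this factor is at most \<open>\<delta>\<close>. Block \<open>L\<close>, of weight 0,
  is a buffer into which \<open>S\<close> may leak from the blocks below.\<close>

lemma commutator_bound:
  fixes S :: "'a::chilbert \<Rightarrow> 'a" and Q :: "nat \<Rightarrow> 'a \<Rightarrow> 'a"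
  assumes S: "bounded_clinear S" "\<And>x. norm (S x) \<le> s * norm x" "0 \<le> s"
    and Qsa: "\<And>k x y. cinner (Q k x) y = cinner x (Q k y)"
    and Qb: "\<And>x. (\<Sum>k\<le>L. (norm (Q k x))\<^sup>2) \<le> (norm x)\<^sup>2"
    and r1: "\<And>k x y. k < L \<Longrightarrow> cinner (S (Q k x)) y = (\<Sum>l\<le>L. cinner (S (Q k x)) (Q l y))"
    and r2: "\<And>k x y. k < L \<Longrightarrow> cinner (S x) (Q k y) = (\<Sum>l\<le>L. cinner (S (Q l x)) (Q k y))"
    and band: "\<And>k l x y. l \<noteq> k \<Longrightarrow> l \<noteq> Suc k \<Longrightarrow> k \<noteq> Suc l \<Longrightarrow> cinner (S (Q k x)) (Q l y) = 0"
    and gL: "g L = 0" and g: "\<And>k. \<bar>g k - g (Suc k)\<bar> \<le> \<delta>"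
    and E: "\<And>x. E x = (\<Sum>k<L. g k *\<^sub>R Q k x)"
  shows "norm (S (E x) - E (S x)) \<le> 2 * \<delta> * s * norm x"
proof -
  have \<delta>: "0 \<le> \<delta>" using g[of 0] by linarith
  define A where "A x y k l = cinner (S (Q k x)) (Q l y)" for x y k l
  have form: "cinner (S (E x) - E (S x)) y = (\<Sum>k\<le>L. \<Sum>l\<le>L. of_real (g k - g l) * A x y k l)" for x y
  proof -
    have 1: "cinner (S (E x)) y = (\<Sum>k\<le>L. \<Sum>l\<le>L. of_real (g k) * A x y k l)"
    proof -
      have "cinner (S (E x)) y = (\<Sum>k<L. of_real (g k) * cinner (S (Q k x)) y)"
        unfolding E by (simp add: bcl_simps[OF S(1)] cinner_simps scaleR_scaleC)
      also have "\<dots> = (\<Sum>k<L. \<Sum>l\<le>L. of_real (g k) * A x y k l)"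
        by (rule sum.cong) (simp_all add: r1 A_def sum_distrib_left)
      \<comment> \<open>The term \<open>k = L\<close> vanishes because \<open>g L = 0\<close>. With
        it both double sums run over the same square and can be compared by swapping.\<close>
      also have "\<dots> = (\<Sum>k<Suc L. \<Sum>l\<le>L. of_real (g k) * A x y k l)" by (simp add: gL)
      finally show ?thesis by (simp only: lessThan_Suc_atMost)
    qed
    have 2: "cinner (E (S x)) y = (\<Sum>k\<le>L. \<Sum>l\<le>L. of_real (g k) * A x y l k)"
    proof -
      have "cinner (E (S x)) y = (\<Sum>k<L. of_real (g k) * cinner (S x) (Q k y))"
        unfolding E by (simp add: cinner_simps Qsa)
      also have "\<dots> = (\<Sum>k<L. \<Sum>l\<le>L. of_real (g k) * A x y l k)"
      proof (rule sum.cong)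
        fix k assume "k \<in> {..<L}"
        then show "of_real (g k) * cinner (S x) (Q k y) = (\<Sum>l\<le>L. of_real (g k) * A x y l k)"
          using r2[of k x y] by (simp add: A_def sum_distrib_left)
      qed simp
      also have "\<dots> = (\<Sum>k<Suc L. \<Sum>l\<le>L. of_real (g k) * A x y l k)" by (simp add: gL)
      finally show ?thesis by (simp only: lessThan_Suc_atMost)
    qed
    have 3: "(\<Sum>k\<le>L. \<Sum>l\<le>L. of_real (g k) * A x y l k) = (\<Sum>k\<le>L. \<Sum>l\<le>L. of_real (g l) * A x y k l)"
      by (rule sum.swap)
    show ?thesis
      unfolding cinner_diff_left 1 2 3 by (simp add: sum_subtractf[symmetric] left_diff_distrib)
  qed
  have est: "cmod (cinner (S (E x) - E (S x)) y) \<le> \<delta> * s * ((norm x)\<^sup>2 + (norm y)\<^sup>2)" for x y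
  proof -
    have t: "cmod (of_real (g k - g l) * A x y k l)
       \<le> (if l = Suc k then \<delta> * s * (norm (Q k x) * norm (Q l y)) else 0)
         + (if k = Suc l then \<delta> * s * (norm (Q k x) * norm (Q l y)) else 0)" for k l
    proof -
      have A: "cmod (A x y k l) \<le> s * (norm (Q k x) * norm (Q l y))"
        unfolding A_def using cauchy_schwarz[of "S (Q k x)" "Q l y"]
          mult_right_mono[OF S(2)[of "Q k x"] norm_ge_zero[of "Q l y"]] by (simp add: mult_ac)
      consider "l = Suc k" | "k = Suc l" | "l = k" | "l \<noteq> k" "l \<noteq> Suc k" "k \<noteq> Suc l" by blast
      then show ?thesis
      proof cases
        case 1
        then have "\<bar>g k - g l\<bar> * cmod (A x y k l) \<le> \<delta> * (s * (norm (Q k x) * norm (Q l y)))"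
          by (intro mult_mono A) (use g[of k] \<delta> in auto)
        then show ?thesis using 1 by (simp add: norm_mult mult_ac del: of_real_diff)
      next
        case 2
        then have "\<bar>g k - g l\<bar> * cmod (A x y k l) \<le> \<delta> * (s * (norm (Q k x) * norm (Q l y)))"
          by (intro mult_mono A) (use g[of l] \<delta> in \<open>auto simp: abs_minus_commute\<close>)
        then show ?thesis using 2 by (simp add: norm_mult mult_ac del: of_real_diff)
      next
        case 4 then show ?thesis using band[of l k x y] by (simp add: A_def)
      qed simp
    qed
    have half: "(\<Sum>k\<le>L. \<Sum>l\<le>L. if l = Suc k then \<delta> * s * (norm (Q k x) * norm (Q l y)) else 0)
        \<le> \<delta> * s * (((norm x)\<^sup>2 + (norm y)\<^sup>2) / 2)" for x y
    proof -
      have "(\<Sum>k\<le>L. \<Sum>l\<le>L. if l = Suc k then \<delta> * s * (norm (Q k x) * norm (Q l y)) else 0)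
        = (\<Sum>k<L. \<delta> * s * (norm (Q k x) * norm (Q (Suc k) y)))"
      proof -
        have "(\<Sum>l\<le>L. if l = Suc k then \<delta> * s * (norm (Q k x) * norm (Q l y)) else 0)
            = (if Suc k \<le> L then \<delta> * s * (norm (Q k x) * norm (Q (Suc k) y)) else 0)" for k
          by (simp add: sum.delta)
        then show ?thesis by (simp only:) (rule sum.mono_neutral_cong_right, auto)
      qed
      also have "\<dots> \<le> (\<Sum>k<L. \<delta> * s * (((norm (Q k x))\<^sup>2 + (norm (Q (Suc k) y))\<^sup>2) / 2))"
      proof (intro sum_mono mult_left_mono)
        show "norm (Q k x) * norm (Q (Suc k) y) \<le> ((norm (Q k x))\<^sup>2 + (norm (Q (Suc k) y))\<^sup>2) / 2" for k
          using sum_squares_bound[of "norm (Q k x)" "norm (Q (Suc k) y)"] by simp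
      qed (use \<delta> S(3) in simp)
      also have "\<dots> = \<delta> * s * (((\<Sum>k<L. (norm (Q k x))\<^sup>2) + (\<Sum>k<L. (norm (Q (Suc k) y))\<^sup>2)) / 2)"
        by (simp add: sum_distrib_left[symmetric] sum_divide_distrib[symmetric] sum.distrib)
      also have "\<dots> \<le> \<delta> * s * (((norm x)\<^sup>2 + (norm y)\<^sup>2) / 2)"
      proof -
        have "(\<Sum>k<L. (norm (Q k x))\<^sup>2) \<le> (\<Sum>k\<le>L. (norm (Q k x))\<^sup>2)" by (rule sum_mono2) auto
        moreover have "(\<Sum>k<L. (norm (Q (Suc k) y))\<^sup>2) \<le> (\<Sum>k\<le>L. (norm (Q k y))\<^sup>2)"
          by (simp add: sum.atMost_shift)
        ultimately show ?thesis using Qb[of x] Qb[of y] \<delta> S(3)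
          by (intro mult_left_mono divide_right_mono add_mono) auto
      qed
      finally show ?thesis .
    qed
    have "cmod (cinner (S (E x) - E (S x)) y) \<le> (\<Sum>k\<le>L. \<Sum>l\<le>L. cmod (of_real (g k - g l) * A x y k l))"
      unfolding form by (intro order_trans[OF norm_sum] sum_mono order_refl)
    also have "\<dots> \<le> (\<Sum>k\<le>L. \<Sum>l\<le>L. (if l = Suc k then \<delta> * s * (norm (Q k x) * norm (Q l y)) else 0)
         + (if k = Suc l then \<delta> * s * (norm (Q k x) * norm (Q l y)) else 0))"
      by (intro sum_mono t)
    also have "\<dots> = (\<Sum>k\<le>L. \<Sum>l\<le>L. if l = Suc k then \<delta> * s * (norm (Q k x) * norm (Q l y)) else 0)
        + (\<Sum>l\<le>L. \<Sum>k\<le>L. if k = Suc l then \<delta> * s * (norm (Q l y) * norm (Q k x)) else 0)"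
    proof -
      have "(\<Sum>k\<le>L. \<Sum>l\<le>L. if k = Suc l then \<delta> * s * (norm (Q k x) * norm (Q l y)) else 0)
          = (\<Sum>l\<le>L. \<Sum>k\<le>L. if k = Suc l then \<delta> * s * (norm (Q k x) * norm (Q l y)) else 0)"
        by (rule sum.swap)
      also have "\<dots> = (\<Sum>l\<le>L. \<Sum>k\<le>L. if k = Suc l then \<delta> * s * (norm (Q l y) * norm (Q k x)) else 0)"
        by (intro sum.cong refl) (simp add: mult.commute)
      finally show ?thesis unfolding sum.distrib by simp
    qed
    also have "\<dots> \<le> \<delta> * s * (((norm x)\<^sup>2 + (norm y)\<^sup>2) / 2) + \<delta> * s * (((norm y)\<^sup>2 + (norm x)\<^sup>2) / 2)"
      by (intro add_mono half)
    also have "\<dots> = \<delta> * s * ((norm x)\<^sup>2 + (norm y)\<^sup>2)" by (simp add: field_simps)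
    finally show ?thesis .
  qed
  have "Q k 0 = 0" for k by (rule cinner_eqI) (simp add: Qsa)
  then have z: "S (E 0) - E (S 0) = 0" by (simp add: E bcl_zero[OF S(1)])
  show ?thesis
  proof (cases "S (E x) - E (S x) = 0 \<or> x = 0")
    case False
    define D where "D = S (E x) - E (S x)"
    \<comment> \<open>\<open>est\<close> is not homogeneous in its second argument. Testing with the
      multiple of \<open>D\<close> that has the norm of \<open>x\<close> makes its two squares equal
      and yields the linear bound.\<close>
    define t where "t = norm x / norm D"
    have nD: "norm D \<noteq> 0" "norm x \<noteq> 0" using False by (auto simp: D_def)
    have t0: "0 \<le> t" by (simp add: t_def)
    have "t * (norm D)\<^sup>2 = cmod (cinner D (t *\<^sub>R D))"
      using t0 by (simp add: cinner_simps cinner_self_norm norm_mult norm_power)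
    also have "\<dots> \<le> \<delta> * s * ((norm x)\<^sup>2 + (norm (t *\<^sub>R D))\<^sup>2)"
      unfolding D_def by (rule est)
    also have "norm (t *\<^sub>R D) = norm x" using nD by (simp add: t_def)
    also have "t * (norm D)\<^sup>2 = norm x * norm D" using nD by (simp add: t_def power2_eq_square)
    finally have "norm x * norm D \<le> norm x * (2 * \<delta> * s * norm x)"
      by (simp add: power2_eq_square algebra_simps)
    then have "norm D \<le> 2 * \<delta> * s * norm x" using nD by simp
    then show ?thesis by (simp add: D_def)
  qed (use \<delta> S(3) z in auto)
qed

text \<open>A bump \<open>h\<close>, whose translates by natural numbers have squares summing to 1
  on the half line, is composed with a slow logarithm \<open>\<tau>\<close>. So \<open>g n\<close>
  lives where \<open>1 + \<eta> * k\<close> is within a factor 2 of \<open>2 ^ n\<close>, and there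
  a step in \<open>k\<close> moves \<open>\<tau>\<close> by at most a multiple of
  \<open>\<eta> / 2 ^ n\<close>. Squares are normalised because the \<open>g n\<close> become
  coefficients of orthogonal vectors.\<close>

lemma slow_partition:
  fixes \<delta> :: real assumes \<delta>: "0 < \<delta>"
  obtains g :: "nat \<Rightarrow> nat \<Rightarrow> real" where
    "\<And>n k. k < n \<Longrightarrow> g n k = 0" "\<And>n. \<exists>L. \<forall>k\<ge>L. g n k = 0"
    "\<And>k. (\<Sum>n<k+2. (g n k)\<^sup>2) = 1" "\<And>n k. \<bar>g n k\<bar> \<le> 1"
    "\<And>n k. \<bar>g n k - g n (Suc k)\<bar> \<le> \<delta> / 2 ^ n"
proof -
  \<comment> \<open>\<open>h\<close> has Lipschitz constant 4, a step of \<open>\<tau>\<close> is at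
    most \<open>2 * \<eta> / (1 + \<eta> * k)\<close>, and where this is used the denominator is at
    least \<open>2 ^ n / 4\<close>; the resulting \<open>32 * \<eta> / 2 ^ n\<close> is below the
    target. The bound 1 gives \<open>\<tau> k \<le> k\<close> and steps of at most 1.\<close>
  define \<eta> where "\<eta> = min 1 (\<delta> / 64)"
  have \<eta>: "0 < \<eta>" "\<eta> \<le> 1" "64 * \<eta> \<le> \<delta>" using \<delta> by (auto simp: \<eta>_def min_def)
  define c where "c t = pi / 2 * max 0 (min 1 t)" for t :: real
  have c_lip: "\<bar>c x - c y\<bar> \<le> 2 * \<bar>x - y\<bar>" for x y
  proof -
    have "\<bar>c x - c y\<bar> = pi / 2 * \<bar>max 0 (min 1 x) - max 0 (min 1 y)\<bar>"
      by (simp add: c_def right_diff_distrib[symmetric] abs_mult del: times_divide_eq_left)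
    also have "\<dots> \<le> 2 * \<bar>x - y\<bar>"
      by (rule mult_mono) (use pi_less_4 in auto)
    finally show ?thesis .
  qed
  have sin_lip: "\<bar>sin x - sin y\<bar> \<le> \<bar>x - y\<bar>" for x y :: real
  proof -
    have "\<bar>sin x - sin y\<bar> = 2 * (\<bar>sin ((x - y) / 2)\<bar> * \<bar>cos ((x + y) / 2)\<bar>)"
      by (simp add: sin_diff_sin abs_mult)
    also have "\<dots> \<le> 2 * (\<bar>(x - y) / 2\<bar> * 1)"
      by (intro mult_left_mono mult_mono abs_sin_x_le_abs_x) auto
    finally show ?thesis by simp
  qed
  have cos_lip: "\<bar>cos x - cos y\<bar> \<le> \<bar>x - y\<bar>" for x y :: real
    using sin_lip[of "x + pi / 2" "y + pi / 2"] by (simp add: sin_add)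
  \<comment> \<open>One of the two factors is always 1: the cosine for \<open>t \<le> 0\<close>, the
    sine for \<open>t \<ge> 0\<close>. Hence the square of \<open>h\<close> is a difference of
    consecutive terms and the partition sum telescopes.\<close>
  define h where "h t = sin (c (t + 1)) * cos (c t)" for t
  have h1: "\<bar>h t\<bar> \<le> 1" for t unfolding h_def abs_mult by (rule mult_le_one) auto
  have h_lip: "\<bar>h x - h y\<bar> \<le> 4 * \<bar>x - y\<bar>" for x y
  proof -
    have "h x - h y = (sin (c (x + 1)) - sin (c (y + 1))) * cos (c x) + sin (c (y + 1)) * (cos (c x) - cos (c y))"
      by (simp add: h_def algebra_simps)
    also have "\<bar>\<dots>\<bar> \<le> \<bar>sin (c (x + 1)) - sin (c (y + 1))\<bar> * \<bar>cos (c x)\<bar> + \<bar>sin (c (y + 1))\<bar> * \<bar>cos (c x) - cos (c y)\<bar>"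
      unfolding abs_mult[symmetric] by (rule abs_triangle_ineq)
    also have "\<dots> \<le> 2 * \<bar>x - y\<bar> * 1 + 1 * (2 * \<bar>x - y\<bar>)"
      using order_trans[OF sin_lip[of "c (x+1)" "c (y+1)"] c_lip[of "x+1" "y+1"]]
        order_trans[OF cos_lip[of "c x" "c y"] c_lip[of x y]]
      by (intro add_mono mult_mono) auto
    finally show ?thesis by simp
  qed
  have h_low: "h t = 0" if "t \<le> -1" for t using that by (simp add: h_def c_def)
  have h_high: "h t = 0" if "1 \<le> t" for t using that by (simp add: h_def c_def min_def max_def)
  have h_sq: "(h t)\<^sup>2 = (sin (c (t + 1)))\<^sup>2 - (sin (c t))\<^sup>2" for t
  proof (cases "t \<le> 0")
    case False
    then have "c (t + 1) = pi / 2" by (simp add: c_def)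
    then have "sin (c (t + 1)) = 1" by (simp only: sin_pi_half)
    then show ?thesis by (simp add: h_def cos_squared_eq)
  qed (simp add: h_def c_def)
  define \<tau> where "\<tau> k = log 2 (1 + \<eta> * real k)" for k :: nat
  have pos: "0 < 1 + \<eta> * real k" for k using \<eta> by (simp add: add_pos_nonneg)
  have \<tau>0: "0 \<le> \<tau> k" for k unfolding \<tau>_def using \<eta> pos[of k] by (subst zero_le_log_cancel_iff) auto
  have \<tau>k: "\<tau> k \<le> real k" for k
  proof -
    have "1 + \<eta> * real k \<le> 1 + real k" using \<eta> mult_right_mono[of \<eta> 1 "real k"] by simp
    also have "\<dots> \<le> 2 ^ k"
      using Bernoulli_inequality[of 1 k] by simp
    finally have "1 + \<eta> * real k \<le> 2 powr (real k)" by (simp add: powr_realpow)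
    then show ?thesis unfolding \<tau>_def using pos[of k] by (simp add: log_le_iff)
  qed
  have \<tau>pow: "2 powr \<tau> k = 1 + \<eta> * real k" for k unfolding \<tau>_def using pos[of k] by simp
  have step: "\<bar>\<tau> (Suc k) - \<tau> k\<bar> \<le> 2 * \<eta> / (1 + \<eta> * real k)" "\<tau> (Suc k) \<le> \<tau> k + 1" for k
  proof -
    have q: "(1 + \<eta> * real (Suc k)) / (1 + \<eta> * real k) = 1 + \<eta> / (1 + \<eta> * real k)"
      using pos[of k] by (simp add: field_simps)
    have e0: "0 \<le> \<eta> / (1 + \<eta> * real k)" using \<eta> pos[of k] by simp
    have "\<tau> (Suc k) - \<tau> k = log 2 (1 + \<eta> / (1 + \<eta> * real k))"
      unfolding \<tau>_def q[symmetric] using pos[of k] pos[of "Suc k"] by (simp add: log_divide del: of_nat_Suc)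
    also have "\<dots> = ln (1 + \<eta> / (1 + \<eta> * real k)) / ln 2" by (simp add: log_def)
    finally have d: "\<tau> (Suc k) - \<tau> k = ln (1 + \<eta> / (1 + \<eta> * real k)) / ln 2" .
    have ln2: "1 / 2 \<le> ln (2::real)" using ln2_ge_two_thirds by simp
    have l0: "0 \<le> ln (1 + \<eta> / (1 + \<eta> * real k))" using e0 by simp
    have "ln (1 + \<eta> / (1 + \<eta> * real k)) / ln 2 \<le> ln (1 + \<eta> / (1 + \<eta> * real k)) / (1 / 2)"
      by (rule divide_left_mono) (use ln2 l0 in auto)
    also have "\<dots> \<le> 2 * (\<eta> / (1 + \<eta> * real k))" using ln_add_one_self_le_self[OF e0] by simp
    finally show "\<bar>\<tau> (Suc k) - \<tau> k\<bar> \<le> 2 * \<eta> / (1 + \<eta> * real k)" using d l0 by simp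
    have "1 + \<eta> * real (Suc k) \<le> 2 * (1 + \<eta> * real k)" 
    proof -
      have e: "1 + \<eta> * real (Suc k) = 1 + (\<eta> + \<eta> * real k)" by (simp add: algebra_simps)
      have "1 + (\<eta> + x) \<le> 2 * (1 + x)" if "0 \<le> x" for x :: real
        using add_mono[OF \<eta>(2) that] that by (simp add: algebra_simps)
      then show ?thesis unfolding e using \<eta>(1) by simp
    qed
    then have "\<tau> (Suc k) \<le> log 2 (2 * (1 + \<eta> * real k))"
      unfolding \<tau>_def by (intro log_mono pos) auto
    also have "\<dots> = \<tau> k + 1" unfolding \<tau>_def using pos[of k] by (subst log_mult) auto
    finally show "\<tau> (Suc k) \<le> \<tau> k + 1" .
  qed
  define g where "g n k = h (\<tau> k - real n)" for n k
  show ?thesis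
  proof (rule that[of g])
    fix n k :: nat
    show "g n k = 0" if "k < n" unfolding g_def by (rule h_low) (use \<tau>k[of k] that in linarith)
    show "\<exists>L. \<forall>k\<ge>L. g n k = 0"
    proof -
      obtain L :: nat where L: "2 powr (real n + 1) / \<eta> < real L" using reals_Archimedean2 by blast
      have "g n k = 0" if "L \<le> k" for k
      proof -
        have "2 powr (real n + 1) / \<eta> \<le> real k" using L that by linarith
        then have "2 powr (real n + 1) \<le> 1 + \<eta> * real k" using \<eta> by (simp add: field_simps)
        then have "real n + 1 \<le> \<tau> k" unfolding \<tau>_def using pos[of k] by (simp add: le_log_iff)
        then show ?thesis unfolding g_def by (intro h_high) simp
      qed
      then show ?thesis by blast
    qed
    show "(\<Sum>n<k+2. (g n k)\<^sup>2) = 1"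
    proof -
      define f where "f n = (sin (c (\<tau> k + 1 - real n)))\<^sup>2" for n :: nat
      have "(\<Sum>n<k+2. (g n k)\<^sup>2) = (\<Sum>n<k+2. f n - f (Suc n))"
        unfolding g_def h_sq f_def by (simp add: algebra_simps)
      also have "\<dots> = f 0 - f (k + 2)" by (rule sum_lessThan_telescope')
      also have "f 0 = 1" using \<tau>0[of k] by (simp add: f_def c_def)
      also have "f (k + 2) = 0" using \<tau>k[of k] by (simp add: f_def c_def)
      finally show ?thesis by simp
    qed
    show "\<bar>g n k\<bar> \<le> 1" unfolding g_def by (rule h1)
    show "\<bar>g n k - g n (Suc k)\<bar> \<le> \<delta> / 2 ^ n"
    \<comment> \<open>In the first case \<open>k\<close> and \<open>Suc k\<close> both lie outside
      the support, because a step raises \<open>\<tau>\<close> by at most 1. Otherwise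
      \<open>\<tau> k\<close> bounds the denominator of the step estimate from below.\<close>
    proof (cases "\<tau> k \<le> real n - 2")
      case True
      then have "\<tau> (Suc k) \<le> real n - 1" using step(2)[of k] by linarith
      then show ?thesis using True \<delta> by (simp add: g_def h_low)
    next
      case False
      have "\<bar>g n k - g n (Suc k)\<bar> \<le> 4 * \<bar>\<tau> (Suc k) - \<tau> k\<bar>"
        unfolding g_def using h_lip[of "\<tau> k - real n" "\<tau> (Suc k) - real n"] by (simp add: abs_minus_commute)
      also have "\<dots> \<le> 8 * \<eta> / (1 + \<eta> * real k)" using step(1)[of k] by simp
      also have "\<dots> \<le> 8 * \<eta> / (2 ^ n / 4)"
      proof (rule divide_left_mono)
        have "2 powr (real n - 2) \<le> 2 powr \<tau> k" using False by (intro powr_mono) auto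
        then show "2 ^ n / 4 \<le> 1 + \<eta> * real k" unfolding \<tau>pow by (simp add: powr_diff powr_realpow)
      qed (use \<eta> pos[of k] in auto)
      also have "\<dots> \<le> \<delta> / 2 ^ n" using \<eta> \<delta> by (simp add: field_simps)
      finally show ?thesis .
    qed
  qed
qed

section \<open>Gluing almost intertwiners\<close>

text \<open>A one-sided condition: block numbers grow by at most one. Imposed on an operator and on
  its adjoint it makes the matrix block tridiagonal.\<close>

definition block_banded :: "(nat \<Rightarrow> 'a::chilbert) \<Rightarrow> (nat \<Rightarrow> nat) \<Rightarrow> ('a \<Rightarrow> 'a) \<Rightarrow> bool" where
  "block_banded c blk S \<longleftrightarrow>
     (\<forall>p. S (c p) = (\<Sum>q\<in>{q. blk q \<le> Suc (blk p)}. scaleC (cinner (S (c p)) (c q)) (c q)))"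

lemma block_commutator:
  fixes S :: "'a::chilbert \<Rightarrow> 'a"
  assumes S: "bounded_clinear S" "\<And>x. norm (S x) \<le> s * norm x" "0 \<le> s"
    and c: "ortho_family c" and fin: "\<And>k. finite {p. blk p \<le> (k::nat)}"
    and b1: "block_banded c blk S" and b2: "block_banded c blk (cadjoint S)"
    and gL: "g L = 0" and g: "\<And>k. \<bar>g k - g (Suc k)\<bar> \<le> \<delta>"
    and E: "\<And>x. E x = (\<Sum>p\<in>{p. blk p < L}. scaleC (of_real (g (blk p)) * cinner x (c p)) (c p))"
  shows "norm (S (E x) - E (S x)) \<le> 2 * \<delta> * s * norm x"
proof (rule commutator_bound[where L=L and g=g])
  define P where "P A x = (\<Sum>p\<in>A. scaleC (cinner x (c p)) (c p))" for A x
  define Q where "Q k = P {p. blk p = k}" for k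
  have finlt: "finite {p. blk p < k}" for k by (rule finite_subset[OF _ fin[of k]]) auto
  have fineq: "finite {p. blk p = k}" for k by (rule finite_subset[OF _ fin[of k]]) auto
  have Psa: "cinner (P A x) y = cinner x (P A y)" for A x y
    unfolding P_def cinner_simps
    by (rule sum.cong) (simp_all add: cinner_commute[symmetric] mult.commute)
  have group: "(\<Sum>k\<le>L. \<Sum>p\<in>{p. blk p = k}. f p) = (\<Sum>p\<in>{p. blk p \<le> L}. f p)" for f :: "nat \<Rightarrow> 'b::comm_monoid_add"
  proof -
    have "(\<Sum>p\<in>{p. blk p \<le> L}. f p) = (\<Sum>k\<in>{..L}. \<Sum>p\<in>{p \<in> {p. blk p \<le> L}. blk p = k}. f p)"
      by (rule sum.group[symmetric]) (auto simp: fin)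
    also have "\<dots> = (\<Sum>k\<le>L. \<Sum>p\<in>{p. blk p = k}. f p)" by (intro sum.cong refl) auto
    finally show ?thesis by simp
  qed
  have QL: "(\<Sum>k\<le>L. Q k x) = P {p. blk p \<le> L} x" for x
    unfolding Q_def P_def by (rule group)
  have Pc: "P A (c q) = c q" if "q \<in> A" "finite A" for A q
  proof -
    have "P A (c q) = (\<Sum>p\<in>A. if p = q then c q else 0)"
      unfolding P_def by (rule sum.cong) (use ortho_familyD[OF c] ortho_family_self[OF c] in auto)
    then show ?thesis using that by simp
  qed
  have Pbcl: "bounded_clinear (P A)" for A unfolding P_def by (intro bcl_sum_fun bcl_rank_one)
  \<comment> \<open>A block below \<open>L\<close> is mapped into the blocks up to \<open>L\<close>,
    so cutting off after block \<open>L\<close> loses nothing.\<close>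
  have fixed: "P {p. blk p \<le> L} (A (Q k x)) = A (Q k x)"
    if k: "k < L" and A: "bounded_clinear A" "block_banded c blk A" for A k x
  proof -
    have "P {p. blk p \<le> L} (A (c p)) = A (c p)" if p: "blk p = k" for p
    proof -
      have e: "A (c p) = (\<Sum>q\<in>{q. blk q \<le> Suc (blk p)}. scaleC (cinner (A (c p)) (c q)) (c q))"
        using A(2) unfolding block_banded_def by blast
      show ?thesis
        by (subst (1 2) e) (use k p in \<open>simp add: bcl_simps[OF Pbcl] Pc fin\<close>)
    qed
    then show ?thesis unfolding Q_def P_def[of "{p. blk p = k}"]
      by (simp add: bcl_simps[OF A(1)] bcl_simps[OF Pbcl])
  qed
  show "cinner (Q k x) y = cinner x (Q k y)" for k x y unfolding Q_def by (rule Psa)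
  show "(\<Sum>k\<le>L. (norm (Q k x))\<^sup>2) \<le> (norm x)\<^sup>2" for x
  proof -
    have "(norm (Q k x))\<^sup>2 \<le> (\<Sum>p\<in>{p. blk p = k}. (cmod (cinner x (c p)))\<^sup>2)" for k
      unfolding Q_def P_def ortho_family_sum_norm[OF c fineq]
    proof (intro sum_mono power_mono)
      fix p show "cmod (cinner x (c p)) * norm (c p) \<le> cmod (cinner x (c p))"
        using mult_left_mono[OF ortho_family_norm[OF c, of p], of "cmod (cinner x (c p))"] by simp
    qed simp
    then have "(\<Sum>k\<le>L. (norm (Q k x))\<^sup>2) \<le> (\<Sum>k\<le>L. \<Sum>p\<in>{p. blk p = k}. (cmod (cinner x (c p)))\<^sup>2)"
      by (intro sum_mono)
    also have "\<dots> \<le> (norm x)\<^sup>2" unfolding group by (rule bessel[OF c fin])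
    finally show ?thesis .
  qed
  note b2cl = bcl_cadjoint[OF S(1)]
  fix k x y
  show "k < L \<Longrightarrow> cinner (S (Q k x)) y = (\<Sum>l\<le>L. cinner (S (Q k x)) (Q l y))"
    unfolding cinner_sum_right[symmetric] QL Psa[symmetric] using fixed[OF _ S(1) b1] by simp
  show "k < L \<Longrightarrow> cinner (S x) (Q k y) = (\<Sum>l\<le>L. cinner (S (Q l x)) (Q k y))"
  proof -
    assume k: "k < L"
    have "(\<Sum>l\<le>L. cinner (S (Q l x)) (Q k y)) = cinner (S (P {p. blk p \<le> L} x)) (Q k y)"
      unfolding cinner_sum_left[symmetric] bcl_sum[OF S(1), symmetric] QL ..
    also have "\<dots> = cinner x (P {p. blk p \<le> L} (cadjoint S (Q k y)))"
      by (simp add: cadjoint_right[OF S(1), symmetric] Psa)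
    also have "\<dots> = cinner (S x) (Q k y)"
      by (simp add: fixed[OF k b2cl b2] cadjoint_right[OF S(1)])
    finally show ?thesis by simp
  qed
  have off: "cinner (A (c p)) (c q) = 0" if "block_banded c blk A" "Suc (blk p) < blk q" for A p q
  proof -
    have "A (c p) = (\<Sum>q\<in>{q. blk q \<le> Suc (blk p)}. scaleC (cinner (A (c p)) (c q)) (c q))"
      using that(1) unfolding block_banded_def by blast
    then have "cinner (A (c p)) (c q) = cinner (\<Sum>q\<in>{q. blk q \<le> Suc (blk p)}. scaleC (cinner (A (c p)) (c q)) (c q)) (c q)"
      by simp
    also have "\<dots> = 0" using that(2) by (subst ortho_family_sum_inner[OF c fin]) simp
    finally show ?thesis .
  qed
  fix l
  assume kl: "l \<noteq> k" "l \<noteq> Suc k" "k \<noteq> Suc l"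
  \<comment> \<open>Jumps upward by more than one block are excluded by \<open>b1\<close>, jumps
    downward by \<open>b2\<close> after passing to the adjoint.\<close>
  have "cinner (S (c p)) (c q) = 0" if "blk p = k" "blk q = l" for p q
  proof (cases "Suc k < l")
    case True then show ?thesis using off[OF b1, of p q] that by simp
  next
    case False
    then have "Suc l < k" using kl by linarith
    then have "cinner (cadjoint S (c q)) (c p) = 0" using off[OF b2, of q p] that by simp
    then show ?thesis by (metis cadjoint_left[OF S(1)] cinner_commute complex_cnj_zero)
  qed
  then show "cinner (S (Q k x)) (Q l y) = 0"
    unfolding Q_def P_def by (simp add: bcl_simps[OF S(1)] cinner_simps)
next
  fix x
  have "E x = (\<Sum>k<L. \<Sum>p\<in>{p \<in> {p. blk p < L}. blk p = k}. scaleC (of_real (g (blk p)) * cinner x (c p)) (c p))"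
    unfolding E by (rule sum.group[symmetric]) (auto intro: finite_subset[OF _ fin[of L]])
  also have "\<dots> = (\<Sum>k<L. \<Sum>p\<in>{p. blk p = k}. scaleC (of_real (g k) * cinner x (c p)) (c p))"
    by (intro sum.cong) auto
  finally show "E x = (\<Sum>k<L. g k *\<^sub>R (\<Sum>p\<in>{p. blk p = k}. scaleC (cinner x (c p)) (c p)))"
    by (simp add: scaleR_scaleC scaleC_sum_right scaleC_scaleC)
qed (use S gL g in auto)

text \<open>The transfer \<open>\<phi>\<close> of \<open>c\<close> to \<open>w\<close> gives
  \<open>Y = \<phi> E\<close>. Then \<open>T Y - Y S\<close> splits into
  \<open>T Y - \<phi> S E\<close>, where each of the finitely many basis vectors costs
  \<open>d\<close>, and \<open>\<phi>\<close> applied to the commutator of \<open>S\<close> with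
  \<open>E\<close>, which is small because \<open>g\<close> varies slowly.\<close>

lemma block_piece_bound:
  fixes S T :: "'a::chilbert \<Rightarrow> 'a"
  assumes T: "bounded_clinear T"
    and S: "bounded_clinear S" "\<And>x. norm (S x) \<le> s * norm x" "0 \<le> s"
    and c: "ortho_family c" and fin: "\<And>k. finite {p. blk p \<le> (k::nat)}"
    and b1: "block_banded c blk S" and b2: "block_banded c blk (cadjoint S)"
    and gL: "g L = 0" and g: "\<And>k. \<bar>g k - g (Suc k)\<bar> \<le> \<delta>" and g1: "\<And>k. \<bar>g k\<bar> \<le> 1"
    and w: "ortho_family w" and wc: "\<And>p. blk p \<le> L \<Longrightarrow> norm (w p) = norm (c p)"
    and d: "\<And>p. blk p < L \<Longrightarrow> norm (T (w p) - (\<Sum>q\<in>{q. blk q \<le> L}. scaleC (cinner (S (c p)) (c q)) (w q))) \<le> d"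
    and Y: "\<And>x. Y x = (\<Sum>p\<in>{p. blk p < L}. scaleC (of_real (g (blk p)) * cinner x (c p)) (w p))"
  shows "norm (T (Y x) - Y (S x)) \<le> (real (card {p. blk p < L}) * d + 2 * \<delta> * s) * norm x"
proof -
  define E where "E x = (\<Sum>p\<in>{p. blk p < L}. scaleC (of_real (g (blk p)) * cinner x (c p)) (c p))" for x
  define \<phi> where "\<phi> x = (\<Sum>q\<in>{q. blk q \<le> L}. scaleC (cinner x (c q)) (w q))" for x
  have \<phi>: "bounded_clinear \<phi>" unfolding \<phi>_def by (intro bcl_sum_fun bcl_rank_one)
  have \<phi>le: "norm (\<phi> x) \<le> norm x" for x unfolding \<phi>_def by (rule ortho_family_transfer_bound[OF c w fin])
  have \<phi>c: "\<phi> (c p) = w p" if p: "blk p \<le> L" for p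
  proof -
    have "\<phi> (c p) = (\<Sum>q\<in>{q. blk q \<le> L}. if q = p then scaleC (cinner (c p) (c p)) (w p) else 0)"
      unfolding \<phi>_def by (rule sum.cong) (use ortho_familyD[OF c] in auto)
    also have "\<dots> = scaleC (cinner (c p) (c p)) (w p)" using p fin by simp
    also have "\<dots> = w p" using wc[OF p] by (rule_tac ortho_family_cases[OF c, of p]) (auto simp: scaleC_one)
    finally show ?thesis .
  qed
  have \<phi>E: "\<phi> (E x) = Y x" for x
    unfolding E_def Y bcl_sum[OF \<phi>] bcl_scaleC[OF \<phi>] by (intro sum.cong) (auto simp: \<phi>c)
  have 1: "norm (T (Y x) - \<phi> (S (E x))) \<le> real (card {p. blk p < L}) * d * norm x"
  proof -
    have "T (Y x) - \<phi> (S (E x)) = (\<Sum>p\<in>{p. blk p < L}. scaleC (of_real (g (blk p)) * cinner x (c p)) (T (w p) - \<phi> (S (c p))))"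
      unfolding Y E_def
      by (simp add: bcl_sum[OF T] bcl_sum[OF S(1)] bcl_sum[OF \<phi>] bcl_scaleC[OF T] bcl_scaleC[OF S(1)] bcl_scaleC[OF \<phi>]
          sum_subtractf scaleC_diff_right)
    also have "norm \<dots> \<le> of_nat (card {p. blk p < L}) * (norm x * d)"
    proof (rule sum_norm_bound)
      fix p assume p: "p \<in> {p. blk p < L}"
      have "cmod (cinner x (c p)) \<le> norm x"
        using cauchy_schwarz[of x "c p"] mult_left_mono[OF ortho_family_norm[OF c, of p] norm_ge_zero[of x]] by simp
      then have "\<bar>g (blk p)\<bar> * cmod (cinner x (c p)) \<le> 1 * norm x" by (intro mult_mono g1) auto
      moreover have "norm (T (w p) - \<phi> (S (c p))) \<le> d" using d p by (simp add: \<phi>_def)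
      ultimately have "\<bar>g (blk p)\<bar> * cmod (cinner x (c p)) * norm (T (w p) - \<phi> (S (c p))) \<le> norm x * d"
        by (intro mult_mono) auto
      then show "norm (scaleC (of_real (g (blk p)) * cinner x (c p)) (T (w p) - \<phi> (S (c p)))) \<le> norm x * d"
        by (simp add: norm_mult)
    qed
    finally show ?thesis by (simp add: mult_ac)
  qed
  have 2: "norm (\<phi> (S (E x) - E (S x))) \<le> 2 * \<delta> * s * norm x"
    using order_trans[OF \<phi>le block_commutator[OF S c fin b1 b2 gL g E_def]] .
  have "T (Y x) - Y (S x) = (T (Y x) - \<phi> (S (E x))) + \<phi> (S (E x) - E (S x))"
    by (simp add: bcl_diff[OF \<phi>] \<phi>E)
  then show ?thesis using norm_triangle_mono[OF 1 2] by (simp only: distrib_right)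
qed

text \<open>The isometry carrying \<open>c p\<close> to \<open>\<omega> p\<close> is glued from finite-dimensional almost
  intertwiners along a slowly varying quadratic partition of unity, which replaces the
  quasicentral approximate units of Voiculescu's theorem.\<close>

lemma intertwining_isometry:
  fixes S T :: "'a::chilbert \<Rightarrow> 'a"
  assumes U: "free_ultrafilter U" and T: "bounded_clinear T" and S: "bounded_clinear S"
    and c: "ortho_family c" and fin: "\<And>k. finite {p. blk p \<le> (k::nat)}"
    and b1: "block_banded c blk S" and b2: "block_banded c blk (cadjoint S)"
    and perp1: "\<And>x. (\<And>p. cinner x (c p) = 0) \<Longrightarrow> S x = 0"
    and perp2: "\<And>x. (\<And>p. cinner x (c p) = 0) \<Longrightarrow> cadjoint S x = 0"
    and copies: "\<And>k B d. finite B \<Longrightarrow> 0 < d \<Longrightarrow> \<exists>w. ortho_family w \<and>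
       (\<forall>p. blk p \<le> k \<longrightarrow> norm (w p) = norm (c p) \<and> (\<forall>x\<in>B. cinner (w p) x = 0)) \<and>
       (\<forall>p. blk p < k \<longrightarrow>
          norm (T (w p) - (\<Sum>q\<in>{q. blk q \<le> k}. scaleC (cinner (S (c p)) (c q)) (w q))) \<le> d \<and>
          norm (cadjoint T (w p) - (\<Sum>q\<in>{q. blk q \<le> k}. scaleC (cinner (cadjoint S (c p)) (c q)) (w q))) \<le> d)"
    and \<epsilon>: "0 < \<epsilon>"
  obtains \<omega> where "ortho_family \<omega>" "\<And>p. norm (\<omega> p) = norm (c p)"
    "small_compact \<epsilon> (\<lambda>x. T (theta U c \<omega> x) - theta U c \<omega> (S x))"
    "small_compact \<epsilon> (\<lambda>x. cadjoint T (theta U c \<omega> x) - theta U c \<omega> (cadjoint S x))"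
proof -
  obtain s where s: "0 < s" "\<And>x. norm (S x) \<le> s * norm x" by (rule bcl_bound[OF S]) blast
  \<comment> \<open>The commutator part of piece \<open>n\<close> becomes a quarter of
    \<open>\<epsilon> / 2 ^ n\<close>, and \<open>d n\<close> makes the finite part at most another
    quarter; summed over \<open>n\<close> this gives \<open>\<epsilon>\<close>.\<close>
  define \<delta> where "\<delta> = \<epsilon> / (8 * s)"
  have \<delta>: "0 < \<delta>" using \<epsilon> s by (simp add: \<delta>_def)
  obtain g :: "nat \<Rightarrow> nat \<Rightarrow> real" where g: "\<And>n k. k < n \<Longrightarrow> g n k = 0" "\<And>n. \<exists>L. \<forall>k\<ge>L. g n k = 0"
    "\<And>k. (\<Sum>n<k+2. (g n k)\<^sup>2) = 1" "\<And>n k. \<bar>g n k\<bar> \<le> 1" "\<And>n k. \<bar>g n k - g n (Suc k)\<bar> \<le> \<delta> / 2 ^ n"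
    by (rule slow_partition[OF \<delta>]) blast
  from g(2) obtain L where L: "\<And>n k. L n \<le> k \<Longrightarrow> g n k = 0" by metis
  define d where "d n = \<epsilon> / (4 * 2 ^ n * (1 + real (card {p. blk p < L n})))" for n
  have d: "0 < d n" for n using \<epsilon> by (simp add: d_def add_pos_nonneg)
  \<comment> \<open>Piece \<open>n\<close> avoids the active vectors of all earlier pieces. These
    are finitely many, and avoiding them keeps different pieces from interacting.\<close>
  define good where "good f n r \<longleftrightarrow> ortho_family r \<and>
       (\<forall>p. blk p \<le> L n \<longrightarrow> norm (r p) = norm (c p) \<and> (\<forall>x\<in>(\<Union>m<n. f m ` {q. blk q \<le> L m}). cinner (r p) x = 0)) \<and>
       (\<forall>p. blk p < L n \<longrightarrow>
          norm (T (r p) - (\<Sum>q\<in>{q. blk q \<le> L n}. scaleC (cinner (S (c p)) (c q)) (r q))) \<le> d n \<and>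
          norm (cadjoint T (r p) - (\<Sum>q\<in>{q. blk q \<le> L n}. scaleC (cinner (cadjoint S (c p)) (c q)) (r q))) \<le> d n)"
    for f :: "nat \<Rightarrow> nat \<Rightarrow> 'a" and n r
  have "\<exists>w. \<forall>n. good w n (w n)"
  proof (rule dependent_wellorder_choice)
    fix r :: "nat \<Rightarrow> 'a" and f g :: "nat \<Rightarrow> nat \<Rightarrow> 'a" and n :: nat
    assume "\<And>m. m < n \<Longrightarrow> f m = g m"
    then have "(\<Union>m<n. f m ` {q. blk q \<le> L m}) = (\<Union>m<n. g m ` {q. blk q \<le> L m})" by auto
    then show "good f n r = good g n r" by (simp add: good_def)
  next
    fix n and f :: "nat \<Rightarrow> nat \<Rightarrow> 'a"
    have "finite (\<Union>m<n. f m ` {q. blk q \<le> L m})" by (auto simp: fin)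
    from copies[OF this d, of "L n" n] show "\<exists>r. good f n r" unfolding good_def by blast
  qed
  then obtain w where w: "\<And>n. good w n (w n)" by blast
  have wo: "ortho_family (w n)" for n using w[of n] by (simp add: good_def)
  have wc: "norm (w n p) = norm (c p)" if "blk p \<le> L n" for n p using w[of n] that by (simp add: good_def)
  have wlt: "cinner (w n p) (w m q) = 0" if "m < n" "blk p \<le> L n" "blk q \<le> L m" for m n p q
    using w[of n] that unfolding good_def by blast
  have wperp: "cinner (w n p) (w m q) = 0" if "m \<noteq> n" "blk p \<le> L n" "blk q \<le> L m" for m n p q
    using that wlt by (metis cinner_commute complex_cnj_zero nat_neq_iff)
  have w1: "norm (T (w n p) - (\<Sum>q\<in>{q. blk q \<le> L n}. scaleC (cinner (S (c p)) (c q)) (w n q))) \<le> d n"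
    and w2: "norm (cadjoint T (w n p) - (\<Sum>q\<in>{q. blk q \<le> L n}. scaleC (cinner (cadjoint S (c p)) (c q)) (w n q))) \<le> d n"
    if "blk p < L n" for n p using w[of n] that by (simp_all add: good_def)
  have gz: "g n (blk p) = 0" if "\<not> blk p < L n" for n p using L that by simp
  \<comment> \<open>The range of summation suffices because \<open>g n k = 0\<close> for
    \<open>k < n\<close>. For fixed \<open>p\<close> the active \<open>w n p\<close> are mutually
    orthogonal, so the squared weights, which add up to 1, give \<open>\<omega> p\<close> the norm
    of \<open>c p\<close>.\<close>
  define \<omega> where "\<omega> p = (\<Sum>n<blk p + 2. g n (blk p) *\<^sub>R w n p)" for p
  have \<omega>N: "\<omega> p = (\<Sum>n<N. g n (blk p) *\<^sub>R w n p)" if "blk p + 2 \<le> N" for p N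
    unfolding \<omega>_def by (rule sum.mono_neutral_left) (use that g(1) in auto)
  have \<omega>inner: "cinner (\<omega> p) (\<omega> q) = (\<Sum>n<N. of_real (g n (blk p) * g n (blk q)) * cinner (w n p) (w n q))"
    if N: "blk p + 2 \<le> N" "blk q + 2 \<le> N" for p q N
  proof -
    have "cinner (\<omega> p) (\<omega> q) = (\<Sum>n<N. \<Sum>m<N. of_real (g n (blk p) * g m (blk q)) * cinner (w n p) (w m q))"
      unfolding \<omega>N[OF N(1)] \<omega>N[OF N(2)] cinner_sum_left cinner_sum_right cinner_scaleR_left cinner_scaleR_right
      by (subst sum.swap) (simp add: sum_distrib_left mult_ac)
    also have "\<dots> = (\<Sum>n<N. \<Sum>m<N. if m = n then of_real (g n (blk p) * g n (blk q)) * cinner (w n p) (w n q) else 0)"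
    proof (intro sum.cong refl)
      fix n m
      show "of_real (g n (blk p) * g m (blk q)) * cinner (w n p) (w m q) =
          (if m = n then of_real (g n (blk p) * g n (blk q)) * cinner (w n p) (w n q) else 0)"
      proof (cases "m = n \<or> g n (blk p) = 0 \<or> g m (blk q) = 0")
        case False
        then have "blk p < L n" "blk q < L m" using gz by blast+
        then show ?thesis using wperp[of m n p q] False by simp
      qed auto
    qed
    finally show ?thesis by simp
  qed
  have \<omega>self: "cinner (\<omega> p) (\<omega> p) = cinner (c p) (c p)" for p
  proof -
    have "cinner (\<omega> p) (\<omega> p) = (\<Sum>n<blk p + 2. of_real ((g n (blk p))\<^sup>2) * cinner (c p) (c p))"
      unfolding \<omega>inner[OF order_refl order_refl]
    proof (rule sum.cong)
      fix n
      show "of_real (g n (blk p) * g n (blk p)) * cinner (w n p) (w n p) = of_real ((g n (blk p))\<^sup>2) * cinner (c p) (c p)"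
        by (cases "blk p < L n") (simp_all add: wc cinner_self_norm gz power2_eq_square)
    qed simp
    also have "\<dots> = of_real (\<Sum>n<blk p + 2. (g n (blk p))\<^sup>2) * cinner (c p) (c p)"
      by (simp only: of_real_sum sum_distrib_right)
    finally show ?thesis unfolding g(3) by simp
  qed
  have \<omega>c: "norm (\<omega> p) = norm (c p)" for p by (rule norm_eqI_cinner[OF \<omega>self])
  have \<omega>: "ortho_family \<omega>"
    unfolding ortho_family_def
  proof (intro conjI allI impI)
    fix p q :: nat assume "p \<noteq> q"
    then show "cinner (\<omega> p) (\<omega> q) = 0"
      using \<omega>inner[of p "max (blk p) (blk q) + 2" q] ortho_familyD[OF wo] by simp
  next
    fix p show "norm (\<omega> p) = 0 \<or> norm (\<omega> p) = 1" using c unfolding \<omega>c by (simp add: ortho_family_def)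
  qed
  define V where "V = theta U c \<omega>"
  have V: "bounded_clinear V" unfolding V_def by (rule bcl_theta[OF U c \<omega>])
  have Vc: "V (c p) = \<omega> p" for p
    unfolding V_def by (rule theta_basis[OF U c \<omega>]) (metis \<omega>c norm_eq_zero)
  have Vperp: "V x = 0" if "\<And>p. cinner x (c p) = 0" for x
    unfolding V_def by (rule theta_perp[OF U c \<omega> that])
  define Y where "Y n x = (\<Sum>p\<in>{p. blk p < L n}. scaleC (of_real (g n (blk p)) * cinner x (c p)) (w n p))" for n x
  have finlt: "finite {p. blk p < k}" for k by (rule finite_subset[OF _ fin[of k]]) auto
  have Yfr: "finite_rank (Y n)" for n
  proof -
    have "Y n = (\<lambda>x. \<Sum>p\<in>{p. blk p < L n}. scaleC (cinner x (c p)) (scaleC (of_real (g n (blk p))) (w n p)))"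
      by (auto simp: Y_def scaleC_scaleC mult.commute)
    then show ?thesis using finite_rank_sum[OF finlt] by simp
  qed
  note Yb = finite_rank_bcl[OF Yfr]
  have Yc: "Y n (c p) = g n (blk p) *\<^sub>R w n p" for n p
  proof -
    have "Y n (c p) = (\<Sum>q\<in>{p. blk p < L n}. if q = p then scaleC (of_real (g n (blk p)) * cinner (c p) (c p)) (w n p) else 0)"
      unfolding Y_def by (rule sum.cong) (use ortho_familyD[OF c] in auto)
    also have "\<dots> = (if blk p < L n then scaleC (of_real (g n (blk p)) * cinner (c p) (c p)) (w n p) else 0)"
      using finlt by simp
    also have "\<dots> = g n (blk p) *\<^sub>R w n p"
      using wc[of p n] by (rule_tac ortho_family_cases[OF c, of p]) (auto simp: scaleR_scaleC gz)
    finally show ?thesis .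
  qed
  have Yperp: "Y n x = 0" if "\<And>p. cinner x (c p) = 0" for n x unfolding Y_def by (simp add: that)
  \<comment> \<open>Stated for a general pair because it serves both \<open>T\<close>,
    \<open>S\<close> and their adjoints, with the same \<open>V\<close> and the same pieces
    \<open>Y n\<close>.\<close>
  have main: "small_compact \<epsilon> (\<lambda>x. T' (V x) - V (S' x))"
    if T': "bounded_clinear T'" and S': "bounded_clinear S'" "\<And>x. norm (S' x) \<le> s * norm x"
      and bb: "block_banded c blk S'" "block_banded c blk (cadjoint S')"
      and perp: "\<And>x. (\<And>p. cinner x (c p) = 0) \<Longrightarrow> S' x = 0"
      and w': "\<And>n p. blk p < L n \<Longrightarrow> norm (T' (w n p) - (\<Sum>q\<in>{q. blk q \<le> L n}. scaleC (cinner (S' (c p)) (c q)) (w n q))) \<le> d n"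
    for T' S'
  proof -
    define B where "B n x = T' (Y n x) - Y n (S' x)" for n x
    have Bs: "small_compact (\<epsilon> / 2 * (1/2) ^ n) (B n)" for n
    proof (rule small_compact_finite_rank)
      show "finite_rank (B n)" unfolding B_def
        by (intro finite_rank_minus finite_rank_left[OF T'] finite_rank_right[OF S'(1)] Yfr)
      show "0 \<le> \<epsilon> / 2 * (1/2) ^ n" using \<epsilon> by simp
      fix x
      have "norm (B n x) \<le> (real (card {p. blk p < L n}) * d n + 2 * (\<delta> / 2 ^ n) * s) * norm x"
        unfolding B_def
        by (rule block_piece_bound[OF T' S' less_imp_le[OF s(1)] c fin bb _ g(5) g(4) wo wc w' Y_def]) (rule L, simp)
      also have "\<dots> \<le> (\<epsilon> / 2 * (1/2) ^ n) * norm x"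
      proof (rule mult_right_mono)
        have "real (card {p. blk p < L n}) * d n \<le> (1 + real (card {p. blk p < L n})) * d n"
          using d[of n] by (intro mult_right_mono) auto
        also have "\<dots> = \<epsilon> / 4 * (1/2) ^ n"
        proof -
          have "a * (\<epsilon> / (4 * 2 ^ n * a)) = \<epsilon> / 4 * (1/2) ^ n" if "a \<noteq> 0" for a :: real
            using that by (simp add: power_divide field_simps)
          from this[of "1 + real (card {p. blk p < L n})"] show ?thesis unfolding d_def by linarith
        qed
        finally have "real (card {p. blk p < L n}) * d n \<le> \<epsilon> / 4 * (1/2) ^ n" .
        moreover have "2 * (\<delta> / 2 ^ n) * s = \<epsilon> / 4 * (1/2) ^ n"
          using s by (simp add: \<delta>_def power_divide field_simps)
        ultimately show "real (card {p. blk p < L n}) * d n + 2 * (\<delta> / 2 ^ n) * s \<le> \<epsilon> / 2 * (1/2) ^ n" by simp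
      qed simp
      finally show "norm (B n x) \<le> \<epsilon> / 2 * (1/2) ^ n * norm x" .
    qed
    have geo: "(\<lambda>n. \<epsilon> / 2 * (1/2) ^ n) sums \<epsilon>"
      using sums_mult[OF geometric_sums[of "1/2 :: real"], of "\<epsilon> / 2"] by simp
    have sc: "small_compact \<epsilon> (\<lambda>x. \<Sum>n. B n x)"
      using small_compact_suminf(1)[OF Bs sums_summable[OF geo]] sums_unique[OF geo] by simp
    have "(\<Sum>n. B n x) = T' (V x) - V (S' x)" for x
    proof (rule eq_on_basis[where u=c and A="\<lambda>x. \<Sum>n. B n x" and B="\<lambda>x. T' (V x) - V (S' x)"])
      show "bounded_clinear (\<lambda>x. \<Sum>n. B n x)" by (rule small_compactD(2)[OF sc])
      show "bounded_clinear (\<lambda>x. T' (V x) - V (S' x))"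
        by (rule bcl_minus_fun[OF bcl_compose[OF T' V] bcl_compose[OF V S'(1)]])
      fix p
      \<comment> \<open>\<open>S' (c p)\<close> reaches block \<open>Suc (blk p)\<close>, and
        \<open>\<omega>N\<close> needs two more than the block number: hence 3.\<close>
      define N where "N = blk p + 3"
      define a where "a q = cinner (S' (c p)) (c q)" for q
      have Sc: "S' (c p) = (\<Sum>q\<in>{q. blk q \<le> Suc (blk p)}. scaleC (a q) (c q))"
        using bb(1) unfolding block_banded_def a_def by blast
      have B0: "B n (c p) = 0" if "n \<notin> {..<N}" for n
      proof -
        have "Y n (c q) = 0" if "blk q \<le> Suc (blk p)" for q
          unfolding Yc using g(1)[of "blk q" n] that \<open>n \<notin> {..<N}\<close> by (simp add: N_def)
        then show ?thesis unfolding B_def Sc by (simp add: bcl_simps[OF Yb] bcl_zero[OF T'])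
      qed
      have "(\<Sum>n. B n (c p)) = (\<Sum>n<N. B n (c p))" by (rule suminf_finite[OF finite_lessThan B0])
      also have "\<dots> = T' (\<Sum>n<N. Y n (c p)) - (\<Sum>n<N. Y n (S' (c p)))"
        unfolding B_def by (simp add: sum_subtractf bcl_sum[OF T'])
      also have "(\<Sum>n<N. Y n (c p)) = V (c p)" unfolding Yc Vc by (rule \<omega>N[symmetric]) (simp add: N_def)
      also have "(\<Sum>n<N. Y n (S' (c p))) = V (S' (c p))"
      proof -
        have "(\<Sum>n<N. Y n (S' (c p))) = (\<Sum>q\<in>{q. blk q \<le> Suc (blk p)}. scaleC (a q) (\<Sum>n<N. Y n (c q)))"
          unfolding Sc bcl_sum[OF Yb] bcl_scaleC[OF Yb] by (subst sum.swap) (simp add: scaleC_sum_right)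
        also have "\<dots> = (\<Sum>q\<in>{q. blk q \<le> Suc (blk p)}. scaleC (a q) (V (c q)))"
        proof (rule sum.cong)
          fix q assume "q \<in> {q. blk q \<le> Suc (blk p)}"
          then have "blk q + 2 \<le> N" by (simp add: N_def)
          then show "scaleC (a q) (\<Sum>n<N. Y n (c q)) = scaleC (a q) (V (c q))" unfolding Yc Vc by (simp add: \<omega>N)
        qed simp
        also have "\<dots> = V (S' (c p))" unfolding Sc bcl_sum[OF V] bcl_scaleC[OF V] ..
        finally show ?thesis .
      qed
      finally show "(\<Sum>n. B n (c p)) = T' (V (c p)) - V (S' (c p))" .
    next
      fix x assume x: "\<And>p. cinner x (c p) = 0"
      show "(\<Sum>n. B n x) = T' (V x) - V (S' x)"
        by (simp add: B_def Yperp[OF x] perp[OF x] Vperp[OF x] bcl_zero[OF T'] bcl_zero[OF V] bcl_zero[OF Yb])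
    qed
    then show ?thesis using sc by simp
  qed
  have r1: "small_compact \<epsilon> (\<lambda>x. T (V x) - V (S x))"
    by (rule main[OF T S s(2) b1 b2 perp1 w1])
  have r2: "small_compact \<epsilon> (\<lambda>x. cadjoint T (V x) - V (cadjoint S x))"
  proof (rule main[OF bcl_cadjoint[OF T] bcl_cadjoint[OF S] _ b2 _ perp2 w2])
    show "norm (cadjoint S x) \<le> s * norm x" for x
      by (rule cadjoint_norm_bound[OF S s(2) less_imp_le[OF s(1)]])
    show "block_banded c blk (cadjoint (cadjoint S))" unfolding cadjoint_cadjoint[OF S] by (rule b1)
  qed
  show ?thesis by (rule that[OF \<omega> \<omega>c r1[unfolded V_def] r2[unfolded V_def]])
qed

section \<open>Absorption\<close>

text \<open>The coefficients of a combination are read off from the vector itself and reused for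
  \<open>w\<close>. Where \<open>c q\<close> is zero the coefficient is lost, so \<open>w q\<close>
  has to vanish too.\<close>

lemma ortho_transfer_sum:
  fixes c w :: "'i \<Rightarrow> 'a::chilbert"
  assumes c: "ortho_family c" and F: "finite F" and e: "\<And>l. l \<in> I \<Longrightarrow> e l \<in> F"
    and cw: "\<And>q. q \<in> F \<Longrightarrow> c q = 0 \<Longrightarrow> w q = 0"
  shows "(\<Sum>q\<in>F. scaleC (cinner (\<Sum>l\<in>I. scaleC (a l) (c (e l))) (c q)) (w q)) = (\<Sum>l\<in>I. scaleC (a l) (w (e l)))"
proof -
  define \<Psi> where "\<Psi> x = (\<Sum>q\<in>F. scaleC (cinner x (c q)) (w q))" for x
  have \<Psi>: "bounded_clinear \<Psi>" unfolding \<Psi>_def by (intro bcl_sum_fun bcl_rank_one)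
  have \<Psi>c: "\<Psi> (c p) = w p" if p: "p \<in> F" for p
  proof -
    have "\<Psi> (c p) = (\<Sum>q\<in>F. if q = p then scaleC (cinner (c p) (c p)) (w p) else 0)"
      unfolding \<Psi>_def by (rule sum.cong) (use ortho_familyD[OF c] in auto)
    also have "\<dots> = scaleC (cinner (c p) (c p)) (w p)" using p F by simp
    also have "\<dots> = w p" using cw[OF p] by (rule_tac ortho_family_cases[OF c, of p]) (auto simp: scaleC_one)
    finally show ?thesis .
  qed
  have "\<Psi> (\<Sum>l\<in>I. scaleC (a l) (c (e l))) = (\<Sum>l\<in>I. scaleC (a l) (w (e l)))"
    unfolding bcl_sum[OF \<Psi>] bcl_scaleC[OF \<Psi>] by (rule sum.cong) (auto simp: \<Psi>c e)
  then show ?thesis by (simp add: \<Psi>_def)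
qed

text \<open>The range \<open>K\<close> of \<open>P\<close> carries \<open>R\<close> and contains the copy \<open>J H\<close> of \<open>H\<close>, on which \<open>R\<close> acts as \<open>T\<close>;
  \<open>\<Phi>\<close> represents the inclusion of \<open>K\<close> into the ultrapower, which restricts to the diagonal
  embedding on \<open>J H\<close>. \<open>Q\<close> below is the projection onto the complement of \<open>J H\<close> in \<open>K\<close>.\<close>

locale absorption =
  fixes U :: "nat filter" and T R P J :: "'a::chilbert \<Rightarrow> 'a" and \<Phi> :: "nat \<Rightarrow> 'a \<Rightarrow> 'a"
    and d b :: "nat \<Rightarrow> 'a"
  assumes U: "free_ultrafilter U"
    and T: "bounded_clinear T" and R: "bounded_clinear R" and P: "bounded_clinear P" and J: "bounded_clinear J"
    and J_iso: "\<And>x y. cinner (J x) (J y) = cinner x y"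
    and P_sa: "\<And>x y. cinner (P x) y = cinner x (P y)" and PP: "\<And>x. P (P x) = P x"
    and PJ: "\<And>x. P (J x) = J x" and PR: "\<And>x. P (R x) = R x" and RP: "\<And>x. R (P x) = R x"
    and RJ: "\<And>x. R (J x) = J (T x)" and RsJ: "\<And>x. cadjoint R (J x) = J (cadjoint T x)"
    and \<Phi>: "\<And>n. bounded_clinear (\<Phi> n)" and \<Phi>_le: "\<And>n x. norm (\<Phi> n x) \<le> norm x"
    and \<Phi>_gram: "\<And>x y. ((\<lambda>n. cinner (\<Phi> n x) (\<Phi> n y)) \<longlongrightarrow> cinner (P x) y) U"
    and \<Phi>_R: "\<And>x. ((\<lambda>n. T (\<Phi> n x) - \<Phi> n (R x)) \<longlongrightarrow> 0) U"
    and \<Phi>_Rs: "\<And>x. ((\<lambda>n. cadjoint T (\<Phi> n x) - \<Phi> n (cadjoint R x)) \<longlongrightarrow> 0) U"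
    and \<Phi>_J: "\<And>x. ((\<lambda>n. \<Phi> n (J x) - x) \<longlongrightarrow> 0) U"
    and dense: "closure (range d) = UNIV"
    and b: "ortho_family b" and norm_b: "\<And>i. norm (b i) = 1"
begin

section \<open>Reduction of \<open>R\<close> by the copy of H and its complement\<close>

abbreviation "Rs \<equiv> cadjoint R"
abbreviation "Js \<equiv> cadjoint J"

lemma nonbot: "U \<noteq> bot" using U by (simp add: free_ultrafilter_def)

lemma Rs: "bounded_clinear Rs" by (rule bcl_cadjoint[OF R])
lemma Js: "bounded_clinear Js" by (rule bcl_cadjoint[OF J])

lemma JsJ: "Js (J x) = x"
  by (rule cinner_eqI) (simp add: cadjoint_left[OF J] J_iso)

lemma norm_J: "norm (J x) = norm x" by (rule norm_eqI_cinner[OF J_iso])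

lemma norm_Js: "norm (Js x) \<le> norm x"
  using cadjoint_norm_bound[OF J, of 1 x] by (simp add: norm_J)

lemma PRs: "P (Rs x) = Rs x"
  by (rule cinner_eqI) (simp add: P_sa cadjoint_left[OF R] RP)

lemma RsP: "Rs (P x) = Rs x"
  by (rule cinner_eqI) (simp add: P_sa cadjoint_left[OF R] PR)

lemma JsR: "Js (R x) = T (Js x)"
proof (rule cinner_eqI)
  fix h
  have "cinner (Js (R x)) h = cinner x (Rs (J h))"
    by (simp add: cadjoint_left[OF J] cadjoint_right[OF R])
  also have "\<dots> = cinner (T (Js x)) h"
    by (simp add: RsJ cadjoint_left[OF J, symmetric] cadjoint_right[OF T])
  finally show "cinner (Js (R x)) h = cinner (T (Js x)) h" .
qed

lemma JsRs: "Js (Rs x) = cadjoint T (Js x)"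
  by (rule cinner_eqI) (simp add: cadjoint_left[OF J] cadjoint_left[OF R] cadjoint_left[OF T] RJ)

definition "Q x = P x - J (Js x)"

lemma Q: "bounded_clinear Q"
  unfolding Q_def by (rule bcl_minus_fun[OF P bcl_compose[OF J Js]])

lemma Q_sa: "cinner (Q x) y = cinner x (Q y)"
  by (simp add: Q_def cinner_simps P_sa cadjoint_left[OF J] cadjoint_right[OF J, symmetric])

lemma JsP: "Js (P x) = Js x"
  by (rule cinner_eqI) (simp add: cadjoint_left[OF J] P_sa PJ)

lemma QQ: "Q (Q x) = Q x"
  by (simp add: Q_def bcl_simps[OF P] bcl_simps[OF J] bcl_simps[OF Js] PP PJ JsP JsJ)

lemma PQ: "P (Q x) = Q x" by (simp add: Q_def bcl_simps[OF P] PP PJ)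

lemma QJ: "Q (J x) = 0" by (simp add: Q_def PJ JsJ)

lemma QR: "Q (R x) = R (Q x)"
  by (simp add: Q_def PR RP bcl_simps[OF R] RJ JsR)

lemma QRs: "Q (Rs x) = Rs (Q x)"
  by (simp add: Q_def PRs RsP bcl_simps[OF Rs] RsJ JsRs)

text \<open>Base 3 digits code words in \<open>R\<close> and its adjoint, applied to the vectors
  \<open>Q (d n)\<close>. The sequence is closed under both operators, and an image of word
  \<open>m\<close> has index at most \<open>3 * m + 2\<close>, which later limits the growth of
  blocks.\<close>

function words :: "nat \<Rightarrow> 'a" where
  "words n = (if n mod 3 = 0 then Q (d (n div 3))
     else if n mod 3 = 1 then R (words (n div 3)) else Rs (words (n div 3)))"
  by pat_completeness auto
termination by (relation "Wellfounded.measure id") (auto simp: div_less_dividend intro!: div_less_dividend gr0I)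

declare words.simps [simp del]

lemma words_R: "words (3 * n + 1) = R (words n)"
proof -
  have "(3 * n + 1) div 3 = n" "(3 * n + 1) mod 3 = 1" by presburger+
  then show ?thesis by (subst words.simps) simp
qed
lemma words_Rs: "words (3 * n + 2) = Rs (words n)"
proof -
  have "(3 * n + 2) div 3 = n" "(3 * n + 2) mod 3 = 2" by presburger+
  then show ?thesis by (subst words.simps) simp
qed
lemma words_d: "words (3 * n) = Q (d n)" by (subst words.simps) simp

lemma Q_words: "Q (words n) = words n"
proof (induction n rule: less_induct)
  case (less n)
  show ?case
  proof (cases "n mod 3 = 0")
    case True then show ?thesis by (subst (1 2) words.simps) (simp add: QQ)
  next
    case False
    then have "n div 3 < n" by (intro div_less_dividend) (auto intro: gr0I)
    then show ?thesis using False less by (subst (1 2) words.simps) (simp add: QR QRs)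
  qed
qed

definition "u = gs words"

lemma u: "ortho_family u" unfolding u_def by (rule ortho_family_gs)

lemma Q_u: "Q (u j) = u j"
proof (induction j rule: less_induct)
  case (less j)
  then have "Q (gs_residual words j) = gs_residual words j"
    unfolding gs_residual_def u_def by (simp add: bcl_simps[OF Q] Q_words)
  then show ?case unfolding u_def
    by (subst (1 2) gs_eq) (simp add: scaleR_scaleC bcl_simps[OF Q])
qed

lemma u_perp_J: "cinner (u j) (J h) = 0"
  using Q_sa[of "u j" "J h"] by (simp add: Q_u QJ)

section \<open>Growth of \<open>R\<close> and its adjoint along the Gram-Schmidt family\<close>

definition "pr n x = (\<Sum>l<n. scaleC (cinner x (u l)) (u l))"

lemma pr: "bounded_clinear (pr n)" unfolding pr_def by (intro bcl_sum_fun bcl_rank_one)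

lemma pr_u: "l < n \<Longrightarrow> pr n (u l) = u l"
proof -
  assume "l < n"
  have "pr n (u l) = (\<Sum>j<n. if j = l then u l else 0)"
    unfolding pr_def by (rule sum.cong) (use ortho_familyD[OF u] ortho_family_self[OF u] in auto)
  then show ?thesis using \<open>l < n\<close> by simp
qed

lemma pr_mono: "pr m x = x \<Longrightarrow> m \<le> n \<Longrightarrow> pr n x = x"
proof -
  assume x: "pr m x = x" and mn: "m \<le> n"
  have "pr n (pr m x) = pr m x"
    unfolding pr_def[of m] bcl_sum[OF pr] bcl_scaleC[OF pr] by (rule sum.cong) (use mn pr_u in auto)
  then show ?thesis by (simp add: x)
qed

lemma pr_words: "m < n \<Longrightarrow> pr n (words m) = words m"
  by (rule pr_mono[of "Suc m"]) (auto simp only: pr_def u_def Suc_le_eq intro: gs_expand[symmetric])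

text \<open>\<open>u j\<close> is a combination of the words up to \<open>j\<close>, whose images
  are words up to \<open>3 * j + 2\<close>. The induction follows the residuals of
  Gram-Schmidt.\<close>

lemma pr_image_u:
  assumes A: "bounded_clinear A" and w: "\<And>m. \<exists>k\<le>3 * m + 2. A (words m) = words k"
  shows "pr (3 * j + 3) (A (u j)) = A (u j)"
proof (induction j rule: less_induct)
  case (less j)
  have "pr (3 * j + 3) (A (words j)) = A (words j)" using w[of j] pr_words by fastforce
  moreover have "pr (3 * j + 3) (A (u l)) = A (u l)" if "l < j" for l
    by (rule pr_mono[OF less[OF that]]) (use that in simp)
  ultimately have "pr (3 * j + 3) (A (gs_residual words j)) = A (gs_residual words j)"
    unfolding gs_residual_def by (simp add: bcl_simps[OF A] bcl_simps[OF pr] u_def)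
  then show ?case unfolding u_def
    by (subst (1 2) gs_eq) (simp add: scaleR_scaleC bcl_simps[OF A] bcl_simps[OF pr])
qed

lemma pr_R: "pr (3 * j + 3) (R (u j)) = R (u j)"
proof (rule pr_image_u[OF R])
  show "\<exists>k\<le>3 * m + 2. R (words m) = words k" for m
    by (rule exI[of _ "3 * m + 1"]) (simp only: words_R, simp)
qed

lemma pr_Rs: "pr (3 * j + 3) (Rs (u j)) = Rs (u j)"
proof (rule pr_image_u[OF Rs])
  show "\<exists>k\<le>3 * m + 2. Rs (words m) = words k" for m
    by (rule exI[of _ "3 * m + 2"]) (simp only: words_Rs, simp)
qed

text \<open>\<open>j < 3 ^ k\<close> implies \<open>3 * j + 3 \<le> 3 ^ Suc k\<close>: measured in
  powers of 3, an application costs one step, whatever \<open>j\<close> is.\<close>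

lemma pr_pow:
  assumes "pr (3 * j + 3) (A (u j)) = A (u j)" "j < 3 ^ k"
  shows "A (u j) = (\<Sum>l<3 ^ Suc k. scaleC (cinner (A (u j)) (u l)) (u l))"
proof -
  have "pr (3 ^ Suc k) (A (u j)) = A (u j)"
    by (rule pr_mono[OF assms(1)]) (use assms(2) in simp)
  then show ?thesis by (simp add: pr_def)
qed

text \<open>The words of index \<open>3 * n\<close> are the \<open>Q (d n)\<close>, which are dense
  in the range of \<open>Q\<close>; so \<open>u\<close> spans exactly that range.\<close>

lemma theta_u: "theta U u u x = Q x"
proof -
  note th = bcl_theta[OF U u u]
  have "Q y = theta U u u (Q y)" for y
  proof -
    have "closure (range d) \<subseteq> {y. Q y - theta U u u (Q y) = 0}"
    proof (rule closure_minimal)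
      show "range d \<subseteq> {y. Q y - theta U u u (Q y) = 0}"
      proof safe
        fix n
        have e: "Q (d n) = (\<Sum>j<Suc (3 * n). scaleC (cinner (Q (d n)) (u j)) (u j))"
          using gs_expand[of words "3 * n"] unfolding words_d u_def .
        have "theta U u u (Q (d n)) = (\<Sum>j<Suc (3 * n). scaleC (cinner (Q (d n)) (u j)) (u j))"
          by (subst e) (simp only: bcl_sum[OF th] bcl_scaleC[OF th] theta_basis[OF U u u])
        then show "Q (d n) - theta U u u (Q (d n)) = 0" using e by simp
      qed
      have "bounded_linear (\<lambda>y. Q y - theta U u u (Q y))"
        by (rule bcl_bounded_linear[OF bcl_minus_fun[OF Q bcl_compose[OF th Q]]])
      then have "continuous_on UNIV (\<lambda>y. Q y - theta U u u (Q y))" by (rule linear_continuous_on)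
      then show "closed {y. Q y - theta U u u (Q y) = 0}"
        by (intro closed_Collect_eq continuous_on_const)
    qed
    then show ?thesis using dense by auto
  qed
  moreover have "theta U u u (x - Q x) = 0"
    by (rule theta_perp[OF U u u]) (simp add: cinner_simps Q_sa Q_u)
  ultimately show ?thesis by (simp add: bcl_diff[OF th])
qed

text \<open>\<open>u j\<close> is orthogonal to \<open>J h\<close>, and \<open>J h\<close> is
  represented by the constant sequence \<open>h\<close>. This is what lets copies of the
  \<open>u j\<close> be placed off any finite set.\<close>

lemma weakly_null: "((\<lambda>n. cinner (\<Phi> n (u j)) h) \<longlongrightarrow> 0) U"
proof -
  have "((\<lambda>n. cinner (\<Phi> n (u j)) (\<Phi> n (J h) - h)) \<longlongrightarrow> 0) U"
  proof (rule tendsto_0_le[OF \<Phi>_J[of h], where K=1], rule always_eventually, rule allI)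
    fix n
    have "norm (\<Phi> n (u j)) \<le> 1" using order_trans[OF \<Phi>_le ortho_family_norm[OF u]] .
    then show "norm (cinner (\<Phi> n (u j)) (\<Phi> n (J h) - h)) \<le> norm (\<Phi> n (J h) - h) * 1"
      using order_trans[OF cauchy_schwarz mult_right_mono[of _ 1]] by simp
  qed
  moreover have "((\<lambda>n. cinner (\<Phi> n (u j)) (\<Phi> n (J h))) \<longlongrightarrow> 0) U"
    using \<Phi>_gram[of "u j" "J h"] by (simp add: P_sa PJ u_perp_J)
  ultimately have "((\<lambda>n. cinner (\<Phi> n (u j)) (\<Phi> n (J h)) - cinner (\<Phi> n (u j)) (\<Phi> n (J h) - h)) \<longlongrightarrow> 0 - 0) U"
    by (intro tendsto_diff)
  then show ?thesis by (simp add: cinner_simps)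
qed

lemma P_u: "P (u j) = u j" using PQ[of "u j"] by (simp add: Q_u)

lemma copy_bound_tendsto:
  assumes A: "bounded_clinear A" and AT: "((\<lambda>n. A (\<Phi> n x) - \<Phi> n y) \<longlongrightarrow> 0) U"
    and wx: "((\<lambda>n. wx n - \<Phi> n x) \<longlongrightarrow> 0) U"
    and y: "y = (\<Sum>l<N. scaleC (a l) (u l))"
    and w: "\<And>l. ((\<lambda>n. w n l - \<Phi> n (u l)) \<longlongrightarrow> 0) U"
  shows "((\<lambda>n. A (wx n) - (\<Sum>l<N. scaleC (a l) (w n l))) \<longlongrightarrow> 0) U"
proof -
  have "((\<lambda>n. \<Sum>l<N. scaleC (a l) (w n l - \<Phi> n (u l))) \<longlongrightarrow> (\<Sum>l<N. 0)) U"
  proof (rule tendsto_sum)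
    fix l
    show "((\<lambda>n. scaleC (a l) (w n l - \<Phi> n (u l))) \<longlongrightarrow> 0) U"
      by (rule tendsto_0_le[OF w[of l], where K="cmod (a l)"]) (simp add: mult.commute)
  qed
  then have "((\<lambda>n. A (wx n - \<Phi> n x) + (A (\<Phi> n x) - \<Phi> n y) - (\<Sum>l<N. scaleC (a l) (w n l - \<Phi> n (u l)))) \<longlongrightarrow> A 0 + 0 - (\<Sum>l<N. 0)) U"
    by (intro tendsto_diff tendsto_add bcl_tendsto[OF A] wx AT)
  then show ?thesis
    by (simp add: bcl_diff[OF A] bcl_zero[OF A] y bcl_sum[OF \<Phi>] bcl_scaleC[OF \<Phi>] scaleC_diff_right sum_subtractf)
qed

text \<open>Gram-Schmidt is run on the finite set followed by the \<open>\<Phi> n (u j)\<close>.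
  Weak nullity makes the list orthonormal in the limit, so it changes little, while orthogonality to
  the set becomes exact. Finitely many conditions that hold along \<open>U\<close> hold at a common
  \<open>n\<close>.\<close>

lemma copy:
  assumes B: "finite B" and e: "0 < e"
  shows "\<exists>w. ortho_family w \<and> (\<forall>j<N. norm (w j) = norm (u j) \<and> (\<forall>x\<in>B. cinner (w j) x = 0)) \<and>
    (\<forall>j<N. R (u j) = (\<Sum>l<N. scaleC (cinner (R (u j)) (u l)) (u l)) \<longrightarrow>
        norm (T (w j) - (\<Sum>l<N. scaleC (cinner (R (u j)) (u l)) (w l))) \<le> e) \<and>
    (\<forall>j<N. Rs (u j) = (\<Sum>l<N. scaleC (cinner (Rs (u j)) (u l)) (u l)) \<longrightarrow>
        norm (cadjoint T (w j) - (\<Sum>l<N. scaleC (cinner (Rs (u j)) (u l)) (w l))) \<le> e)"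
proof -
  obtain x :: "nat \<Rightarrow> 'a" and r where x: "B = x ` {i. i < r}"
    using finite_imp_nat_seg_image_inj_on[OF B] by blast
  define \<beta> where "\<beta> = gs x"
  have \<beta>: "ortho_family \<beta>" unfolding \<beta>_def by (rule ortho_family_gs)
  \<comment> \<open>The finite set is orthonormalised beforehand, since \<open>gs_close\<close>
    wants every entry to be identically zero or of norm tending to 1.\<close>
  define X where "X i n = (if i < r then \<beta> i else \<Phi> n (u (i - r)))" for i n
  define w where "w n j = gs (\<lambda>i. X i n) (r + j)" for n j
  have gsX: "ortho_family (gs (\<lambda>i. X i n))" for n by (rule ortho_family_gs)
  have close: "((\<lambda>n. gs (\<lambda>i. X i n) i - X i n) \<longlongrightarrow> 0) U" for i
  proof (rule gs_close)
    fix i j :: nat assume ij: "i \<noteq> j"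
    have sw: "((\<lambda>n. cinner h (\<Phi> n (u k))) \<longlongrightarrow> 0) U" for h k
      using tendsto_cnj[OF weakly_null[of k h]] by (simp add: cinner_commute[symmetric])
    consider "i < r" "j < r" | "i < r" "r \<le> j" | "r \<le> i" "j < r" | "r \<le> i" "r \<le> j" by linarith
    then show "((\<lambda>n. cinner (X i n) (X j n)) \<longlongrightarrow> 0) U"
    proof cases
      case 1 then show ?thesis using ortho_familyD[OF \<beta> ij] by (simp add: X_def)
    next
      case 2 then show ?thesis using sw by (simp add: X_def)
    next
      case 3 then show ?thesis using weakly_null by (simp add: X_def)
    next
      case 4
      then have "i - r \<noteq> j - r" using ij by linarith
      then show ?thesis using \<Phi>_gram[of "u (i - r)" "u (j - r)"] 4 ortho_familyD[OF u, of "i - r" "j - r"]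
        by (simp add: X_def P_u)
    qed
  next
    fix i
    show "(\<forall>n. X i n = 0) \<or> ((\<lambda>n. norm (X i n)) \<longlongrightarrow> 1) U"
    proof (cases "i < r")
      case True
      show ?thesis by (rule ortho_family_cases[OF \<beta>, of i]) (use True in \<open>auto simp: X_def\<close>)
    next
      case False
      show ?thesis
      proof (rule ortho_family_cases[OF u, of "i - r"])
        assume "u (i - r) = 0" then show ?thesis using False by (simp add: X_def bcl_zero[OF \<Phi>])
      next
        assume 1: "cinner (u (i - r)) (u (i - r)) = 1"
        have "((\<lambda>n. sqrt (Re (cinner (\<Phi> n (u (i - r))) (\<Phi> n (u (i - r)))))) \<longlongrightarrow> sqrt (Re 1)) U"
          using \<Phi>_gram[of "u (i - r)" "u (i - r)"] unfolding P_u 1 by (intro tendsto_intros)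
        then show ?thesis using False by (simp add: Re_cinner_self X_def)
      qed
    qed
  qed
  have wc: "((\<lambda>n. w n j - \<Phi> n (u j)) \<longlongrightarrow> 0) U" for j
    using close[of "r + j"] unfolding w_def by (simp add: X_def)
  have wo: "ortho_family (w n)" for n
    using gsX[of n] unfolding ortho_family_def w_def by (metis add_left_cancel)
  have wB: "cinner (w n j) y = 0" if y: "y \<in> B" for n j y
  proof -
    have "\<forall>i<r. cinner (w n j) (gs (\<lambda>i. X i n) i) = 0"
      unfolding w_def using ortho_familyD[OF gsX] by simp
    then have "\<forall>i<r. cinner (w n j) (X i n) = 0" using gs_perp_iff[of r "w n j" "\<lambda>i. X i n"] by blast
    then have "\<forall>i<r. cinner (w n j) (gs x i) = 0" by (simp add: X_def \<beta>_def)
    then have "\<forall>i<r. cinner (w n j) (x i) = 0" using gs_perp_iff[of r "w n j" x] by blast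
    then show ?thesis using y x by auto
  qed
  \<comment> \<open>A norm that is 0 or 1 and tends to 1 is eventually equal to 1, so the norms
    agree exactly.\<close>
  have e1: "eventually (\<lambda>n. norm (w n j) = norm (u j)) U" for j
  proof (rule ortho_family_cases[OF u, of j])
    assume z: "u j = 0"
    have "w n j = 0" for n unfolding w_def by (rule gs_eq_zero) (simp add: X_def z bcl_zero[OF \<Phi>])
    then show ?thesis using z by simp
  next
    assume 1: "cinner (u j) (u j) = 1" "norm (u j) = 1"
    have "((\<lambda>n. sqrt (Re (cinner (\<Phi> n (u j)) (\<Phi> n (u j))))) \<longlongrightarrow> sqrt (Re 1)) U"
      using \<Phi>_gram[of "u j" "u j"] unfolding P_u 1 by (intro tendsto_intros)
    then have nz: "((\<lambda>n. norm (\<Phi> n (u j))) \<longlongrightarrow> 1) U" by (simp add: Re_cinner_self)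
    have "((\<lambda>n. norm (w n j) - norm (\<Phi> n (u j))) \<longlongrightarrow> 0) U"
      by (rule tendsto_0_le[OF wc[of j], where K=1]) (auto intro!: always_eventually norm_triangle_ineq3)
    from tendsto_add[OF this nz] have "((\<lambda>n. norm (w n j)) \<longlongrightarrow> 1) U" by simp
    then have "eventually (\<lambda>n. 0 < norm (w n j)) U" by (rule order_tendstoD) simp
    then show ?thesis
    proof (rule eventually_mono)
      fix n assume "0 < norm (w n j)"
      then show "norm (w n j) = norm (u j)" using wo[of n] 1 unfolding ortho_family_def by auto
    qed
  qed
  have small: "eventually (\<lambda>n. norm (f n) \<le> e) U" if "((\<lambda>n. f n) \<longlongrightarrow> 0) U" for f :: "nat \<Rightarrow> 'a"
    using order_tendstoD(2)[OF tendsto_norm[OF that], of e] e by (auto elim: eventually_mono)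
  have e2: "eventually (\<lambda>n. R (u j) = (\<Sum>l<N. scaleC (cinner (R (u j)) (u l)) (u l)) \<longrightarrow>
        norm (T (w n j) - (\<Sum>l<N. scaleC (cinner (R (u j)) (u l)) (w n l))) \<le> e) U" for j
  proof (cases "R (u j) = (\<Sum>l<N. scaleC (cinner (R (u j)) (u l)) (u l))")
    case True
    then show ?thesis using small[OF copy_bound_tendsto[OF T \<Phi>_R wc True wc]] by (auto elim: eventually_mono)
  qed simp
  have e3: "eventually (\<lambda>n. Rs (u j) = (\<Sum>l<N. scaleC (cinner (Rs (u j)) (u l)) (u l)) \<longrightarrow>
        norm (cadjoint T (w n j) - (\<Sum>l<N. scaleC (cinner (Rs (u j)) (u l)) (w n l))) \<le> e) U" for j
  proof (cases "Rs (u j) = (\<Sum>l<N. scaleC (cinner (Rs (u j)) (u l)) (u l))")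
    case True
    then show ?thesis using small[OF copy_bound_tendsto[OF bcl_cadjoint[OF T] \<Phi>_Rs wc True wc]] by (auto elim: eventually_mono)
  qed simp
  have "eventually (\<lambda>n. \<forall>j\<in>{..<N}. norm (w n j) = norm (u j) \<and>
     (R (u j) = (\<Sum>l<N. scaleC (cinner (R (u j)) (u l)) (u l)) \<longrightarrow>
        norm (T (w n j) - (\<Sum>l<N. scaleC (cinner (R (u j)) (u l)) (w n l))) \<le> e) \<and>
     (Rs (u j) = (\<Sum>l<N. scaleC (cinner (Rs (u j)) (u l)) (u l)) \<longrightarrow>
        norm (cadjoint T (w n j) - (\<Sum>l<N. scaleC (cinner (Rs (u j)) (u l)) (w n l))) \<le> e)) U"
    by (intro eventually_ball_finite ballI eventually_conj e1 e2 e3) simp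
  then obtain n where "\<forall>j\<in>{..<N}. norm (w n j) = norm (u j) \<and>
     (R (u j) = (\<Sum>l<N. scaleC (cinner (R (u j)) (u l)) (u l)) \<longrightarrow>
        norm (T (w n j) - (\<Sum>l<N. scaleC (cinner (R (u j)) (u l)) (w n l))) \<le> e) \<and>
     (Rs (u j) = (\<Sum>l<N. scaleC (cinner (Rs (u j)) (u l)) (u l)) \<longrightarrow>
        norm (cadjoint T (w n j) - (\<Sum>l<N. scaleC (cinner (Rs (u j)) (u l)) (w n l))) \<le> e)"
    using eventually_happens'[OF nonbot] by blast
  then show ?thesis using wo[of n] wB by (intro exI[of _ "w n"]) auto
qed

text \<open>\<open>cc i j\<close> is the vector \<open>u j\<close> in the \<open>i\<close>-th of infinitely many orthogonal copies of the range
  of \<open>Q\<close>; \<open>c\<close> enumerates them all. Since \<open>R\<close> and \<open>Rs\<close> map \<open>u j\<close> into the span of the first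
  \<open>3 * j + 3\<close> vectors, the level of \<open>j\<close> is counted in powers of \<open>3\<close>.\<close>

definition "cc i j = (if u j = 0 then 0 else b (prod_encode (i, j)))"
definition "c p = (case prod_decode p of (i, j) \<Rightarrow> cc i j)"
definition "lev j = (LEAST k. j < 3 ^ k)" for j :: nat
definition "blk p = (case prod_decode p of (i, j) \<Rightarrow> max i (lev j))"

lemma c_encode [simp]: "c (prod_encode (i, j)) = cc i j" by (simp add: c_def)
lemma blk_encode [simp]: "blk (prod_encode (i, j)) = max i (lev j)" by (simp add: blk_def)

lemma lev_le: "lev j \<le> k \<longleftrightarrow> j < 3 ^ k"
proof
  have "j < 3 ^ j" by (induction j) auto
  then have "j < 3 ^ lev j" unfolding lev_def by (rule LeastI)
  moreover assume "lev j \<le> k"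
  ultimately show "j < 3 ^ k" using power_increasing[of "lev j" k "3::nat"] by linarith
qed (auto simp: lev_def intro: Least_le)

text \<open>The copy number enters \<open>blk\<close> through the maximum for this purpose: blocks
  stay finite although there are infinitely many copies.\<close>

lemma finite_blk: "finite {p. blk p \<le> k}"
proof (rule finite_subset)
  show "{p. blk p \<le> k} \<subseteq> prod_encode ` ({..k} \<times> {..<3 ^ k})"
  proof
    fix p assume p: "p \<in> {p. blk p \<le> k}"
    obtain i j where ij: "p = prod_encode (i, j)" by (metis prod_decode_inverse surj_pair)
    show "p \<in> prod_encode ` ({..k} \<times> {..<3 ^ k})" using p unfolding ij by (simp add: lev_le)
  qed
qed simp

lemma cc_norm: "norm (cc i j) = norm (u j)"
  by (rule ortho_family_cases[OF u, of j]) (auto simp: cc_def norm_b)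

lemma cc_zero: "u j = 0 \<Longrightarrow> cc i j = 0" "cc i j = 0 \<Longrightarrow> u j = 0"
  using cc_norm[of i j] by auto

lemma cc_orth: "(i, j) \<noteq> (i', j') \<Longrightarrow> cinner (cc i j) (cc i' j') = 0"
  unfolding cc_def by (simp add: ortho_familyD[OF b] prod_encode_eq)

lemma cc: "ortho_family (cc i)"
  using u cc_orth[of i _ i] unfolding ortho_family_def cc_norm by blast

lemma c: "ortho_family c"
  unfolding ortho_family_def
proof (intro conjI allI impI)
  fix p q :: nat assume "p \<noteq> q"
  then have "prod_decode p \<noteq> prod_decode q" by (simp add: prod_decode_eq)
  then show "cinner (c p) (c q) = 0" unfolding c_def
    by (metis (mono_tags, lifting) cc_orth case_prod_unfold prod.collapse)
next
  fix p show "norm (c p) = 0 \<or> norm (c p) = 1"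
    using u unfolding c_def by (simp add: case_prod_unfold cc_norm ortho_family_def)
qed

lemma c_perpI: "(\<And>p. cinner x (c p) = 0) \<Longrightarrow> cinner x (cc i j) = 0"
  by (metis c_encode)

lemma c_cases: obtains i j where "p = prod_encode (i, j)" "c p = cc i j"
  by (metis c_encode prod_decode_inverse surj_pair)

section \<open>Embeddings of the individual copies and their adjoints\<close>

definition "iota i = theta U u (cc i)"
definition "iotas i = theta U (cc i) u"

lemma iota: "bounded_clinear (iota i)" unfolding iota_def by (rule bcl_theta[OF U u cc])
lemma iotas: "bounded_clinear (iotas i)" unfolding iotas_def by (rule bcl_theta[OF U cc u])
lemma iota_le: "norm (iota i x) \<le> norm x" unfolding iota_def by (rule theta_le[OF U u cc])
lemma iota_u: "iota i (u j) = cc i j" unfolding iota_def by (rule theta_basis[OF U u cc cc_zero(1)])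
lemma iota_perp: "(\<And>j. cinner x (u j) = 0) \<Longrightarrow> iota i x = 0" unfolding iota_def by (rule theta_perp[OF U u cc])
lemma iotas_perp: "(\<And>j. cinner x (cc i j) = 0) \<Longrightarrow> iotas i x = 0" unfolding iotas_def by (rule theta_perp[OF U cc u])
lemma iotas_cc: "iotas i (cc i' j) = (if i' = i then u j else 0)"
proof (cases "i' = i")
  case True then show ?thesis unfolding iotas_def using theta_basis[OF U cc u, of i j] cc_zero(2) by simp
next
  case False then show ?thesis using iotas_perp[of "cc i' j" i] cc_orth by simp
qed
lemma iota_adj: "cinner (iota i x) y = cinner x (iotas i y)"
  unfolding iota_def iotas_def by (rule theta_adjoint[OF U u cc])
lemma iotas_adj: "cinner (iotas i x) y = cinner x (iota i y)"
  unfolding iota_def iotas_def by (rule theta_adjoint[OF U cc u])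

lemma iotas_iota: "iotas i (iota k x) = (if k = i then Q x else 0)"
proof (rule eq_on_basis[where u=u and A="\<lambda>x. iotas i (iota k x)" and B="\<lambda>x. if k = i then Q x else 0"])
  show "bounded_clinear (\<lambda>x. iotas i (iota k x))" by (rule bcl_compose[OF iotas iota])
  show "bounded_clinear (\<lambda>x. if k = i then Q x else 0)" using Q bcl_0 by (cases "k = i") simp_all
  show "iotas i (iota k (u j)) = (if k = i then Q (u j) else 0)" for j by (simp add: iota_u iotas_cc Q_u)
  show "iotas i (iota k x) = (if k = i then Q x else 0)" if "\<And>j. cinner x (u j) = 0" for x
    using theta_perp[OF U u u that] by (simp add: iota_perp[OF that] bcl_zero[OF iotas] theta_u)
qed

text \<open>\<open>amp_sum S N\<close> acts as \<open>S\<close> on each of the first \<open>N\<close> copies; its weak limit is the ampliation of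
  \<open>S\<close> to all copies.\<close>

definition "amp_sum S N x = (\<Sum>i<N. iota i (S (iotas i x)))"

lemma amp_sum_bcl:
  assumes "bounded_clinear S" shows "bounded_clinear (amp_sum S N)"
  unfolding amp_sum_def by (rule bcl_sum_fun) (rule bcl_compose[OF iota bcl_compose[OF assms iotas]])

lemma iota_sum_norm: "(norm (\<Sum>i<N. iota i (y i)))\<^sup>2 \<le> (\<Sum>i<N. (norm (y i))\<^sup>2)"
proof -
  have "(norm (\<Sum>i<N. iota i (y i)))\<^sup>2 = (\<Sum>i<N. (norm (iota i (y i)))\<^sup>2)"
    by (rule norm_sum_sq) (simp_all add: iota_adj iotas_iota)
  also have "\<dots> \<le> (\<Sum>i<N. (norm (y i))\<^sup>2)" by (intro sum_mono power_mono iota_le) simp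
  finally show ?thesis .
qed

text \<open>Dual to \<open>iota_sum_norm\<close>: pairing \<open>t\<close> with \<open>x\<close>
  gives \<open>\<sigma>\<close>, and \<open>\<sigma>\<close> also bounds the square of
  \<open>norm t\<close>, so Cauchy-Schwarz gives the claim.\<close>

lemma iotas_bessel: "(\<Sum>i<N. (norm (iotas i x))\<^sup>2) \<le> (norm x)\<^sup>2"
proof -
  define t where "t = (\<Sum>i<N. iota i (iotas i x))"
  define \<sigma> where "\<sigma> = (\<Sum>i<N. (norm (iotas i x))\<^sup>2)"
  have \<sigma>: "0 \<le> \<sigma>" unfolding \<sigma>_def by (simp add: sum_nonneg)
  have "cinner t x = of_real \<sigma>"
    unfolding t_def \<sigma>_def by (simp add: cinner_sum_left iota_adj cinner_self_norm)
  then have "\<sigma> \<le> norm t * norm x" using cauchy_schwarz[of t x] \<sigma> by simp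
  then have "\<sigma>\<^sup>2 \<le> (norm t)\<^sup>2 * (norm x)\<^sup>2"
    unfolding power_mult_distrib[symmetric] using \<sigma> by (rule power_mono)
  also have "\<dots> \<le> \<sigma> * (norm x)\<^sup>2"
    unfolding t_def \<sigma>_def by (intro mult_right_mono iota_sum_norm) simp
  finally have "\<sigma> * \<sigma> \<le> \<sigma> * (norm x)\<^sup>2" by (simp add: power2_eq_square)
  then show ?thesis using \<sigma> unfolding \<sigma>_def[symmetric]
    by (cases "\<sigma> = 0") auto
qed

lemma amp_sum_bound:
  assumes "\<And>x. norm (S x) \<le> s * norm x" "0 \<le> s" shows "norm (amp_sum S N x) \<le> s * norm x"
proof -
  have "(norm (amp_sum S N x))\<^sup>2 \<le> (\<Sum>i<N. (norm (S (iotas i x)))\<^sup>2)"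
    unfolding amp_sum_def by (rule iota_sum_norm)
  also have "\<dots> \<le> (\<Sum>i<N. (s * norm (iotas i x))\<^sup>2)" by (intro sum_mono power_mono assms) simp
  also have "\<dots> = s\<^sup>2 * (\<Sum>i<N. (norm (iotas i x))\<^sup>2)" by (simp add: power_mult_distrib sum_distrib_left)
  also have "\<dots> \<le> s\<^sup>2 * (norm x)\<^sup>2" by (intro mult_left_mono iotas_bessel) simp
  finally have "(norm (amp_sum S N x))\<^sup>2 \<le> (s * norm x)\<^sup>2" by (simp add: power_mult_distrib)
  then show ?thesis by (rule power2_le_imp_le) (use assms(2) in simp)
qed

text \<open>On \<open>cc i j\<close> the partial sums are constant as soon as \<open>N > i\<close>,
  so the weak limit takes the expected value there exactly.\<close>

lemma amp_exists:
  assumes S: "bounded_clinear S"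
  shows "\<exists>A. bounded_clinear A \<and> (\<forall>i j. A (cc i j) = iota i (S (u j))) \<and>
    (\<forall>x. (\<forall>p. cinner x (c p) = 0) \<longrightarrow> A x = 0) \<and>
    (\<forall>x y. ((\<lambda>N. cinner (amp_sum S N x) y) \<longlongrightarrow> cinner (A x) y) U)"
proof -
  obtain s where s: "0 < s" "\<And>x. norm (S x) \<le> s * norm x" by (rule bcl_bound[OF S]) blast
  obtain A where A: "bounded_clinear A" "\<And>x y. ((\<lambda>N. cinner (amp_sum S N x) y) \<longlongrightarrow> cinner (A x) y) U"
    by (rule weak_ultralimit[OF U, of "amp_sum S" s, OF amp_sum_bcl[OF S] amp_sum_bound[OF s(2) less_imp_le[OF s(1)]]]) blast
  have lim: "A x = z" if "\<And>N. N > k \<Longrightarrow> amp_sum S N x = z" for x z k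
  proof (rule cinner_eqI)
    fix y
    have "eventually (\<lambda>N. N > k) U"
      using filter_leD[OF free_ultrafilter_le_sequentially[OF U] eventually_gt_at_top[of k]] .
    then have "eventually (\<lambda>N. cinner (amp_sum S N x) y = cinner z y) U"
      by (rule eventually_mono) (simp add: that)
    then have "((\<lambda>N. cinner (amp_sum S N x) y) \<longlongrightarrow> cinner z y) U" by (rule tendsto_eventually)
    then show "cinner (A x) y = cinner z y" using tendsto_unique[OF nonbot A(2)] by blast
  qed
  have "A (cc i j) = iota i (S (u j))" for i j
  proof (rule lim[of i])
    fix N assume N: "i < N"
    have "amp_sum S N (cc i j) = (\<Sum>k<N. if k = i then iota i (S (u j)) else 0)"
      unfolding amp_sum_def by (rule sum.cong) (auto simp: iotas_cc bcl_zero[OF S] bcl_zero[OF iota])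
    then show "amp_sum S N (cc i j) = iota i (S (u j))" using N by simp
  qed
  moreover have "A x = 0" if "\<forall>p. cinner x (c p) = 0" for x
  proof (rule lim)
    fix N
    have "iotas i x = 0" for i by (rule iotas_perp) (use that c_perpI in blast)
    then show "amp_sum S N x = 0" by (simp add: amp_sum_def bcl_zero[OF S] bcl_zero[OF iota])
  qed
  ultimately show ?thesis using A by blast
qed

lemma amp_adjoint:
  assumes S: "bounded_clinear S"
    and A: "\<And>x y. ((\<lambda>N. cinner (amp_sum S N x) y) \<longlongrightarrow> cinner (A x) y) U"
    and A': "\<And>x y. ((\<lambda>N. cinner (amp_sum (cadjoint S) N x) y) \<longlongrightarrow> cinner (A' x) y) U"
  shows "cinner (A' x) y = cinner x (A y)"
proof -
  have "cinner (amp_sum (cadjoint S) N x) y = cnj (cinner (amp_sum S N y) x)" for N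
    unfolding amp_sum_def cinner_sum_left cnj_sum
    by (rule sum.cong) (simp_all add: iota_adj iotas_adj cadjoint_left[OF S] flip: cinner_commute)
  then have "((\<lambda>N. cinner (amp_sum (cadjoint S) N x) y) \<longlongrightarrow> cnj (cinner (A y) x)) U"
    using tendsto_cnj[OF A[of y x]] by simp
  then have "cinner (A' x) y = cnj (cinner (A y) x)" using tendsto_unique[OF nonbot A'] by blast
  then show ?thesis by (simp add: cinner_commute[symmetric])
qed

lemma amp_expand:
  assumes A: "\<And>i j. A (cc i j) = iota i (S (u j))" and S: "pr (3 * j + 3) (S (u j)) = S (u j)"
    and j: "j < 3 ^ k"
  shows "A (cc i j) = (\<Sum>l<3 ^ Suc k. scaleC (cinner (S (u j)) (u l)) (cc i l))"
  unfolding A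
  by (subst pr_pow[of j S k, OF S j]) (simp only: bcl_sum[OF iota] bcl_scaleC[OF iota] iota_u)

text \<open>An ampliation keeps the copy number and, by \<open>pr_pow\<close>, raises the level by
  at most one; so the maximum \<open>blk\<close> also grows by at most one.\<close>

lemma amp_banded:
  assumes A: "\<And>i j. A (cc i j) = iota i (S (u j))" and S: "\<And>j. pr (3 * j + 3) (S (u j)) = S (u j)"
  shows "block_banded c blk A"
  unfolding block_banded_def
proof
  fix p
  obtain i j where p: "p = prod_encode (i, j)" "c p = cc i j" by (rule c_cases)
  define m where "m = blk p"
  have m: "i \<le> m" "j < 3 ^ m" unfolding m_def p(1) by (simp_all flip: lev_le)
  have e: "A (c p) = (\<Sum>l<3 ^ Suc m. scaleC (cinner (S (u j)) (u l)) (c (prod_encode (i, l))))"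
    unfolding p(2) c_encode by (rule amp_expand[OF A S m(2)])
  show "A (c p) = (\<Sum>q\<in>{q. blk q \<le> Suc (blk p)}. scaleC (cinner (A (c p)) (c q)) (c q))"
    unfolding e m_def[symmetric]
  proof (rule ortho_transfer_sum[OF c finite_blk, symmetric])
    fix l assume "l \<in> {..<3 ^ Suc m :: nat}"
    then have "lev l \<le> Suc m" unfolding lev_le by simp
    then show "prod_encode (i, l) \<in> {q. blk q \<le> Suc m}" using m(1) by simp
  qed simp
qed

text \<open>\<open>copy\<close> is applied once for each copy number, every time avoiding
  \<open>B\<close> and all earlier copies, and the results are arranged along
  \<open>prod_encode\<close>.\<close>

lemma amp_copies:
  assumes B: "finite B" and e: "0 < e"
    and A: "\<And>i j. A (cc i j) = iota i (R (u j))" and A': "\<And>i j. A' (cc i j) = iota i (Rs (u j))"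
  shows "\<exists>w. ortho_family w \<and>
       (\<forall>p. blk p \<le> k \<longrightarrow> norm (w p) = norm (c p) \<and> (\<forall>x\<in>B. cinner (w p) x = 0)) \<and>
       (\<forall>p. blk p < k \<longrightarrow>
          norm (T (w p) - (\<Sum>q\<in>{q. blk q \<le> k}. scaleC (cinner (A (c p)) (c q)) (w q))) \<le> e \<and>
          norm (cadjoint T (w p) - (\<Sum>q\<in>{q. blk q \<le> k}. scaleC (cinner (A' (c p)) (c q)) (w q))) \<le> e)"
proof -
  define N :: nat where "N = 3 ^ k"
  define good where "good f i w \<longleftrightarrow> ortho_family w \<and>
    (\<forall>j<N. norm (w j) = norm (u j) \<and> (\<forall>x\<in>B \<union> (\<Union>m<i. f m ` {..<N}). cinner (w j) x = 0)) \<and>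
    (\<forall>j<N. R (u j) = (\<Sum>l<N. scaleC (cinner (R (u j)) (u l)) (u l)) \<longrightarrow>
        norm (T (w j) - (\<Sum>l<N. scaleC (cinner (R (u j)) (u l)) (w l))) \<le> e) \<and>
    (\<forall>j<N. Rs (u j) = (\<Sum>l<N. scaleC (cinner (Rs (u j)) (u l)) (u l)) \<longrightarrow>
        norm (cadjoint T (w j) - (\<Sum>l<N. scaleC (cinner (Rs (u j)) (u l)) (w l))) \<le> e)"
    for f :: "nat \<Rightarrow> nat \<Rightarrow> 'a" and i w
  have "\<exists>w. \<forall>i. good w i (w i)"
  proof (rule dependent_wellorder_choice)
    fix r :: "nat \<Rightarrow> 'a" and f g :: "nat \<Rightarrow> nat \<Rightarrow> 'a" and i :: nat
    assume "\<And>m. m < i \<Longrightarrow> f m = g m"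
    then have "(\<Union>m<i. f m ` {..<N}) = (\<Union>m<i. g m ` {..<N})" by auto
    then show "good f i r = good g i r" by (simp add: good_def)
  next
    fix i and f :: "nat \<Rightarrow> nat \<Rightarrow> 'a"
    have "finite (B \<union> (\<Union>m<i. f m ` {..<N}))" using B by auto
    from copy[OF this e, of N] show "\<exists>r. good f i r" unfolding good_def .
  qed
  then obtain w where w: "\<And>i. good w i (w i)" by blast
  have wo: "ortho_family (w i)" for i using w[of i] by (simp add: good_def)
  have wu: "norm (w i j) = norm (u j)" if "j < N" for i j using w[of i] that by (simp add: good_def)
  have wB: "cinner (w i j) x = 0" if "j < N" "x \<in> B" for i j x
    using w[of i] that unfolding good_def by blast
  have wlt: "cinner (w i j) (w m l) = 0" if "m < i" "j < N" "l < N" for i j m l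
    using w[of i] that unfolding good_def by blast
  have wne: "cinner (w i j) (w m l) = 0" if "m \<noteq> i" "j < N" "l < N" for i j m l
    using that wlt by (metis cinner_commute complex_cnj_zero nat_neq_iff)
  \<comment> \<open>Indices \<open>j \<ge> N\<close> have a block number above \<open>k\<close>,
    where no condition is imposed; the value 0 keeps the family orthogonal.\<close>
  define v where "v p = (case prod_decode p of (i, j) \<Rightarrow> if j < N then w i j else 0)" for p
  have v_enc: "v (prod_encode (i, j)) = (if j < N then w i j else 0)" for i j by (simp add: v_def)
  have vo: "ortho_family v"
    unfolding ortho_family_def
  proof (intro conjI allI impI)
    fix p q :: nat assume pq: "p \<noteq> q"
    obtain i j where p: "p = prod_encode (i, j)" by (rule c_cases)
    obtain i' j' where q: "q = prod_encode (i', j')" by (rule c_cases)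
    show "cinner (v p) (v q) = 0"
      using pq wne[of i' i j j'] ortho_familyD[OF wo, of j j' i] unfolding p q v_enc by auto
  next
    fix p
    obtain i j where p: "p = prod_encode (i, j)" by (rule c_cases)
    show "norm (v p) = 0 \<or> norm (v p) = 1" using wo[of i] unfolding p v_enc ortho_family_def by simp
  qed
  have blkN: "i \<le> k" "j < N" if "blk (prod_encode (i, j)) \<le> k" for i j
    using that by (simp_all add: N_def flip: lev_le)
  have vc: "norm (v p) = norm (c p)" if "blk p \<le> k" for p
  proof -
    obtain i j where p: "p = prod_encode (i, j)" "c p = cc i j" by (rule c_cases)
    have "j < N" using blkN that unfolding p by blast
    then show ?thesis by (simp add: p v_enc wu cc_norm)
  qed
  have est: "norm (T' (v p) - (\<Sum>q\<in>{q. blk q \<le> k}. scaleC (cinner (D (c p)) (c q)) (v q))) \<le> e"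
    if D: "\<And>i j. D (cc i j) = iota i (S (u j))" and S: "\<And>j. pr (3 * j + 3) (S (u j)) = S (u j)"
      and wS: "\<And>i j. j < N \<Longrightarrow> S (u j) = (\<Sum>l<N. scaleC (cinner (S (u j)) (u l)) (u l)) \<Longrightarrow>
        norm (T' (w i j) - (\<Sum>l<N. scaleC (cinner (S (u j)) (u l)) (w i l))) \<le> e"
      and p: "blk p < k" for T' D S p
  proof -
    obtain i j where ij: "p = prod_encode (i, j)" "c p = cc i j" by (rule c_cases)
    \<comment> \<open>As \<open>blk p < k\<close>, the level of \<open>j\<close> is at most
      \<open>k'\<close>, so \<open>S (u j)\<close> still lies in the span of the first
      \<open>3 ^ k\<close> vectors. The strict inequality for the estimates provides this one
      step.\<close>
    obtain k' where k': "k = Suc k'" using p by (cases k) auto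
    have "lev j \<le> k'" "i \<le> k'" using p unfolding ij(1) k' by simp_all
    then have j: "j < 3 ^ k'" and i: "i \<le> k" by (simp_all add: lev_le k')
    have jN: "j < N" using j unfolding N_def k' by simp
    have e1: "D (c p) = (\<Sum>l<N. scaleC (cinner (S (u j)) (u l)) (c (prod_encode (i, l))))"
      unfolding ij(2) c_encode N_def k' by (rule amp_expand[OF D S j])
    have "(\<Sum>q\<in>{q. blk q \<le> k}. scaleC (cinner (D (c p)) (c q)) (v q))
        = (\<Sum>l<N. scaleC (cinner (S (u j)) (u l)) (v (prod_encode (i, l))))"
      unfolding e1
    proof (rule ortho_transfer_sum[OF c finite_blk])
      fix l assume "l \<in> {..<N}"
      then have "lev l \<le> k" unfolding lev_le N_def by simp
      then show "prod_encode (i, l) \<in> {q. blk q \<le> k}" using i by simp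
    next
      fix q assume "q \<in> {q. blk q \<le> k}" "c q = 0"
      then show "v q = 0" using vc[of q] by simp
    qed
    also have "\<dots> = (\<Sum>l<N. scaleC (cinner (S (u j)) (u l)) (w i l))"
      by (rule sum.cong) (auto simp: v_enc)
    finally have e2: "(\<Sum>q\<in>{q. blk q \<le> k}. scaleC (cinner (D (c p)) (c q)) (v q))
        = (\<Sum>l<N. scaleC (cinner (S (u j)) (u l)) (w i l))" .
    have e3: "S (u j) = (\<Sum>l<N. scaleC (cinner (S (u j)) (u l)) (u l))"
      unfolding N_def k' by (rule pr_pow[of j S, OF S j])
    show ?thesis unfolding e2 using wS[OF jN e3, of i] jN by (simp add: ij(1) v_enc)
  qed
  have R1: "norm (T (w i j) - (\<Sum>l<N. scaleC (cinner (R (u j)) (u l)) (w i l))) \<le> e"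
    if "j < N" "R (u j) = (\<Sum>l<N. scaleC (cinner (R (u j)) (u l)) (u l))" for i j
    using w[of i] that unfolding good_def by blast
  have R2: "norm (cadjoint T (w i j) - (\<Sum>l<N. scaleC (cinner (Rs (u j)) (u l)) (w i l))) \<le> e"
    if "j < N" "Rs (u j) = (\<Sum>l<N. scaleC (cinner (Rs (u j)) (u l)) (u l))" for i j
    using w[of i] that unfolding good_def by blast
  have vB: "cinner (v p) x = 0" if "blk p \<le> k" "x \<in> B" for p x
  proof -
    obtain i j where p: "p = prod_encode (i, j)" by (rule c_cases)
    have "j < N" using blkN that unfolding p by blast
    then show ?thesis using wB that by (simp add: p v_enc)
  qed
  show ?thesis
    using vo vc vB est[OF A pr_R R1] est[OF A' pr_Rs R2] by (intro exI[of _ v]) blast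
qed

section \<open>The shift of the copies\<close>

definition "c' p = (case prod_decode p of (i, j) \<Rightarrow> cc (Suc i) j)"
text \<open>A unilateral shift on the span of \<open>c\<close>, moving each copy to the next; the
  defect recorded in \<open>sh_shs\<close> is the projection onto copy 0.\<close>

definition "sh = theta U c c'"
definition "shs = theta U c' c"
definition "Pc = theta U c c"

lemma c'_encode [simp]: "c' (prod_encode (i, j)) = cc (Suc i) j" by (simp add: c'_def)

lemma c'_eq: "c' p = c (case prod_decode p of (i, j) \<Rightarrow> prod_encode (Suc i, j))"
  by (simp add: c'_def split: prod.split)

lemma c': "ortho_family c'"
  unfolding ortho_family_def
proof (intro conjI allI impI)
  fix p q :: nat assume pq: "p \<noteq> q"
  obtain i j where p: "p = prod_encode (i, j)" by (rule c_cases)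
  obtain i' j' where q: "q = prod_encode (i', j')" by (rule c_cases)
  show "cinner (c' p) (c' q) = 0" using pq cc_orth[of "Suc i" j "Suc i'" j'] unfolding p q by auto
next
  fix p
  show "norm (c' p) = 0 \<or> norm (c' p) = 1" using c unfolding c'_eq ortho_family_def by blast
qed

lemma c_c'_zero: "c p = 0 \<Longrightarrow> c' p = 0" "c' p = 0 \<Longrightarrow> c p = 0"
proof -
  obtain i j where p: "p = prod_encode (i, j)" by (rule c_cases)
  show "c p = 0 \<Longrightarrow> c' p = 0" "c' p = 0 \<Longrightarrow> c p = 0" unfolding p by (simp_all add: cc_zero)
qed

lemma sh: "bounded_clinear sh" unfolding sh_def by (rule bcl_theta[OF U c c'])
lemma shs: "bounded_clinear shs" unfolding shs_def by (rule bcl_theta[OF U c' c])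
lemma Pc: "bounded_clinear Pc" unfolding Pc_def by (rule bcl_theta[OF U c c])
lemma sh_le: "norm (sh x) \<le> norm x" unfolding sh_def by (rule theta_le[OF U c c'])
lemma sh_perp: "(\<And>p. cinner x (c p) = 0) \<Longrightarrow> sh x = 0" unfolding sh_def by (rule theta_perp[OF U c c'])
lemma Pc_perp: "(\<And>p. cinner x (c p) = 0) \<Longrightarrow> Pc x = 0" unfolding Pc_def by (rule theta_perp[OF U c c])
lemma shs_perp': "(\<And>p. cinner x (c' p) = 0) \<Longrightarrow> shs x = 0" unfolding shs_def by (rule theta_perp[OF U c' c])
lemma shs_perp: "(\<And>p. cinner x (c p) = 0) \<Longrightarrow> shs x = 0"
  by (rule shs_perp') (simp add: c'_eq)
lemma sh_c: "sh (c p) = c' p" unfolding sh_def by (rule theta_basis[OF U c c' c_c'_zero(1)])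
lemma sh_cc: "sh (cc i j) = cc (Suc i) j" using sh_c[of "prod_encode (i, j)"] by simp
lemma shs_c': "shs (c' p) = c p" unfolding shs_def by (rule theta_basis[OF U c' c c_c'_zero(2)])
lemma shs_cc_Suc: "shs (cc (Suc i) j) = cc i j" using shs_c'[of "prod_encode (i, j)"] by simp
lemma Pc_c: "Pc (c p) = c p" unfolding Pc_def by (rule theta_basis[OF U c c])
lemma Pc_cc: "Pc (cc i j) = cc i j" using Pc_c[of "prod_encode (i, j)"] by simp
lemma shs_cc_0: "shs (cc 0 j) = 0"
proof (rule shs_perp')
  fix p
  obtain i l where p: "p = prod_encode (i, l)" by (rule c_cases)
  show "cinner (cc 0 j) (c' p) = 0" unfolding p by (simp add: cc_orth)
qed
lemma sh_adj: "cinner (sh x) y = cinner x (shs y)" unfolding sh_def shs_def by (rule theta_adjoint[OF U c c'])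
lemma eq_on_c:
  assumes "bounded_clinear A" "bounded_clinear B" "\<And>i j. A (cc i j) = B (cc i j)"
    and "\<And>x. (\<And>p. cinner x (c p) = 0) \<Longrightarrow> A x = B x"
  shows "A x = B x"
proof (rule eq_on_basis[where u=c, OF assms(1,2) _ assms(4)])
  fix p
  obtain i j where "p = prod_encode (i, j)" "c p = cc i j" by (rule c_cases)
  then show "A (c p) = B (c p)" using assms(3) by simp
qed

lemma eq_on_u:
  assumes "bounded_clinear A" "bounded_clinear B" "\<And>j. A (u j) = B (u j)"
    and "\<And>x. (\<And>j. cinner x (u j) = 0) \<Longrightarrow> A x = B x"
  shows "A x = B x"
  by (rule eq_on_basis[where u=u, OF assms])

lemma Q_perp: "(\<And>j. cinner x (u j) = 0) \<Longrightarrow> Q x = 0"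
  using theta_perp[OF U u u] by (simp add: theta_u)

lemma sh_Pc: "sh (Pc x) = sh x"
  by (rule eq_on_c[OF bcl_compose[OF sh Pc] sh]) (simp_all add: Pc_cc Pc_perp sh_perp bcl_zero[OF sh])

lemma Pc_sh: "Pc (sh x) = sh x"
  by (rule eq_on_c[OF bcl_compose[OF Pc sh] sh]) (simp_all add: sh_cc Pc_cc sh_perp bcl_zero[OF Pc])

lemma shs_sh: "shs (sh x) = Pc x"
  by (rule eq_on_c[OF bcl_compose[OF shs sh] Pc]) (simp_all add: sh_cc shs_cc_Suc Pc_cc sh_perp Pc_perp bcl_zero[OF shs])

lemma shs_Pc: "shs (Pc x) = shs x"
  by (rule eq_on_c[OF bcl_compose[OF shs Pc] shs]) (simp_all add: Pc_cc Pc_perp shs_perp bcl_zero[OF shs])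

lemma iotas_c_perp: "(\<And>p. cinner x (c p) = 0) \<Longrightarrow> iotas i x = 0"
  by (rule iotas_perp) (rule c_perpI)

lemma iotas_Pc: "iotas i (Pc x) = iotas i x"
  by (rule eq_on_c[OF bcl_compose[OF iotas Pc] iotas]) (simp_all add: Pc_cc Pc_perp iotas_c_perp bcl_zero[OF iotas])

lemma iotas_sh: "iotas 0 (sh x) = 0"
  by (rule eq_on_c[OF bcl_compose[OF iotas sh] bcl_0]) (simp_all add: sh_cc iotas_cc sh_perp bcl_zero[OF iotas])

lemma shs_iota: "shs (iota 0 x) = 0"
  by (rule eq_on_u[OF bcl_compose[OF shs iota] bcl_0]) (simp_all add: iota_u shs_cc_0 iota_perp bcl_zero[OF shs])

lemma sh_shs: "sh (shs x) = Pc x - iota 0 (iotas 0 x)"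
proof (rule eq_on_c[OF bcl_compose[OF sh shs] bcl_minus_fun[OF Pc bcl_compose[OF iota iotas]]])
  fix i j
  show "sh (shs (cc i j)) = Pc (cc i j) - iota 0 (iotas 0 (cc i j))"
    by (cases i) (simp_all add: shs_cc_0 shs_cc_Suc sh_cc Pc_cc iotas_cc iota_u bcl_zero[OF sh] bcl_zero[OF iota])
qed (simp add: shs_perp Pc_perp iotas_c_perp bcl_zero[OF sh] bcl_zero[OF iota])

lemma iota_J: "iota 0 (J h) = 0"
proof (rule iota_perp)
  fix j show "cinner (J h) (u j) = 0" using u_perp_J[of j h] by (metis cinner_commute complex_cnj_zero)
qed

lemma Js_iotas: "Js (iotas 0 z) = 0"
  by (rule cinner_eqI) (simp add: cadjoint_left[OF J] iotas_adj iota_J)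

lemma sh_iota: "sh (iota i x) = iota (Suc i) x"
  by (rule eq_on_u[OF bcl_compose[OF sh iota] iota]) (simp_all add: iota_u sh_cc iota_perp bcl_zero[OF sh])

lemma iota_Q: "iota i (Q x) = iota i x"
  by (rule eq_on_u[OF bcl_compose[OF iota Q] iota]) (simp_all add: Q_u Q_perp iota_perp bcl_zero[OF iota])

text \<open>\<open>W\<close> identifies \<open>J H\<close> plus its complement with \<open>H\<close> by shifting the copies \<open>V (cc i _)\<close>
  of the complement one step up to free the copy number \<open>0\<close>.\<close>

lemma absorb:
  assumes \<epsilon>: "0 < \<epsilon>"
  shows "\<exists>W. bounded_clinear W \<and> (\<forall>x. norm (W x) \<le> norm x) \<and> (\<forall>x. cadjoint W (W x) = P x) \<and>
     (\<forall>y. W (cadjoint W y) = y) \<and> small_compact \<epsilon> (\<lambda>x. T (W x) - W (R x))"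
proof -
  \<comment> \<open>\<open>R\<close> on the complement of \<open>J H\<close>. Since \<open>Q\<close>
    commutes with \<open>R\<close>, compression and restriction agree and the adjoint has the same
    form.\<close>
  define S where "S x = R (Q x)" for x
  have S: "bounded_clinear S" unfolding S_def by (rule bcl_compose[OF R Q])
  have Ss: "cadjoint S = (\<lambda>x. Rs (Q x))"
    by (rule cadjoint_eqI[OF S]) (simp add: S_def cadjoint_left[OF R] Q_sa QR)
  have Su: "S (u j) = R (u j)" "cadjoint S (u j) = Rs (u j)" for j by (simp_all add: S_def Ss Q_u)
  from amp_exists[OF S] obtain A where A: "bounded_clinear A" "\<And>i j. A (cc i j) = iota i (S (u j))"
    "\<And>x. (\<And>p. cinner x (c p) = 0) \<Longrightarrow> A x = 0"
    "\<And>x y. ((\<lambda>N. cinner (amp_sum S N x) y) \<longlongrightarrow> cinner (A x) y) U" by blast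
  from amp_exists[OF bcl_cadjoint[OF S]] obtain A' where A': "bounded_clinear A'"
    "\<And>i j. A' (cc i j) = iota i (cadjoint S (u j))"
    "\<And>x. (\<And>p. cinner x (c p) = 0) \<Longrightarrow> A' x = 0"
    "\<And>x y. ((\<lambda>N. cinner (amp_sum (cadjoint S) N x) y) \<longlongrightarrow> cinner (A' x) y) U" by blast
  have As: "cadjoint A = A'"
    by (rule cadjoint_eqI[OF A(1) amp_adjoint[OF S A(4) A'(4)]])
  have Acc: "A (cc i j) = iota i (R (u j))" "A' (cc i j) = iota i (Rs (u j))" for i j
    by (simp_all add: A(2) A'(2) Su)
  \<comment> \<open>The formula \<open>diff\<close> has five error terms, each bounded by
    \<open>\<epsilon> / 5\<close>.\<close>
  obtain \<omega> where \<omega>: "ortho_family \<omega>" "\<And>p. norm (\<omega> p) = norm (c p)"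
    and sm: "small_compact (\<epsilon> / 5) (\<lambda>x. T (theta U c \<omega> x) - theta U c \<omega> (A x))"
      "small_compact (\<epsilon> / 5) (\<lambda>x. cadjoint T (theta U c \<omega> x) - theta U c \<omega> (cadjoint A x))"
  proof (rule intertwining_isometry[OF U T A(1) c finite_blk])
    show "block_banded c blk A" by (rule amp_banded[OF Acc(1) pr_R])
    show "block_banded c blk (cadjoint A)" unfolding As by (rule amp_banded[OF Acc(2) pr_Rs])
    show "(\<And>p. cinner x (c p) = 0) \<Longrightarrow> A x = 0" for x by (rule A(3))
    show "(\<And>p. cinner x (c p) = 0) \<Longrightarrow> cadjoint A x = 0" for x unfolding As by (rule A'(3))
    show "0 < \<epsilon> / 5" using \<epsilon> by simp
    show "\<exists>w. ortho_family w \<and>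
       (\<forall>p. blk p \<le> k \<longrightarrow> norm (w p) = norm (c p) \<and> (\<forall>x\<in>B. cinner (w p) x = 0)) \<and>
       (\<forall>p. blk p < k \<longrightarrow>
          norm (T (w p) - (\<Sum>q\<in>{q. blk q \<le> k}. scaleC (cinner (A (c p)) (c q)) (w q))) \<le> d \<and>
          norm (cadjoint T (w p) - (\<Sum>q\<in>{q. blk q \<le> k}. scaleC (cinner (cadjoint A (c p)) (c q)) (w q))) \<le> d)"
      if "finite B" "0 < d" for k B d
      unfolding As by (rule amp_copies[OF that Acc])
  qed blast
  have c\<omega>: "c p = 0 \<Longrightarrow> \<omega> p = 0" "\<omega> p = 0 \<Longrightarrow> c p = 0" for p
    using \<omega>(2)[of p] by auto
  define V where "V = theta U c \<omega>"
  define Vs where "Vs = theta U \<omega> c"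
  have V: "bounded_clinear V" unfolding V_def by (rule bcl_theta[OF U c \<omega>(1)])
  have Vs: "bounded_clinear Vs" unfolding Vs_def by (rule bcl_theta[OF U \<omega>(1) c])
  have V_le: "norm (V x) \<le> norm x" for x unfolding V_def by (rule theta_le[OF U c \<omega>(1)])
  have Vs_le: "norm (Vs x) \<le> norm x" for x unfolding Vs_def by (rule theta_le[OF U \<omega>(1) c])
  have V_c: "V (c p) = \<omega> p" for p unfolding V_def by (rule theta_basis[OF U c \<omega>(1) c\<omega>(1)])
  have Vs_\<omega>: "Vs (\<omega> p) = c p" for p unfolding Vs_def by (rule theta_basis[OF U \<omega>(1) c c\<omega>(2)])
  have V_perp: "(\<And>p. cinner x (c p) = 0) \<Longrightarrow> V x = 0" for x unfolding V_def by (rule theta_perp[OF U c \<omega>(1)])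
  have Vs_perp: "(\<And>p. cinner x (\<omega> p) = 0) \<Longrightarrow> Vs x = 0" for x unfolding Vs_def by (rule theta_perp[OF U \<omega>(1) c])
  have V_adj: "cinner (V x) y = cinner x (Vs y)" for x y
    unfolding V_def Vs_def by (rule theta_adjoint[OF U c \<omega>(1)])
  have VsV: "Vs (V x) = Pc x" for x
    by (rule eq_on_basis[where u=c, OF bcl_compose[OF Vs V] Pc])
      (simp_all add: V_c Vs_\<omega> Pc_c V_perp Pc_perp bcl_zero[OF Vs])
  have VPc: "V (Pc x) = V x" for x
    by (rule eq_on_basis[where u=c, OF bcl_compose[OF V Pc] V])
      (simp_all add: V_perp Pc_c Pc_perp bcl_zero[OF V])
  have PcVs: "Pc (Vs x) = Vs x" for x
    by (rule eq_on_basis[where u=\<omega>, OF bcl_compose[OF Pc Vs] Vs])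
      (simp_all add: Vs_\<omega> Vs_perp Pc_c bcl_zero[OF Pc])
  \<comment> \<open>An isometry that is the identity off the range of \<open>V\<close> and the shift
    of copies on it. Its range is the complement of copy 0 under \<open>V\<close>.\<close>
  define A1 where "A1 h = h - V (Vs h) + V (sh (Vs h))" for h
  define A1s where "A1s h = h - V (Vs h) + V (shs (Vs h))" for h
  have A1: "bounded_clinear A1" unfolding A1_def
    by (intro bcl_plus bcl_minus_fun bcl_id bcl_compose[OF V Vs] bcl_compose[OF V bcl_compose[OF sh Vs]])
  have A1s: "bounded_clinear A1s" unfolding A1s_def
    by (intro bcl_plus bcl_minus_fun bcl_id bcl_compose[OF V Vs] bcl_compose[OF V bcl_compose[OF shs Vs]])
  have A1_adj: "cinner (A1 x) y = cinner x (A1s y)" for x y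
  proof -
    have "cinner (Vs x) y = cinner x (V y)" for x y
      unfolding V_def Vs_def by (rule theta_adjoint[OF U \<omega>(1) c])
    then show ?thesis by (simp add: A1_def A1s_def cinner_simps V_adj sh_adj)
  qed
  \<comment> \<open>The complement of \<open>J H\<close> goes to the freed copy 0 and
    \<open>J H\<close> itself to the range of \<open>A1\<close>; together these exhaust H.\<close>
  define W where "W x = V (iota 0 x) + A1 (Js x)" for x
  define Ws where "Ws y = iotas 0 (Vs y) + J (A1s y)" for y
  have W: "bounded_clinear W" unfolding W_def
    by (rule bcl_plus[OF bcl_compose[OF V iota] bcl_compose[OF A1 Js]])
  have Ws: "cadjoint W = Ws"
  proof (rule cadjoint_eqI[OF W])
    fix x y
    have "cinner (W y) x = cinner y (Ws x)"
      by (simp add: W_def Ws_def cinner_simps V_adj iota_adj A1_adj cadjoint_left[OF J])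
    then show "cinner (Ws x) y = cinner x (W y)" by (metis cinner_commute)
  qed
  have A1V: "A1 (V z) = V (sh z)" for z by (simp add: A1_def VsV VPc sh_Pc)
  have A1sV: "A1s (V z) = V (shs z)" for z by (simp add: A1s_def VsV VPc shs_Pc)
  have A1A1s: "A1 (A1s y) = y - V (iota 0 (iotas 0 (Vs y)))" for y
    unfolding A1s_def
    by (simp add: bcl_add[OF A1] bcl_diff[OF A1] A1V) (simp add: A1_def sh_shs bcl_diff[OF V] PcVs)
  have A1sA1: "A1s (A1 h) = h" for h
    unfolding A1_def
    by (simp add: bcl_add[OF A1s] bcl_diff[OF A1s] A1sV) (simp add: A1s_def shs_sh PcVs)
  have WWs: "W (Ws y) = y" for y
    by (simp add: W_def Ws_def bcl_simps[OF iota] bcl_simps[OF V] bcl_simps[OF Js] bcl_simps[OF A1]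
        iota_J Js_iotas JsJ A1A1s)
  have WsW: "Ws (W x) = P x" for x
  proof -
    have Vs1: "Vs (A1 h) = sh (Vs h)" for h
      by (simp add: A1_def bcl_add[OF Vs] bcl_diff[OF Vs] VsV PcVs Pc_sh)
    have "Ws (V (iota 0 x)) = Q x"
      by (simp add: Ws_def VsV iotas_Pc iotas_iota A1sV shs_iota bcl_zero[OF V] bcl_zero[OF J])
    moreover have "Ws (A1 h) = J h" for h
      by (simp add: Ws_def Vs1 iotas_sh A1sA1)
    moreover have "bounded_clinear Ws" using bcl_cadjoint[OF W] by (simp add: Ws)
    ultimately show ?thesis by (simp add: W_def bcl_add Q_def)
  qed
  have W_le: "norm (W x) \<le> norm x" for x
  proof -
    have "(norm (W x))\<^sup>2 = Re (cinner (P x) x)"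
      using cadjoint_left[OF W, of "W x" x] by (simp add: Re_cinner_self[symmetric] Ws WsW)
    also have "\<dots> = (norm (P x))\<^sup>2" using P_sa[of x "P x"] by (simp add: Re_cinner_self[symmetric] PP P_sa)
    also have "\<dots> \<le> (norm x)\<^sup>2"
    proof -
      have "(norm x)\<^sup>2 = (norm (P x + (x - P x)))\<^sup>2" by simp
      also have "\<dots> = (norm (P x))\<^sup>2 + (norm (x - P x))\<^sup>2"
        unfolding norm_add_sq by (simp add: P_sa bcl_diff[OF P] PP)
      finally show ?thesis by simp
    qed
    finally show ?thesis by (rule power2_le_imp_le) simp
  qed
  define B where "B x = T (V x) - V (A x)" for x
  \<comment> \<open>\<open>A1\<close> contains the adjoint of \<open>V\<close>, and moving
    \<open>T\<close> past that adjoint produces the adjoint of this second error. Hence the need to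
    almost intertwine the adjoints too.\<close>
  define B' where "B' x = cadjoint T (V x) - V (A' x)" for x
  have B: "small_compact (\<epsilon> / 5) B" unfolding B_def using sm(1) by (simp add: V_def)
  have B': "small_compact (\<epsilon> / 5) B'" unfolding B'_def using sm(2) by (simp add: V_def As)
  have TV: "T (V z) = B z + V (A z)" for z by (simp add: B_def)
  have B's: "cadjoint B' x = Vs (T x) - A (Vs x)" for x
  proof -
    have "cadjoint B' = (\<lambda>x. Vs (T x) - A (Vs x))"
    proof (rule cadjoint_eqI[OF small_compactD(2)[OF B']])
      fix x y
      have "cinner (B' y) x = cinner y (Vs (T x) - A (Vs x))"
        by (simp add: B'_def cinner_simps cadjoint_left[OF T] V_adj flip: As) (simp add: cadjoint_left[OF A(1)])
      then show "cinner (Vs (T x) - A (Vs x)) y = cinner x (B' y)" by (metis cinner_commute)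
    qed
    then show ?thesis by simp
  qed
  have VsT: "Vs (T x) = cadjoint B' x + A (Vs x)" for x by (simp add: B's)
  have A_iota: "A (iota 0 x) = iota 0 (S x)" for x
  proof (rule eq_on_u[OF bcl_compose[OF A(1) iota] bcl_compose[OF iota S]])
    show "A (iota 0 (u j)) = iota 0 (S (u j))" for j by (simp add: iota_u A(2))
    show "A (iota 0 x) = iota 0 (S x)" if "\<And>j. cinner x (u j) = 0" for x
      by (simp add: iota_perp[OF that] S_def Q_perp[OF that] bcl_zero[OF A(1)] bcl_zero[OF R] bcl_zero[OF iota])
  qed
  \<comment> \<open>The ampliation acts alike on all copies, so the shift commutes with it exactly;
    errors come only from \<open>V\<close> and its adjoint.\<close>
  have sh_A: "sh (A x) = A (sh x)" for x
    by (rule eq_on_c[OF bcl_compose[OF sh A(1)] bcl_compose[OF A(1) sh]])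
      (simp_all add: A(2) A(3) sh_cc sh_iota sh_perp bcl_zero[OF sh] bcl_zero[OF A(1)])
  have iota_S: "iota 0 (S x) = iota 0 (R x)" for x
    using iota_Q[of 0 "R x"] by (simp add: S_def QR)
  have diff: "T (W x) - W (R x) = B (iota 0 x) +
      ((- B (Vs (Js x)) + B (sh (Vs (Js x)))) + (V (cadjoint B' (Js x)) - V (sh (cadjoint B' (Js x)))))" for x
  proof -
    have 1: "T (V (iota 0 x)) - V (iota 0 (R x)) = B (iota 0 x)" by (simp add: TV A_iota iota_S)
    have 2: "T (A1 h) - A1 (T h) = (- B (Vs h) + B (sh (Vs h))) + (V (cadjoint B' h) - V (sh (cadjoint B' h)))" for h
      by (simp add: A1_def bcl_add[OF T] bcl_diff[OF T] TV VsT bcl_add[OF V] bcl_add[OF sh] sh_A)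
    have "T (W x) - W (R x) = (T (V (iota 0 x)) - V (iota 0 (R x))) + (T (A1 (Js x)) - A1 (T (Js x)))"
      by (simp add: W_def bcl_add[OF T] JsR)
    then show ?thesis unfolding 1 2 .
  qed
  note Bs = small_compact_cadjoint[OF B']
  have "small_compact (\<epsilon> / 5 + (((\<epsilon> / 5) + \<epsilon> / 5) + (\<epsilon> / 5 + \<epsilon> / 5)))
    (\<lambda>x. B (iota 0 x) +
      ((- B (Vs (Js x)) + B (sh (Vs (Js x)))) + (V (cadjoint B' (Js x)) - V (sh (cadjoint B' (Js x))))))"
  proof (intro small_compact_plus small_compact_minus small_compact_uminus)
    show "small_compact (\<epsilon> / 5) (\<lambda>x. B (iota 0 x))" by (rule small_compact_right[OF iota iota_le B])
    show "small_compact (\<epsilon> / 5) (\<lambda>x. B (Vs (Js x)))"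
      by (rule small_compact_right[OF bcl_compose[OF Vs Js] order_trans[OF Vs_le norm_Js] B])
    show "small_compact (\<epsilon> / 5) (\<lambda>x. B (sh (Vs (Js x))))"
      by (rule small_compact_right[OF bcl_compose[OF sh bcl_compose[OF Vs Js]] order_trans[OF sh_le order_trans[OF Vs_le norm_Js]] B])
    show "small_compact (\<epsilon> / 5) (\<lambda>x. V (cadjoint B' (Js x)))"
      by (rule small_compact_left[OF V V_le small_compact_right[OF Js norm_Js Bs]])
    show "small_compact (\<epsilon> / 5) (\<lambda>x. V (sh (cadjoint B' (Js x))))"
      by (rule small_compact_left[OF bcl_compose[OF V sh] order_trans[OF V_le sh_le] small_compact_right[OF Js norm_Js Bs]])
  qed
  then have "small_compact \<epsilon> (\<lambda>x. T (W x) - W (R x))" unfolding diff by simp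
  then show ?thesis using W W_le WsW WWs by (intro exI[of _ W]) (simp add: Ws)
qed

end

section \<open>Unitary equivalence of ultrapowers\<close>

lemma bseq_iff: "bseq X \<longleftrightarrow> (\<exists>K. \<forall>n. norm (X n) \<le> K)"
  by (auto simp: bseq_def bounded_iff)

lemma bseq_bcl:
  assumes T: "bounded_clinear T" and X: "bseq X" shows "bseq (\<lambda>n. T (X n))"
proof -
  obtain K where K: "K > 0" "\<And>x. norm (T x) \<le> K * norm x" by (rule bcl_bound[OF T]) blast
  obtain L where L: "\<And>n. norm (X n) \<le> L" using X by (auto simp: bseq_iff)
  have "norm (T (X n)) \<le> K * L" for n
    using K(2)[of "X n"] mult_left_mono[OF L[of n] less_imp_le[OF K(1)]] by linarith
  then show ?thesis by (auto simp: bseq_iff)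
qed

lemma bseq_diff:
  assumes X: "bseq X" and Y: "bseq Y" shows "bseq (\<lambda>n. X n - Y n)"
proof -
  obtain K where K: "\<And>n. norm (X n) \<le> K" using X by (auto simp: bseq_iff)
  obtain L where L: "\<And>n. norm (Y n) \<le> L" using Y by (auto simp: bseq_iff)
  have "norm (X n - Y n) \<le> K + L" for n
    using norm_triangle_ineq4[of "X n" "Y n"] K[of n] L[of n] by linarith
  then show ?thesis by (auto simp: bseq_iff)
qed

lemma bseq_const: "bseq (\<lambda>n. x)" by (auto simp: bseq_iff)

lemma unull_iff: "unull U X \<longleftrightarrow> (X \<longlongrightarrow> 0) U"
  by (simp add: unull_def tendsto_norm_zero_iff)

section \<open>Calculus of null sequences along the ultrafilter\<close>

lemma null_trans:
  fixes X Y Z :: "nat \<Rightarrow> 'b::real_normed_vector"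
  assumes "((\<lambda>n. X n - Y n) \<longlongrightarrow> 0) U" "((\<lambda>n. Y n - Z n) \<longlongrightarrow> 0) U"
  shows "((\<lambda>n. X n - Z n) \<longlongrightarrow> 0) U"
  using tendsto_add[OF assms] by simp

lemma null_sym:
  fixes X Y :: "nat \<Rightarrow> 'b::real_normed_vector"
  assumes "((\<lambda>n. X n - Y n) \<longlongrightarrow> 0) U" shows "((\<lambda>n. Y n - X n) \<longlongrightarrow> 0) U"
  using tendsto_minus[OF assms] by simp

lemma null_bcl:
  assumes T: "bounded_clinear T" and X: "((\<lambda>n. X n - Y n) \<longlongrightarrow> 0) U"
  shows "((\<lambda>n. T (X n) - T (Y n)) \<longlongrightarrow> 0) U"
  using bcl_tendsto[OF T X] by (simp add: bcl_diff[OF T] bcl_zero[OF T])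

lemma null_cinner_left:
  assumes X: "((\<lambda>n. X n - X' n) \<longlongrightarrow> 0) U" and Y: "bseq Y"
  shows "((\<lambda>n. cinner (X n) (Y n) - cinner (X' n) (Y n)) \<longlongrightarrow> 0) U"
proof -
  obtain K where K: "\<And>n. norm (Y n) \<le> K" using Y by (auto simp: bseq_iff)
  have "((\<lambda>n. cinner (X n - X' n) (Y n)) \<longlongrightarrow> 0) U"
    by (rule tendsto_0_le[OF X, where K=K], rule always_eventually, rule allI)
      (rule order_trans[OF cauchy_schwarz mult_left_mono[OF K norm_ge_zero]])
  then show ?thesis by (simp add: cinner_simps)
qed

lemma null_cinner_right:
  assumes X: "((\<lambda>n. X n - X' n) \<longlongrightarrow> 0) U" and Y: "bseq Y"
  shows "((\<lambda>n. cinner (Y n) (X n) - cinner (Y n) (X' n)) \<longlongrightarrow> 0) U"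
  using tendsto_cnj[OF null_cinner_left[OF X Y]] by (simp add: cinner_commute[symmetric])

lemma null_of_self_cinner:
  assumes "((\<lambda>n. cinner (X n) (X n)) \<longlongrightarrow> 0) U" shows "(X \<longlongrightarrow> 0) U"
proof -
  have "((\<lambda>n. sqrt (Re (cinner (X n) (X n)))) \<longlongrightarrow> sqrt (Re 0)) U"
    using assms by (intro tendsto_intros)
  then show ?thesis by (simp add: Re_cinner_self tendsto_norm_zero_iff)
qed

lemma limit_transfer:
  fixes X Y :: "nat \<Rightarrow> 'b::real_normed_vector"
  assumes "((\<lambda>n. X n - Y n) \<longlongrightarrow> 0) U" "(Y \<longlongrightarrow> l) U" shows "(X \<longlongrightarrow> l) U"
  using tendsto_add[OF assms] by simp

text \<open>Equalities of limits from the definition become null differences, which can be chained.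
  By \<open>swap\<close> the roles of \<open>T\<close>, \<open>F\<close> and \<open>T'\<close>,
  \<open>G\<close> may be exchanged, so each result is available for both operators.\<close>

locale ultra_intertwiner =
  fixes U :: "nat filter" and T T' :: "'a::chilbert \<Rightarrow> 'a" and F G :: "(nat \<Rightarrow> 'a) \<Rightarrow> nat \<Rightarrow> 'a"
  assumes T: "bounded_clinear T" and T': "bounded_clinear T'"
    and Fb: "\<And>X. bseq X \<Longrightarrow> bseq (F X)" and Gb: "\<And>X. bseq X \<Longrightarrow> bseq (G X)"
    and Fc: "\<And>X Y. bseq X \<Longrightarrow> bseq Y \<Longrightarrow> ((\<lambda>n. X n - Y n) \<longlongrightarrow> 0) U \<Longrightarrow> ((\<lambda>n. F X n - F Y n) \<longlongrightarrow> 0) U"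
    and Gc: "\<And>X Y. bseq X \<Longrightarrow> bseq Y \<Longrightarrow> ((\<lambda>n. X n - Y n) \<longlongrightarrow> 0) U \<Longrightarrow> ((\<lambda>n. G X n - G Y n) \<longlongrightarrow> 0) U"
    and adj: "\<And>X Y. bseq X \<Longrightarrow> bseq Y \<Longrightarrow> ((\<lambda>n. cinner (G X n) (Y n) - cinner (X n) (F Y n)) \<longlongrightarrow> 0) U"
    and GF: "\<And>X. bseq X \<Longrightarrow> ((\<lambda>n. G (F X) n - X n) \<longlongrightarrow> 0) U"
    and FG: "\<And>X. bseq X \<Longrightarrow> ((\<lambda>n. F (G X) n - X n) \<longlongrightarrow> 0) U"
    and intertwine: "\<And>X. bseq X \<Longrightarrow> ((\<lambda>n. T' (X n) - F (\<lambda>k. T (G X k)) n) \<longlongrightarrow> 0) U"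
begin

lemma G_isometric:
  assumes X: "bseq X" and Y: "bseq Y"
  shows "((\<lambda>n. cinner (G X n) (G Y n) - cinner (X n) (Y n)) \<longlongrightarrow> 0) U"
  by (rule null_trans[OF adj[OF X Gb[OF Y]] null_cinner_right[OF FG[OF Y] X]])

lemma TG:
  assumes X: "bseq X"
  shows "((\<lambda>n. T (G X n) - G (\<lambda>k. T' (X k)) n) \<longlongrightarrow> 0) U"
proof (rule null_sym)
  have TX: "bseq (\<lambda>k. T (G X k))" by (rule bseq_bcl[OF T Gb[OF X]])
  show "((\<lambda>n. G (\<lambda>k. T' (X k)) n - T (G X n)) \<longlongrightarrow> 0) U"
    by (rule null_trans[OF Gc[OF bseq_bcl[OF T' X] Fb[OF TX] intertwine[OF X]] GF[OF TX]])
qed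

lemma swap: "ultra_intertwiner U T' T G F"
proof
  fix X Y :: "nat \<Rightarrow> 'a" assume X: "bseq X" and Y: "bseq Y"
  show "((\<lambda>n. cinner (F X n) (Y n) - cinner (X n) (G Y n)) \<longlongrightarrow> 0) U"
    using null_sym[OF tendsto_cnj[OF adj[OF Y X], simplified]] by (simp add: cinner_commute[symmetric])
next
  fix X :: "nat \<Rightarrow> 'a" assume X: "bseq X"
  show "((\<lambda>n. T (X n) - G (\<lambda>k. T' (F X k)) n) \<longlongrightarrow> 0) U"
    by (rule null_trans[OF null_sym[OF null_bcl[OF T GF[OF X]]] TG[OF Fb[OF X]]])
qed (use T T' Fb Gb Fc Gc GF FG in auto)

text \<open>The given relation concerns the operators only, not their adjoints. The defect
  \<open>Z\<close> is paired with itself; moving the adjoints to the other side leaves the relation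
  \<open>TG\<close> of the swapped situation, applied to \<open>Z\<close>.\<close>

lemma adjoint_TG:
  assumes X: "bseq X"
  shows "((\<lambda>n. cadjoint T (G X n) - G (\<lambda>k. cadjoint T' (X k)) n) \<longlongrightarrow> 0) U"
proof (rule null_of_self_cinner)
  interpret s: ultra_intertwiner U T' T G F by (rule swap)
  define Z where "Z n = cadjoint T (G X n) - G (\<lambda>k. cadjoint T' (X k)) n" for n
  have TX: "bseq (\<lambda>k. cadjoint T' (X k))" by (rule bseq_bcl[OF bcl_cadjoint[OF T'] X])
  have Z: "bseq Z" unfolding Z_def
    by (rule bseq_diff[OF bseq_bcl[OF bcl_cadjoint[OF T] Gb[OF X]] Gb[OF TX]])
  have 1: "((\<lambda>n. cinner (G X n) (T (Z n)) - cinner (X n) (F (\<lambda>k. T (Z k)) n)) \<longlongrightarrow> 0) U"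
    by (rule adj[OF X bseq_bcl[OF T Z]])
  have 2: "((\<lambda>n. cinner (X n) (F (\<lambda>k. T (Z k)) n) - cinner (X n) (T' (F Z n))) \<longlongrightarrow> 0) U"
    by (rule null_cinner_right[OF null_sym[OF s.TG[OF Z]] X])
  have 3: "((\<lambda>n. cinner (cadjoint T' (X n)) (F Z n) - cinner (G (\<lambda>k. cadjoint T' (X k)) n) (Z n)) \<longlongrightarrow> 0) U"
    by (rule null_sym[OF adj[OF TX Z]])
  have "((\<lambda>n. cinner (G X n) (T (Z n)) - cinner (G (\<lambda>k. cadjoint T' (X k)) n) (Z n)) \<longlongrightarrow> 0) U"
    using null_trans[OF null_trans[OF 1 2]] 3 by (simp add: cadjoint_left[OF T'])
  then show "((\<lambda>n. cinner (cadjoint T (G X n) - G (\<lambda>k. cadjoint T' (X k)) n) (cadjoint T (G X n) - G (\<lambda>k. cadjoint T' (X k)) n)) \<longlongrightarrow> 0) U"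
    unfolding Z_def[symmetric] by (simp add: Z_def cinner_diff_left cadjoint_left[OF T])
qed

lemma G_const_dist: "((\<lambda>n. norm (G (\<lambda>k. x) n - G (\<lambda>k. y) n)) \<longlongrightarrow> norm (x - y)) U"
proof -
  have a: "((\<lambda>n. cinner (G (\<lambda>k. p) n) (G (\<lambda>k. q) n)) \<longlongrightarrow> cinner p q) U" for p q
    by (rule limit_transfer[OF G_isometric[OF bseq_const bseq_const] tendsto_const])
  have "((\<lambda>n. sqrt (Re (cinner (G (\<lambda>k. x) n - G (\<lambda>k. y) n) (G (\<lambda>k. x) n - G (\<lambda>k. y) n)))) \<longlongrightarrow> sqrt (Re (cinner (x - y) (x - y)))) U"
    unfolding cinner_diff_left cinner_diff_right by (intro tendsto_intros a)
  then show ?thesis unfolding Re_cinner_self by simp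
qed

end

text \<open>Shaped for families involving \<open>G\<close>, which respects distances only in the
  limit: the Lipschitz bound carries an error \<open>\<delta>\<close> and is required along
  \<open>U\<close>.\<close>

lemma null_on_dense:
  fixes E :: "'a::chilbert \<Rightarrow> nat \<Rightarrow> 'b::real_normed_vector"
  assumes dense: "closure (range d) = UNIV" and d: "\<And>j. (E (d j) \<longlongrightarrow> 0) U"
    and lip: "\<And>x y \<delta>. 0 < \<delta> \<Longrightarrow> eventually (\<lambda>n. norm (E x n - E y n) \<le> K * norm (x - y) + \<delta>) U"
  shows "(E x \<longlongrightarrow> 0) U"
  unfolding tendsto_iff dist_norm diff_0_right
proof (intro allI impI)
  fix e :: real assume e: "0 < e"
  define K' where "K' = \<bar>K\<bar> + 1"
  have K': "0 < K'" "K \<le> K'" by (auto simp: K'_def)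
  have "x \<in> closure (range d)" using dense by simp
  moreover have "0 < e / (3 * K')" using e K'(1) by simp
  ultimately obtain j where "dist (d j) x < e / (3 * K')" unfolding closure_approachable by blast
  then have j: "norm (x - d j) < e / (3 * K')" by (simp add: dist_norm norm_minus_commute)
  have "K * norm (x - d j) \<le> K' * norm (x - d j)" by (rule mult_right_mono[OF K'(2)]) simp
  also have "\<dots> \<le> K' * (e / (3 * K'))" using j K'(1) by (intro mult_left_mono) auto
  also have "\<dots> = e / 3" using K'(1) by simp
  finally have b: "K * norm (x - d j) \<le> e / 3" .
  have "eventually (\<lambda>n. norm (E x n - E (d j) n) \<le> K * norm (x - d j) + e / 4) U"
    using e by (intro lip) simp
  moreover have "eventually (\<lambda>n. norm (E (d j) n) < e / 4) U"
    by (rule order_tendstoD(2)[OF tendsto_norm[OF d[of j]]]) (use e in simp)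
  ultimately show "eventually (\<lambda>n. norm (E x n) < e) U"
  proof eventually_elim
    case (elim n)
    then show ?case using norm_triangle_ineq[of "E x n - E (d j) n" "E (d j) n"] b e by simp
  qed
qed

text \<open>Let \<open>N\<close> be the weak limit of the adjoint of \<open>A n\<close> composed
  with \<open>A n\<close>; the sequence \<open>A n x\<close> is null once \<open>N x = 0\<close>. As
  \<open>N\<close> vanishes on the \<open>v i\<close> and on their complement, it is 0.\<close>

lemma null_on_span:
  fixes A :: "nat \<Rightarrow> 'a::chilbert \<Rightarrow> 'a"
  assumes U: "free_ultrafilter U" and A: "\<And>n. bounded_clinear (A n)" and K: "\<And>n x. norm (A n x) \<le> K * norm x" "0 \<le> K"
    and v: "\<And>i. ((\<lambda>n. A n (v i)) \<longlongrightarrow> 0) U"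
    and perp: "\<And>x. (\<And>i. cinner x (v i) = 0) \<Longrightarrow> ((\<lambda>n. A n x) \<longlongrightarrow> 0) U"
  shows "((\<lambda>n. A n x) \<longlongrightarrow> 0) U"
proof -
  have nb: "U \<noteq> bot" using U by (simp add: free_ultrafilter_def)
  obtain N where N: "bounded_clinear N" "\<And>x y. ((\<lambda>n. cinner (cadjoint (A n) (A n x)) y) \<longlongrightarrow> cinner (N x) y) U"
  proof (rule weak_ultralimit[OF U, of "\<lambda>n x. cadjoint (A n) (A n x)" "K * K"])
    show "bounded_clinear (\<lambda>x. cadjoint (A n) (A n x))" for n by (rule bcl_compose[OF bcl_cadjoint[OF A] A])
    show "norm (cadjoint (A n) (A n x)) \<le> K * K * norm x" for n x
      using order_trans[OF cadjoint_norm_bound[OF A K] mult_left_mono[OF K(1) K(2)]] by (simp add: mult.assoc)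
  qed blast
  have N': "((\<lambda>n. cinner (A n x) (A n y)) \<longlongrightarrow> cinner (N x) y) U" for x y
    using N(2)[of x y] by (simp add: cadjoint_left[OF A])
  have z: "N x = 0" if "((\<lambda>n. A n x) \<longlongrightarrow> 0) U" for x
  proof (rule cinner_eqI)
    fix y
    have "bseq (\<lambda>n. A n y)" using K(1)[of _ y] by (auto simp: bseq_iff)
    from null_cinner_left[of "\<lambda>n. A n x" "\<lambda>n. 0", OF _ this] that
    have "((\<lambda>n. cinner (A n x) (A n y)) \<longlongrightarrow> 0) U" by simp
    then show "cinner (N x) y = cinner 0 y" using tendsto_unique[OF nb N'] by simp
  qed
  have "N x = 0"
    by (rule eq_on_basis[where u=v, OF N(1) bcl_0]) (use z v perp in auto)
  then show ?thesis using N'[of x x] by (intro null_of_self_cinner) simp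
qed

text \<open>Polarisation: \<open>norm_add_sq\<close> gives real parts, and replacing
  \<open>x\<close> by its multiple with \<open>\<i>\<close> gives imaginary parts.\<close>

lemma isometry_cinner:
  assumes J: "bounded_clinear J" and n: "\<And>x. norm (J x) = norm x"
  shows "cinner (J x) (J y) = cinner x y"
proof -
  have re: "Re (cinner (J x) (J y)) = Re (cinner x y)" for x y
    using norm_add_sq[of "J x" "J y"] norm_add_sq[of x y] by (simp add: n flip: bcl_add[OF J])
  show ?thesis
  proof (rule complex_eqI[OF re])
    show "Im (cinner (J x) (J y)) = Im (cinner x y)"
      using re[of "scaleC \<i> x" y] by (simp add: bcl_scaleC[OF J] cinner_simps)
  qed
qed

lemma bcl_eq_on_dense:
  assumes A: "bounded_clinear A" and B: "bounded_clinear B"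
    and dense: "closure (range d) = UNIV" and d: "\<And>j. A (d j) = B (d j)"
  shows "A x = B x"
proof -
  have "closure (range d) \<subseteq> {x. A x = B x}"
    by (rule closure_minimal)
      (auto simp: d intro!: closed_Collect_eq linear_continuous_on bcl_bounded_linear A B)
  then show ?thesis using dense by auto
qed

text \<open>\<open>J x\<close> is the vector of \<open>K\<close> standing for the constant sequence
  \<open>x\<close>. The adjoints of the \<open>\<Phi> n\<close> send constants weakly to their
  projection to \<open>K\<close>; for \<open>x = d j\<close> nothing is lost because
  \<open>v (s j)\<close> already lifts to it, and density covers the rest.\<close>

lemma lift_isometry:
  fixes \<Phi> :: "nat \<Rightarrow> 'a::chilbert \<Rightarrow> 'a"
  assumes U: "free_ultrafilter U"
    and \<Phi>: "\<And>n. bounded_clinear (\<Phi> n)" and \<Phi>_le: "\<And>n x. norm (\<Phi> n x) \<le> norm x"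
    and gram: "\<And>x y. ((\<lambda>n. cinner (\<Phi> n x) (\<Phi> n y)) \<longlongrightarrow> cinner (P x) y) U"
    and P: "bounded_clinear P" and Pv: "\<And>i. P (v i) = v i"
    and dense: "closure (range d) = UNIV"
    and d: "\<And>j. ((\<lambda>n. \<Phi> n (v (s j)) - d j) \<longlongrightarrow> 0) U"
  obtains J where "bounded_clinear J" "\<And>j. J (d j) = v (s j)" "\<And>x y. cinner (J x) (J y) = cinner x y"
    "\<And>x. ((\<lambda>n. \<Phi> n (J x) - x) \<longlongrightarrow> 0) U" "\<And>x. P (J x) = J x"
proof -
  have nb: "U \<noteq> bot" using U by (simp add: free_ultrafilter_def)
  obtain J where J: "bounded_clinear J" "\<And>x y. ((\<lambda>n. cinner (cadjoint (\<Phi> n) x) y) \<longlongrightarrow> cinner (J x) y) U"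
  proof (rule weak_ultralimit[OF U, of "\<lambda>n. cadjoint (\<Phi> n)" 1])
    show "norm (cadjoint (\<Phi> n) x) \<le> 1 * norm x" for n x
      by (rule cadjoint_norm_bound[OF \<Phi>]) (simp_all add: \<Phi>_le)
  qed (auto intro: bcl_cadjoint \<Phi>)
  have Jl: "((\<lambda>n. cinner x (\<Phi> n y)) \<longlongrightarrow> cinner (J x) y) U" for x y
    using J(2)[of x y] by (simp add: cadjoint_left[OF \<Phi>])
  have \<Phi>b: "bseq (\<lambda>n. \<Phi> n y)" for y using \<Phi>_le[of _ y] by (auto simp: bseq_iff)
  have Jd: "J (d j) = v (s j)" for j
  proof (rule cinner_eqI)
    fix y
    have "((\<lambda>n. cinner (\<Phi> n (v (s j))) (\<Phi> n y)) \<longlongrightarrow> cinner (J (d j)) y) U"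
      by (rule limit_transfer[OF null_cinner_left[OF d \<Phi>b] Jl])
    then show "cinner (J (d j)) y = cinner (v (s j)) y"
      using tendsto_unique[OF nb _ gram[of "v (s j)" y]] by (simp add: Pv)
  qed
  have "norm (J (d j)) = norm (d j)" for j
  proof (rule norm_eqI_cinner)
    have t: "((\<lambda>n. \<Phi> n (v (s j))) \<longlongrightarrow> d j) U" using d[of j] by (simp add: LIM_zero_iff)
    show "cinner (J (d j)) (J (d j)) = cinner (d j) (d j)"
      using tendsto_unique[OF nb gram[of "v (s j)" "v (s j)"] tendsto_cinner[OF t t]] by (simp add: Jd Pv)
  qed
  then have "closure (range d) \<subseteq> {x. norm (J x) = norm x}"
    by (intro closure_minimal closed_Collect_eq continuous_on_norm linear_continuous_on bcl_bounded_linear[OF J(1)])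
      (auto intro: continuous_intros)
  then have nJ: "norm (J x) = norm x" for x using dense by auto
  have \<Phi>J: "((\<lambda>n. \<Phi> n (J x) - x) \<longlongrightarrow> 0) U" for x
  proof (rule null_on_dense[OF dense, where K=2])
    show "((\<lambda>n. \<Phi> n (J (d j)) - d j) \<longlongrightarrow> 0) U" for j using d by (simp add: Jd)
    fix x y and \<delta> :: real assume \<delta>: "0 < \<delta>"
    have "norm (\<Phi> n (J x) - x - (\<Phi> n (J y) - y)) \<le> 2 * norm (x - y) + \<delta>" for n
    proof -
      have "\<Phi> n (J x) - x - (\<Phi> n (J y) - y) = \<Phi> n (J (x - y)) - (x - y)"
        by (simp add: bcl_diff[OF \<Phi>] bcl_diff[OF J(1)])
      also have "norm \<dots> \<le> norm (\<Phi> n (J (x - y))) + norm (x - y)" by (rule norm_triangle_ineq4)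
      finally show ?thesis using \<Phi>_le[of n "J (x - y)"] \<delta> unfolding nJ by linarith
    qed
    then show "eventually (\<lambda>n. norm (\<Phi> n (J x) - x - (\<Phi> n (J y) - y)) \<le> 2 * norm (x - y) + \<delta>) U"
      by (intro always_eventually) blast
  qed
  have "P (J x) = J x" for x
    by (rule bcl_eq_on_dense[OF bcl_compose[OF P J(1)] J(1) dense]) (simp add: Jd Pv)
  then show ?thesis using that J(1) Jd isometry_cinner[OF J(1) nJ] \<Phi>J by blast
qed

text \<open>\<open>W1\<close> and \<open>W2\<close> carry the range of \<open>P\<close> unitarily
  onto H and take \<open>R\<close> to \<open>T1\<close> and \<open>T2\<close> up to errors. So
  \<open>W2\<close> composed with the adjoint of \<open>W1\<close> is unitary, and the two errors
  add up.\<close>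

lemma approx_unitary_of_absorbers:
  assumes T1: "bounded_clinear T1" and T2: "bounded_clinear T2" and PR: "\<And>x. P (R x) = R x"
    and W1: "bounded_clinear W1" "\<And>x. norm (W1 x) \<le> norm x" "\<And>x. cadjoint W1 (W1 x) = P x" "\<And>y. W1 (cadjoint W1 y) = y"
      "small_compact \<epsilon> (\<lambda>x. T1 (W1 x) - W1 (R x))"
    and W2: "bounded_clinear W2" "\<And>x. norm (W2 x) \<le> norm x" "\<And>x. cadjoint W2 (W2 x) = P x" "\<And>y. W2 (cadjoint W2 y) = y"
      "small_compact \<epsilon> (\<lambda>x. T2 (W2 x) - W2 (R x))"
  shows "\<exists>W. unitary_op W \<and> small_compact (\<epsilon> + \<epsilon>) (\<lambda>x. T2 x - W (T1 (cadjoint W x)))"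
proof -
  have P1: "W1 (P x) = W1 x" and P2: "W2 (P x) = W2 x" for x
    using W1(4)[of "W1 x"] W2(4)[of "W2 x"] by (simp_all add: W1(3) W2(3))
  define W where "W x = W2 (cadjoint W1 x)" for x
  have W: "bounded_clinear W" unfolding W_def by (rule bcl_compose[OF W2(1) bcl_cadjoint[OF W1(1)]])
  have Ws: "cadjoint W = (\<lambda>x. W1 (cadjoint W2 x))"
    by (rule cadjoint_eqI[OF W]) (simp add: W_def cadjoint_right[OF W1(1), symmetric] cadjoint_left[OF W2(1)])
  have "unitary_op W"
    unfolding unitary_op_def
  proof (intro conjI exI[of _ "cadjoint W"])
    show "cadjoint W \<circ> W = id" unfolding Ws by (auto simp: W_def W2(3) P1 W1(4))
    show "W \<circ> cadjoint W = id" unfolding Ws by (auto simp: W_def W1(3) P2 W2(4))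
  qed (use W is_cadjoint_cadjoint in auto)
  moreover have "small_compact (\<epsilon> + \<epsilon>) (\<lambda>x. T2 x - W (T1 (cadjoint W x)))"
  proof -
    define D1 where "D1 x = T1 (W1 x) - W1 (R x)" for x
    define D2 where "D2 x = T2 (W2 x) - W2 (R x)" for x
    have D: "small_compact \<epsilon> D1" "small_compact \<epsilon> D2" using W1(5) W2(5) unfolding D1_def D2_def .
    have le1: "norm (cadjoint W1 x) \<le> norm x" for x using cadjoint_norm_bound[OF W1(1), of 1 x] W1(2) by simp
    have le2: "norm (cadjoint W2 x) \<le> norm x" for x using cadjoint_norm_bound[OF W2(1), of 1 x] W2(2) by simp
    have leW: "norm (W x) \<le> norm x" for x unfolding W_def by (rule order_trans[OF W2(2) le1])
    have e: "T2 x - W (T1 (cadjoint W x)) = D2 (cadjoint W2 x) - W (D1 (cadjoint W2 x))" for x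
      by (simp add: D1_def D2_def Ws bcl_diff[OF W] W2(4)) (simp add: W_def W1(3) PR)
    show ?thesis unfolding e
      by (intro small_compact_minus small_compact_right[OF bcl_cadjoint[OF W2(1)] le2 D(2)]
          small_compact_left[OF W leW small_compact_right[OF bcl_cadjoint[OF W2(1)] le2 D(1)]])
  qed
  ultimately show ?thesis by blast
qed

section \<open>Lifting the intertwining relations\<close>

context ultra_intertwiner
begin

lemma adjoint_intertwiner: "ultra_intertwiner U (cadjoint T) (cadjoint T') F G"
proof
  fix X :: "nat \<Rightarrow> 'a" assume X: "bseq X"
  have 1: "bseq (\<lambda>k. cadjoint T' (X k))" by (rule bseq_bcl[OF bcl_cadjoint[OF T'] X])
  have 2: "bseq (\<lambda>k. cadjoint T (G X k))" by (rule bseq_bcl[OF bcl_cadjoint[OF T] Gb[OF X]])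
  show "((\<lambda>n. cadjoint T' (X n) - F (\<lambda>k. cadjoint T (G X k)) n) \<longlongrightarrow> 0) U"
    by (rule null_sym[OF null_trans[OF Fc[OF 2 Gb[OF 1] adjoint_TG[OF X]] FG[OF 1]]])
qed (use bcl_cadjoint[OF T] bcl_cadjoint[OF T'] Fb Gb Fc Gc adj GF FG in auto)

text \<open>\<open>G_const_dist\<close> supplies the Lipschitz bound that carries the relation from
  the \<open>d j\<close> to all vectors. It identifies \<open>J' y\<close> as the vector standing
  for the image of the constant \<open>y\<close> under \<open>G\<close>.\<close>

lemma lift_G:
  assumes \<Phi>: "\<And>n. bounded_clinear (\<Phi> n)" and \<Phi>_le: "\<And>n x. norm (\<Phi> n x) \<le> norm x"
    and J': "bounded_clinear J'" "\<And>x y. cinner (J' x) (J' y) = cinner x y"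
    and dense: "closure (range d) = UNIV" and d: "\<And>j. ((\<lambda>n. \<Phi> n (J' (d j)) - G (\<lambda>k. d j) n) \<longlongrightarrow> 0) U"
  shows "((\<lambda>n. \<Phi> n (J' y) - G (\<lambda>k. y) n) \<longlongrightarrow> 0) U"
proof (rule null_on_dense[where E="\<lambda>y n. \<Phi> n (J' y) - G (\<lambda>k. y) n" and K=2, OF dense d])
  fix x y and \<delta> :: real assume "0 < \<delta>"
  then have "eventually (\<lambda>n. norm (G (\<lambda>k. x) n - G (\<lambda>k. y) n) < norm (x - y) + \<delta>) U"
    by (intro order_tendstoD(2)[OF G_const_dist]) simp
  then show "eventually (\<lambda>n. norm (\<Phi> n (J' x) - G (\<lambda>k. x) n - (\<Phi> n (J' y) - G (\<lambda>k. y) n)) \<le> 2 * norm (x - y) + \<delta>) U"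
  proof eventually_elim
    case (elim n)
    have "\<Phi> n (J' x) - G (\<lambda>k. x) n - (\<Phi> n (J' y) - G (\<lambda>k. y) n) = \<Phi> n (J' (x - y)) - (G (\<lambda>k. x) n - G (\<lambda>k. y) n)"
      by (simp add: bcl_diff[OF \<Phi>] bcl_diff[OF J'(1)])
    also have "norm \<dots> \<le> norm (\<Phi> n (J' (x - y))) + norm (G (\<lambda>k. x) n - G (\<lambda>k. y) n)" by (rule norm_triangle_ineq4)
    finally show ?case using elim \<Phi>_le[of n "J' (x - y)"] norm_eqI_cinner[OF J'(2)[of "x - y" "x - y"]] by linarith
  qed
qed

lemma lift_intertwines:
  assumes \<Phi>J: "\<And>x. ((\<lambda>n. \<Phi> n (J x) - x) \<longlongrightarrow> 0) U"
    and \<Phi>J': "\<And>y. ((\<lambda>n. \<Phi> n (J' y) - G (\<lambda>k. y) n) \<longlongrightarrow> 0) U"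
  shows "((\<lambda>n. T (\<Phi> n (J x)) - \<Phi> n (J (T x))) \<longlongrightarrow> 0) U"
    and "((\<lambda>n. T (\<Phi> n (J' x)) - \<Phi> n (J' (T' x))) \<longlongrightarrow> 0) U"
proof -
  show "((\<lambda>n. T (\<Phi> n (J x)) - \<Phi> n (J (T x))) \<longlongrightarrow> 0) U"
    by (rule null_trans[OF null_bcl[OF T \<Phi>J] null_sym[OF \<Phi>J]])
  show "((\<lambda>n. T (\<Phi> n (J' x)) - \<Phi> n (J' (T' x))) \<longlongrightarrow> 0) U"
    by (rule null_trans[OF null_trans[OF null_bcl[OF T \<Phi>J'] TG[OF bseq_const]] null_sym[OF \<Phi>J']])
qed

text \<open>The relation holds on the ranges of \<open>J\<close> and \<open>J'\<close>, which
  contain all \<open>v i\<close>, while on vectors orthogonal to the \<open>v i\<close> both terms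
  are null. \<open>null_on_span\<close> joins the two cases.\<close>

lemma lift_defect:
  assumes U: "free_ultrafilter U" and \<Phi>: "\<And>n. bounded_clinear (\<Phi> n)" and \<Phi>_le: "\<And>n x. norm (\<Phi> n x) \<le> norm x"
    and \<Phi>J: "\<And>x. ((\<lambda>n. \<Phi> n (J x) - x) \<longlongrightarrow> 0) U"
    and \<Phi>J': "\<And>y. ((\<lambda>n. \<Phi> n (J' y) - G (\<lambda>k. y) n) \<longlongrightarrow> 0) U"
    and B: "bounded_clinear B" "\<And>x. B (J x) = J (T x)" "\<And>x. B (J' x) = J' (T' x)"
    and v: "\<And>i. v i \<in> range J \<union> range J'"
    and perp: "\<And>x. (\<And>i. cinner x (v i) = 0) \<Longrightarrow> B x = 0 \<and> ((\<lambda>n. \<Phi> n x) \<longlongrightarrow> 0) U"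
  shows "((\<lambda>n. T (\<Phi> n x) - \<Phi> n (B x)) \<longlongrightarrow> 0) U"
proof -
  obtain K where K: "K > 0" "\<And>x. norm (T x) \<le> K * norm x" by (rule bcl_bound[OF T]) blast
  obtain L where L: "L > 0" "\<And>x. norm (B x) \<le> L * norm x" by (rule bcl_bound[OF B(1)]) blast
  show ?thesis
  proof (rule null_on_span[OF U, of "\<lambda>n x. T (\<Phi> n x) - \<Phi> n (B x)" "K + L" v])
    show "bounded_clinear (\<lambda>x. T (\<Phi> n x) - \<Phi> n (B x))" for n
      by (rule bcl_minus_fun[OF bcl_compose[OF T \<Phi>] bcl_compose[OF \<Phi> B(1)]])
    show "norm (T (\<Phi> n x) - \<Phi> n (B x)) \<le> (K + L) * norm x" for n x
    proof -
      have "norm (T (\<Phi> n x)) \<le> K * norm x"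
        using order_trans[OF K(2) mult_left_mono[OF \<Phi>_le less_imp_le[OF K(1)]]] .
      moreover have "norm (\<Phi> n (B x)) \<le> L * norm x" by (rule order_trans[OF \<Phi>_le L(2)])
      ultimately show ?thesis using norm_triangle_ineq4[of "T (\<Phi> n x)" "\<Phi> n (B x)"] by (simp add: distrib_right)
    qed
    show "0 \<le> K + L" using K L by simp
    show "((\<lambda>n. T (\<Phi> n (v i)) - \<Phi> n (B (v i))) \<longlongrightarrow> 0) U" for i
      using v[of i] lift_intertwines[of \<Phi> J J', OF \<Phi>J \<Phi>J'] by (auto simp: B)
    show "((\<lambda>n. T (\<Phi> n x) - \<Phi> n (B x)) \<longlongrightarrow> 0) U" if "\<And>i. cinner x (v i) = 0" for x
      using perp[OF that] bcl_tendsto[OF T, of "\<lambda>n. \<Phi> n x" 0 U] by (simp add: bcl_zero[OF T] bcl_zero[OF \<Phi>])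
  qed
qed

end

lemma ultra_bounded_clinearD:
  assumes "ultra_bounded_clinear U F"
  shows "bseq X \<Longrightarrow> bseq (F X)"
    and "bseq X \<Longrightarrow> bseq Y \<Longrightarrow> unull U (\<lambda>n. X n - Y n) \<Longrightarrow> unull U (\<lambda>n. F X n - F Y n)"
  using assms unfolding ultra_bounded_clinear_def by simp_all

lemma ultra_unitarily_equivalentD:
  assumes U: "free_ultrafilter U" and T1: "bounded_clinear T1" and T2: "bounded_clinear T2"
    and eq: "ultra_unitarily_equivalent U T1 T2"
  obtains F G where "ultra_intertwiner U T1 T2 F G"
proof -
  have nb: "U \<noteq> bot" using U by (simp add: free_ultrafilter_def)
  obtain F G where *: "ultra_bounded_clinear U F \<and> ultra_bounded_clinear U G \<and>
      (\<forall>X Y. bseq X \<and> bseq Y \<longrightarrow>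
          ulim U (\<lambda>n. cinner (G X n) (Y n)) = ulim U (\<lambda>n. cinner (X n) (F Y n))) \<and>
      (\<forall>X. bseq X \<longrightarrow> unull U (\<lambda>n. G (F X) n - X n)) \<and>
      (\<forall>X. bseq X \<longrightarrow> unull U (\<lambda>n. F (G X) n - X n)) \<and>
      (\<forall>X. bseq X \<longrightarrow> unull U (\<lambda>n. uop T2 X n - F (uop T1 (G X)) n))"
    using eq unfolding ultra_unitarily_equivalent_def by (elim exE)
  then have F: "ultra_bounded_clinear U F" and G: "ultra_bounded_clinear U G"
    and adj: "\<And>X Y. bseq X \<Longrightarrow> bseq Y \<Longrightarrow> ulim U (\<lambda>n. cinner (G X n) (Y n)) = ulim U (\<lambda>n. cinner (X n) (F Y n))"
    and GF: "\<And>X. bseq X \<Longrightarrow> unull U (\<lambda>n. G (F X) n - X n)"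
    and FG: "\<And>X. bseq X \<Longrightarrow> unull U (\<lambda>n. F (G X) n - X n)"
    and int: "\<And>X. bseq X \<Longrightarrow> unull U (\<lambda>n. uop T2 X n - F (uop T1 (G X)) n)"
    by simp_all
  \<comment> \<open>\<open>ulim\<close> is \<open>Lim\<close> and carries information only where a
    limit exists; boundedness and the ultrafilter property ensure that.\<close>
  have lim: "((\<lambda>n. cinner (X n) (Y n)) \<longlongrightarrow> ulim U (\<lambda>n. cinner (X n) (Y n))) U"
    if X: "bseq X" and Y: "bseq Y" for X Y :: "nat \<Rightarrow> 'a"
  proof -
    obtain K where K: "\<And>n. norm (X n) \<le> K" using X by (auto simp: bseq_iff)
    obtain L where L: "\<And>n. norm (Y n) \<le> L" using Y by (auto simp: bseq_iff)
    have "cmod (cinner (X n) (Y n)) \<le> K * L" for n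
      using order_trans[OF cauchy_schwarz mult_mono[OF K L order_trans[OF norm_ge_zero K] norm_ge_zero]] .
    then obtain l where l: "((\<lambda>n. cinner (X n) (Y n)) \<longlongrightarrow> l) U"
      by (rule_tac ultrafilter_limit[OF U, of "\<lambda>n. cinner (X n) (Y n)" "K * L"]) auto
    then show ?thesis unfolding ulim_def using tendsto_Lim[OF nb l] by simp
  qed
  have Fb: "bseq (F X)" and Gb: "bseq (G X)" if "bseq X" for X
    using that ultra_bounded_clinearD(1)[OF F] ultra_bounded_clinearD(1)[OF G] by auto
  have "ultra_intertwiner U T1 T2 F G"
  proof
    fix X Y :: "nat \<Rightarrow> 'a" assume X: "bseq X" and Y: "bseq Y"
    show "((\<lambda>n. cinner (G X n) (Y n) - cinner (X n) (F Y n)) \<longlongrightarrow> 0) U"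
      using tendsto_diff[OF lim[OF Gb[OF X] Y] lim[OF X Fb[OF Y]]] adj[OF X Y] by simp
    assume XY: "((\<lambda>n. X n - Y n) \<longlongrightarrow> 0) U"
    show "((\<lambda>n. F X n - F Y n) \<longlongrightarrow> 0) U" "((\<lambda>n. G X n - G Y n) \<longlongrightarrow> 0) U"
      using ultra_bounded_clinearD(2)[OF F X Y] ultra_bounded_clinearD(2)[OF G X Y] XY by (simp_all add: unull_iff)
  next
    fix X :: "nat \<Rightarrow> 'a" assume X: "bseq X"
    show "((\<lambda>n. T2 (X n) - F (\<lambda>k. T1 (G X k)) n) \<longlongrightarrow> 0) U"
      using int[OF X] by (simp add: uop_def unull_iff)
    show "((\<lambda>n. G (F X) n - X n) \<longlongrightarrow> 0) U" "((\<lambda>n. F (G X) n - X n) \<longlongrightarrow> 0) U"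
      using GF[OF X] FG[OF X] by (simp_all add: unull_iff)
  qed (fact T1 T2 Fb Gb)+
  then show ?thesis by (rule that)
qed

text \<open>The same vectors \<open>v i\<close> represent the sequences \<open>X i\<close> and,
  because the unitary preserves inner products, their images under \<open>F\<close>. In the first
  picture the even \<open>v i\<close> stand for constants, in the second the odd ones. Thus one pair
  \<open>P\<close>, \<open>R\<close> serves \<open>T1\<close> through \<open>\<Phi>\<close> and
  \<open>T2\<close> through \<open>\<Psi>\<close>.\<close>

lemma absorbers_of_intertwiner:
  fixes T1 T2 :: "'a::chilbert \<Rightarrow> 'a" and b d :: "nat \<Rightarrow> 'a"
  assumes U: "free_ultrafilter U" and I: "ultra_intertwiner U T1 T2 F G"
    and dense: "closure (range d) = UNIV"
    and b: "ortho_family b" "\<And>i. norm (b i) = 1"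
  obtains P R J1 J2 :: "'a \<Rightarrow> 'a" and \<Phi> \<Psi> :: "nat \<Rightarrow> 'a \<Rightarrow> 'a"
  where "absorption U T1 R P J1 \<Phi> d b" "absorption U T2 R P J2 \<Psi> d b"
proof -
  interpret s: ultra_intertwiner U T1 T2 F G by (rule I)
  interpret r: ultra_intertwiner U T2 T1 G F by (rule s.swap)
  interpret sa: ultra_intertwiner U "cadjoint T1" "cadjoint T2" F G by (rule s.adjoint_intertwiner)
  interpret ra: ultra_intertwiner U "cadjoint T2" "cadjoint T1" G F by (rule r.adjoint_intertwiner)
  note T1 = s.T and T2 = s.T'
  have nb: "U \<noteq> bot" using U by (simp add: free_ultrafilter_def)
  \<comment> \<open>Interleaves a dense sequence of constants with its image under \<open>G\<close>,
    the adjoint of the unitary.\<close>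
  define X where "X i = (if even i then (\<lambda>n. d (i div 2)) else G (\<lambda>n. d (i div 2)))" for i
  have Xb: "bseq (X i)" for i unfolding X_def by (simp add: bseq_const s.Gb)
  then obtain K where K: "\<And>i n. norm (X i n) \<le> K i" unfolding bseq_iff by metis
  obtain v :: "nat \<Rightarrow> 'a" where v: "\<And>i j. ((\<lambda>n. cinner (X i n) (X j n)) \<longlongrightarrow> cinner (v i) (v j)) U"
    by (rule gram_realization[OF U b, of X K, OF K]) blast
  have v': "((\<lambda>n. cinner (F (X i) n) (F (X j) n)) \<longlongrightarrow> cinner (v i) (v j)) U" for i j
    by (rule limit_transfer[OF r.G_isometric[OF Xb Xb] v])
  define P where "P = theta U (gs v) (gs v)"
  note gv = ortho_family_gs[of v]
  obtain \<Phi> where \<Phi>: "\<And>n. bounded_clinear (\<Phi> n)" "\<And>n x. norm (\<Phi> n x) \<le> norm x"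
    "\<And>i. ((\<lambda>n. \<Phi> n (v i) - X i n) \<longlongrightarrow> 0) U"
    "\<And>x y. ((\<lambda>n. cinner (\<Phi> n x) (\<Phi> n y)) \<longlongrightarrow> cinner (P x) y) U"
    by (rule lift_to_ultrapower[OF U, of X v, OF v, folded P_def]) blast
  obtain \<Psi> where \<Psi>: "\<And>n. bounded_clinear (\<Psi> n)" "\<And>n x. norm (\<Psi> n x) \<le> norm x"
    "\<And>i. ((\<lambda>n. \<Psi> n (v i) - F (X i) n) \<longlongrightarrow> 0) U"
    "\<And>x y. ((\<lambda>n. cinner (\<Psi> n x) (\<Psi> n y)) \<longlongrightarrow> cinner (P x) y) U"
    by (rule lift_to_ultrapower[OF U, of "\<lambda>i. F (X i)" v, OF v', folded P_def]) blast
  have P: "bounded_clinear P" unfolding P_def by (rule bcl_theta[OF U gv gv])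
  have P_sa: "cinner (P x) y = cinner x (P y)" for x y unfolding P_def by (rule theta_adjoint[OF U gv gv])
  have PP: "P (P x) = P x" for x unfolding P_def by (rule theta_proj_idem[OF U gv])
  have Pv: "P (v i) = v i" for i
  proof -
    have e: "v i = (\<Sum>j<Suc i. scaleC (cinner (v i) (gs v j)) (gs v j))" by (rule gs_expand)
    have "P (\<Sum>j<Suc i. scaleC (cinner (v i) (gs v j)) (gs v j)) = (\<Sum>j<Suc i. scaleC (cinner (v i) (gs v j)) (gs v j))"
      unfolding bcl_sum[OF P] bcl_scaleC[OF P] unfolding P_def by (simp only: theta_basis[OF U gv gv])
    then show ?thesis by (simp only: e[symmetric])
  qed
  have P_perp: "P x = 0" if "\<And>i. cinner x (v i) = 0" for x
    unfolding P_def
  proof (rule theta_perp[OF U gv gv])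
    fix j show "cinner x (gs v j) = 0" using gs_perp_iff[of "Suc j" x v] that by blast
  qed
  have lift0: "((\<lambda>n. A n x) \<longlongrightarrow> 0) U"
    if "\<And>x y. ((\<lambda>n. cinner (A n x) (A n y)) \<longlongrightarrow> cinner (P x) y) U" "P x = 0" for A :: "nat \<Rightarrow> 'a \<Rightarrow> 'a" and x
    using that(1)[of x x] that(2) by (intro null_of_self_cinner) simp
  obtain J1 where J1: "bounded_clinear J1" "\<And>j. J1 (d j) = v (2 * j)" "\<And>x y. cinner (J1 x) (J1 y) = cinner x y"
    "\<And>x. ((\<lambda>n. \<Phi> n (J1 x) - x) \<longlongrightarrow> 0) U" "\<And>x. P (J1 x) = J1 x"
  proof (rule lift_isometry[OF U \<Phi>(1,2,4) P Pv dense, where s="\<lambda>j. 2 * j"])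
    show "((\<lambda>n. \<Phi> n (v (2 * j)) - d j) \<longlongrightarrow> 0) U" for j using \<Phi>(3)[of "2 * j"] by (simp add: X_def)
  qed blast
  obtain J2 where J2: "bounded_clinear J2" "\<And>j. J2 (d j) = v (2 * j + 1)" "\<And>x y. cinner (J2 x) (J2 y) = cinner x y"
    "\<And>x. ((\<lambda>n. \<Psi> n (J2 x) - x) \<longlongrightarrow> 0) U" "\<And>x. P (J2 x) = J2 x"
  proof (rule lift_isometry[OF U \<Psi>(1,2,4) P Pv dense, where s="\<lambda>j. 2 * j + 1"])
    show "((\<lambda>n. \<Psi> n (v (2 * j + 1)) - d j) \<longlongrightarrow> 0) U" for j
      using null_trans[OF \<Psi>(3)[of "2 * j + 1"]] s.FG[OF bseq_const[of "d j"]] by (simp add: X_def)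
  qed blast
  have \<Phi>J2: "((\<lambda>n. \<Phi> n (J2 y) - G (\<lambda>k. y) n) \<longlongrightarrow> 0) U" for y
    by (rule s.lift_G[OF \<Phi>(1,2) J2(1,3) dense]) (use \<Phi>(3)[of "2 * _ + 1"] in \<open>simp add: J2(2) X_def\<close>)
  have \<Psi>J1: "((\<lambda>n. \<Psi> n (J1 y) - F (\<lambda>k. y) n) \<longlongrightarrow> 0) U" for y
    by (rule r.lift_G[OF \<Psi>(1,2) J1(1,3) dense]) (use \<Psi>(3)[of "2 * _"] in \<open>simp add: J1(2) X_def\<close>)
  have vJ: "v i \<in> range J1 \<union> range J2" for i
  proof (cases "even i")
    case True then show ?thesis using J1(2)[of "i div 2"] by (metis UnI1 dvd_mult_div_cancel rangeI)
  next
    case False then show ?thesis using J2(2)[of "i div 2"] by (metis UnI2 odd_two_times_div_two_succ rangeI)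
  qed
  have bound: "norm (cadjoint (\<Phi> n) (A (\<Phi> n x))) \<le> k * norm x"
    if "0 < k" "\<And>x. norm (A x) \<le> k * norm x" for A :: "'a \<Rightarrow> 'a" and k n x
  proof -
    have "norm (cadjoint (\<Phi> n) (A (\<Phi> n x))) \<le> 1 * norm (A (\<Phi> n x))"
      by (rule cadjoint_norm_bound[OF \<Phi>(1)]) (simp_all add: \<Phi>(2))
    then show ?thesis
      using order_trans[OF that(2)[of "\<Phi> n x"] mult_left_mono[OF \<Phi>(2)[of n x] less_imp_le[OF that(1)]]] by simp
  qed
  obtain k where k: "0 < k" "\<And>x. norm (T1 x) \<le> k * norm x" by (rule bcl_bound[OF T1]) blast
  \<comment> \<open>The compression of the ultrapower of \<open>T1\<close> to \<open>K\<close>. The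
    relations \<open>RJ\<close> and \<open>RsJ\<close> on the generators then show that
    \<open>K\<close> reduces it.\<close>
  obtain R where R: "bounded_clinear R"
    and R0: "\<And>x y. ((\<lambda>n. cinner (cadjoint (\<Phi> n) (T1 (\<Phi> n x))) y) \<longlongrightarrow> cinner (R x) y) U"
  proof (rule weak_ultralimit[OF U, of "\<lambda>n x. cadjoint (\<Phi> n) (T1 (\<Phi> n x))" k])
    show "bounded_clinear (\<lambda>x. cadjoint (\<Phi> n) (T1 (\<Phi> n x)))" for n
      by (rule bcl_compose[OF bcl_cadjoint[OF \<Phi>(1)] bcl_compose[OF T1 \<Phi>(1)]])
  qed (use bound[OF k] in auto)
  have R1: "((\<lambda>n. cinner (T1 (\<Phi> n x)) (\<Phi> n y)) \<longlongrightarrow> cinner (R x) y) U" for x y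
    using R0[of x y] by (simp add: cadjoint_left[OF \<Phi>(1)])
  have R2: "((\<lambda>n. cinner (cadjoint T1 (\<Phi> n x)) (\<Phi> n y)) \<longlongrightarrow> cinner (cadjoint R x) y) U" for x y
    using tendsto_cnj[OF R1[of y x]]
    by (simp add: cinner_commute[symmetric] cadjoint_left[OF T1] cadjoint_left[OF R])
  have \<Phi>b: "bseq (\<lambda>n. \<Phi> n y)" for y using \<Phi>(2)[of _ y] by (auto simp: bseq_iff)
  have eqI: "B x = z"
    if B: "\<And>y. ((\<lambda>n. cinner (A (\<Phi> n x)) (\<Phi> n y)) \<longlongrightarrow> cinner (B x) y) U"
      and n: "((\<lambda>n. A (\<Phi> n x) - \<Phi> n z) \<longlongrightarrow> 0) U" and z: "P z = z" for A B :: "'a \<Rightarrow> 'a" and x z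
  proof (rule cinner_eqI)
    fix y
    have "((\<lambda>n. cinner (A (\<Phi> n x)) (\<Phi> n y)) \<longlongrightarrow> cinner (P z) y) U"
      by (rule limit_transfer[OF null_cinner_left[OF n \<Phi>b] \<Phi>(4)])
    then show "cinner (B x) y = cinner z y" using tendsto_unique[OF nb B] by (simp add: z)
  qed
  have RJ: "R (J1 x) = J1 (T1 x)" "R (J2 x) = J2 (T2 x)" for x
    by (rule eqI[OF R1 _ J1(5)] eqI[OF R1 _ J2(5)]; rule s.lift_intertwines[of \<Phi> J1 J2, OF J1(4) \<Phi>J2])+
  have RsJ: "cadjoint R (J1 x) = J1 (cadjoint T1 x)" "cadjoint R (J2 x) = J2 (cadjoint T2 x)" for x
    by (rule eqI[OF R2 _ J1(5)] eqI[OF R2 _ J2(5)]; rule sa.lift_intertwines[of \<Phi> J1 J2, OF J1(4) \<Phi>J2])+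
  have \<Phi>0: "((\<lambda>n. \<Phi> n x) \<longlongrightarrow> 0) U" if "P x = 0" for x by (rule lift0[OF \<Phi>(4) that])
  have \<Psi>0: "((\<lambda>n. \<Psi> n x) \<longlongrightarrow> 0) U" if "P x = 0" for x by (rule lift0[OF \<Psi>(4) that])
  have ker: "B x = 0"
    if B: "\<And>y. ((\<lambda>n. cinner (A (\<Phi> n x)) (\<Phi> n y)) \<longlongrightarrow> cinner (B x) y) U"
      and A: "bounded_clinear A" and x: "P x = 0" for A B :: "'a \<Rightarrow> 'a" and x
    by (rule eqI[where B=B, OF B])
      (use bcl_tendsto[OF A \<Phi>0[OF x]] in \<open>simp_all add: bcl_zero[OF A] bcl_zero[OF \<Phi>(1)] bcl_zero[OF P]\<close>)
  note T1s = bcl_cadjoint[OF T1] and Rs = bcl_cadjoint[OF R]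
  have RP: "R (P x) = R x" for x
    using ker[where A=T1 and B=R and x="x - P x", OF R1 T1] by (simp add: bcl_diff[OF P] PP bcl_diff[OF R])
  have RsP: "cadjoint R (P x) = cadjoint R x" for x
    using ker[where A="cadjoint T1" and B="cadjoint R" and x="x - P x", OF R2 T1s] by (simp add: bcl_diff[OF P] PP bcl_diff[OF Rs])
  have PR: "P (R x) = R x" for x
    by (rule cinner_eqI) (simp add: P_sa cadjoint_right[OF R, symmetric] RsP)
  have vJ': "v i \<in> range J2 \<union> range J1" for i using vJ by blast
  have R_perp: "R x = 0" "cadjoint R x = 0" if "\<And>i. cinner x (v i) = 0" for x
    using ker[where A=T1 and B=R, OF R1 T1] ker[where A="cadjoint T1" and B="cadjoint R", OF R2 T1s] P_perp[OF that]
    by simp_all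
  have lift_perp: "((\<lambda>n. \<Phi> n x) \<longlongrightarrow> 0) U" "((\<lambda>n. \<Psi> n x) \<longlongrightarrow> 0) U" if "\<And>i. cinner x (v i) = 0" for x
    using \<Phi>0 \<Psi>0 P_perp[OF that] by simp_all
  have d1: "((\<lambda>n. T1 (\<Phi> n x) - \<Phi> n (R x)) \<longlongrightarrow> 0) U" for x
    by (rule s.lift_defect[where v=v, OF U \<Phi>(1,2) J1(4) \<Phi>J2 R RJ vJ]) (intro conjI R_perp lift_perp)
  have d2: "((\<lambda>n. cadjoint T1 (\<Phi> n x) - \<Phi> n (cadjoint R x)) \<longlongrightarrow> 0) U" for x
    by (rule sa.lift_defect[where v=v, OF U \<Phi>(1,2) J1(4) \<Phi>J2 Rs RsJ vJ]) (intro conjI R_perp lift_perp)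
  have d3: "((\<lambda>n. T2 (\<Psi> n x) - \<Psi> n (R x)) \<longlongrightarrow> 0) U" for x
    by (rule r.lift_defect[where v=v, OF U \<Psi>(1,2) J2(4) \<Psi>J1 R RJ(2,1) vJ']) (intro conjI R_perp lift_perp)
  have d4: "((\<lambda>n. cadjoint T2 (\<Psi> n x) - \<Psi> n (cadjoint R x)) \<longlongrightarrow> 0) U" for x
    by (rule ra.lift_defect[where v=v, OF U \<Psi>(1,2) J2(4) \<Psi>J1 Rs RsJ(2,1) vJ']) (intro conjI R_perp lift_perp)
  have "absorption U T1 R P J1 \<Phi> d b"
    by standard (fact U T1 R P J1 P_sa PP PR RP RJ RsJ \<Phi> d1 d2 dense b)+
  moreover have "absorption U T2 R P J2 \<Psi> d b"
    by standard (fact U T2 R P J2 P_sa PP PR RP RJ RsJ \<Psi> d3 d4 dense b)+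
  ultimately show ?thesis by (rule that)
qed

text \<open>The unitaries \<open>W n\<close>, applied coordinatewise, induce a unitary of the
  ultrapower. The free ultrafilter refines \<open>sequentially\<close>, so operator norms tending to
  0 make the defect null on bounded sequences.\<close>

lemma approx_imp_ultra_equivalent:
  assumes U: "free_ultrafilter U" and T1: "bounded_clinear T1" and T2: "bounded_clinear T2"
    and a: "approx_unitarily_equivalent T1 T2"
  shows "ultra_unitarily_equivalent U T1 T2"
proof -
  obtain W where W: "\<And>n. unitary_op (W n)"
    and lim: "(\<lambda>n. onorm (\<lambda>x. T2 x - W n (T1 (cadjoint (W n) x)))) \<longlonglongrightarrow> 0"
    using a unfolding approx_unitarily_equivalent_def by blast
  have Wb: "bounded_clinear (W n)" for n using W by (simp add: unitary_op_def)
  define V where "V n = cadjoint (W n)" for n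
  have VW: "V n (W n x) = x" and WV: "W n (V n x) = x" for n x
  proof -
    obtain V' where V': "is_cadjoint V' (W n)" "V' \<circ> W n = id" "W n \<circ> V' = id"
      using W[of n] unfolding unitary_op_def by blast
    have "V n = V'" unfolding V_def
      by (rule cadjoint_eqI[OF Wb]) (use V'(1) in \<open>simp add: is_cadjoint_def\<close>)
    then show "V n (W n x) = x" "W n (V n x) = x" using V'(2,3) by (metis comp_apply id_apply)+
  qed
  have Vb: "bounded_clinear (V n)" for n unfolding V_def by (rule bcl_cadjoint[OF Wb])
  have Vadj: "cinner (V n x) y = cinner x (W n y)" for n x y unfolding V_def by (rule cadjoint_left[OF Wb])
  have nV: "norm (V n x) = norm x" for n x by (rule norm_eqI_cinner) (simp add: Vadj WV)
  have nW: "norm (W n x) = norm x" for n x by (rule norm_eqI_cinner) (simp add: Vadj[symmetric] VW)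
  have ubc: "ultra_bounded_clinear U (\<lambda>X n. A n (X n))"
    if A: "\<And>n. bounded_clinear (A n)" and n: "\<And>n x. norm (A n x) = norm x" for A :: "nat \<Rightarrow> 'a \<Rightarrow> 'a"
    unfolding ultra_bounded_clinear_def
  proof (intro conjI allI impI exI[of _ 1])
    show "bseq X \<Longrightarrow> bseq (\<lambda>k. A k (X k))" for X by (simp add: bseq_iff n)
    show "bseq X \<and> bseq Y \<and> unull U (\<lambda>n. X n - Y n) \<Longrightarrow> unull U (\<lambda>n. A n (X n) - A n (Y n))" for X Y
      by (simp add: unull_def n flip: bcl_diff[OF A])
  qed (simp_all add: bcl_add[OF A] bcl_scaleC[OF A] unull_def n)
  show ?thesis
    unfolding ultra_unitarily_equivalent_def
  proof (intro exI conjI allI impI)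
    show "ultra_bounded_clinear U (\<lambda>X n. W n (X n))" by (rule ubc[OF Wb nW])
    show "ultra_bounded_clinear U (\<lambda>X n. V n (X n))" by (rule ubc[OF Vb nV])
    fix X :: "nat \<Rightarrow> 'a" assume X: "bseq X"
    then obtain K where K: "\<And>n. norm (X n) \<le> K" by (auto simp: bseq_iff)
    define E where "E n x = T2 x - W n (T1 (V n x))" for n x
    have E: "norm (E n x) \<le> onorm (E n) * norm x" for n x
      unfolding E_def
      by (rule onorm[OF bcl_bounded_linear[OF bcl_minus_fun[OF T2 bcl_compose[OF Wb bcl_compose[OF T1 Vb]]]]])
    have "((\<lambda>n. onorm (E n)) \<longlongrightarrow> 0) U"
      by (rule tendsto_mono[OF free_ultrafilter_le_sequentially[OF U]]) (use lim in \<open>simp add: E_def[abs_def] V_def\<close>)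
    then have "((\<lambda>n. E n (X n)) \<longlongrightarrow> 0) U"
    proof (rule tendsto_0_le[where K=K], intro always_eventually allI)
      fix n
      have "onorm (E n) * norm (X n) \<le> \<bar>onorm (E n)\<bar> * K"
        by (intro mult_mono K) auto
      then show "norm (E n (X n)) \<le> norm (onorm (E n)) * K" using E[of n "X n"] by simp
    qed
    then show "unull U (\<lambda>n. uop T2 X n - W n (uop T1 (\<lambda>n. V n (X n)) n))"
      by (simp add: unull_iff E_def uop_def)
  qed (simp_all add: Vadj VW WV unull_def)
qed

theorem theorem3p5:
  fixes T1 T2 :: "'a::chilbert \<Rightarrow> 'a" and U :: "nat filter"
  assumes separable: "\<exists>D :: 'a set. countable D \<and> closure D = UNIV"
    and infinite_dim: "\<forall>S :: 'a set. finite S \<longrightarrow> cspan S \<noteq> UNIV"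
    and ultra: "free_ultrafilter U"
    and T1: "bounded_clinear T1"
    and T2: "bounded_clinear T2"
  shows "approx_unitarily_equivalent T1 T2 \<longleftrightarrow> ultra_unitarily_equivalent U T1 T2"
proof
  assume "ultra_unitarily_equivalent U T1 T2"
  then obtain F G where I: "ultra_intertwiner U T1 T2 F G"
    using ultra_unitarily_equivalentD[OF ultra T1 T2] by blast
  obtain D :: "'a set" where D: "countable D" "closure D = UNIV" using separable by blast
  have "D \<noteq> {}" using D(2) by auto
  then have d: "closure (range (from_nat_into D)) = UNIV" using D by (simp add: range_from_nat_into)
  obtain b :: "nat \<Rightarrow> 'a" where b: "ortho_family b" "\<And>i. norm (b i) = 1"
    by (rule exists_orthonormal_sequence[OF infinite_dim]) blast
  obtain P R J1 J2 \<Phi> \<Psi> where a1: "absorption U T1 R P J1 \<Phi> (from_nat_into D) b"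
    and a2: "absorption U T2 R P J2 \<Psi> (from_nat_into D) b"
    by (rule absorbers_of_intertwiner[OF ultra I d b]) blast
  have "\<exists>W. unitary_op W \<and> small_compact (1 / real (Suc n)) (\<lambda>x. T2 x - W (T1 (cadjoint W x)))" for n
  proof -
    \<comment> \<open>The two absorptions share the allowed error equally.\<close>
    define e where "e = 1 / real (Suc n) / 2"
    have e: "0 < e" "e + e = 1 / real (Suc n)" unfolding e_def by (simp, simp only: field_sum_of_halves)
    obtain W1 where W1: "bounded_clinear W1" "\<And>x. norm (W1 x) \<le> norm x" "\<And>x. cadjoint W1 (W1 x) = P x"
      "\<And>y. W1 (cadjoint W1 y) = y" "small_compact e (\<lambda>x. T1 (W1 x) - W1 (R x))"
      using absorption.absorb[OF a1 e(1)] by blast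
    obtain W2 where W2: "bounded_clinear W2" "\<And>x. norm (W2 x) \<le> norm x" "\<And>x. cadjoint W2 (W2 x) = P x"
      "\<And>y. W2 (cadjoint W2 y) = y" "small_compact e (\<lambda>x. T2 (W2 x) - W2 (R x))"
      using absorption.absorb[OF a2 e(1)] by blast
    show ?thesis
      using approx_unitary_of_absorbers[OF T1 T2 absorption.PR[OF a1] W1 W2] unfolding e(2) .
  qed
  then obtain W where W: "\<And>n. unitary_op (W n)"
    and sm: "\<And>n. small_compact (1 / real (Suc n)) (\<lambda>x. T2 x - W n (T1 (cadjoint (W n) x)))" by metis
  have "(\<lambda>n. onorm (\<lambda>x. T2 x - W n (T1 (cadjoint (W n) x)))) \<longlonglongrightarrow> 0"
  proof (rule tendsto_sandwich[OF always_eventually always_eventually tendsto_const LIMSEQ_inverse_real_of_nat], safe)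
    fix n
    show "0 \<le> onorm (\<lambda>x. T2 x - W n (T1 (cadjoint (W n) x)))"
      by (rule onorm_pos_le[OF bcl_bounded_linear[OF small_compactD(2)[OF sm]]])
    show "onorm (\<lambda>x. T2 x - W n (T1 (cadjoint (W n) x))) \<le> inverse (real (Suc n))"
      using small_compactD(3)[OF sm[of n]] by (intro onorm_bound) (auto simp: inverse_eq_divide)
  qed
  then show "approx_unitarily_equivalent T1 T2"
    unfolding approx_unitarily_equivalent_def
    using W small_compact_imp_compact_op[OF sm] by (intro exI[of _ W]) blast
qed (rule approx_imp_ultra_equivalent[OF ultra T1 T2])

end
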